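(* Let $R$ be a measurable function on the unit circle $\mathbb{T}$ with $|R(t)|\le 1$ and $\log(1-|R|)\in L^1(\mathbb{T})$. Let $Z=\{\zeta_k\}\subset\mathbb{D}\setminus\{0\}$ be a (finite or countable) set of distinct points with $\sum_k(1-|\zeta_k|)<\infty$, and let $\nu$ be a positive (not necessarily finite) measure supported on $Z$ with $\nu(\zeta_k)=\nu_k>0$. Put $\alpha=\{R,\nu\}$ and, for $n\ge 0$, $\alpha_n=\{\zeta^nR(\zeta),\,|\zeta|^{2n}\nu(\zeta)\}$. Let $K^{\alpha_n}=k^{\alpha_n}/\|k^{\alpha_n}\|$ be the normalized reproducing kernel at the origin of the space $H^2(\alpha_n)$. Then $$K^{\alpha_n}(0)\to 1,\qquad n\to\infty .$$
   Context: $\mathbb{D}$ is the open unit disk, $L^2=L^2(\mathbb{T})$ is taken with respect to normalized Lebesgue measure with standard inner product $\langle\cdot,\cdot\rangle$, $H^2$ is the Hardy space, $H^2_-=L^2\ominus H^2$, and $P_-$ is the orthogonal projection of $L^2$ onto $H^2_-$. For data $\alpha=\{R,\nu\}$ as in the claim, let $\Gamma=\Gamma_R:H^2\to H^2_-$, $\Gamma f=P_-(Rf)$, be the Hankel operator with symbol $R$. Call $f\in H^2$ admissible if $f$ vanishes at all points of $Z$ except for a finite number of them. On admissible functions one considers the scalar product given by $$\langle D(\alpha)f,f\rangle=\langle (I-\Gamma^*\Gamma)f,f\rangle+\sum_k|f(\zeta_k)|^2\nu_k .$$ $H^2(\alpha)$ denotes the closure (completion) of the admissible functions with respect to this metric.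 The condition $\log(1-|R|)\in L^1$ guarantees that for every $\zeta_0\in\mathbb{D}$ the point evaluation $f\mapsto f(\zeta_0)$ is bounded in this metric, hence extends to $H^2(\alpha)$. $k^\alpha$ denotes the reproducing kernel of $H^2(\alpha)$ with respect to the origin, i.e. the element with $\langle f,k^\alpha\rangle_{H^2(\alpha)}=f(0)$ for all $f\in H^2(\alpha)$, and $K^\alpha=k^\alpha/\|k^\alpha\|$ with the norm of $H^2(\alpha)$. The data $\alpha_n$ consist of the symbol $t\mapsto t^nR(t)$ on $\mathbb{T}$ and the measure with mass $|\zeta_k|^{2n}\nu_k$ at each $\zeta_k\in Z$. *)

theory Defs
  imports "HOL-Analysis.Analysis"
begin

section \<open>The Hardy space on the unit circle\<close>

text \<open>Normalized Lebesgue measure on the unit circle, with all Lebesgue measurable sets.\<close>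

definition circle_measure :: "complex measure" where
  "circle_measure = completion
     (distr (uniform_measure lborel {0..2*pi}) (restrict_space borel (sphere 0 1)) cis)"

text \<open>\<open>ln 0\<close> has a real value in HOL, so \<open>ln g \<in> L\<^sup>1\<close> must state separately that \<open>g\<close> is almost
  everywhere positive.\<close>

definition log_in_L1 :: "(complex \<Rightarrow> real) \<Rightarrow> bool" where
  "log_in_L1 g \<longleftrightarrow> (AE t in circle_measure. 0 < g t) \<and> integrable circle_measure (\<lambda>t. ln (g t))"

text \<open>Elements of \<open>L\<^sup>2\<close> are represented by functions rather than by classes modulo almost
  everywhere equality; the objects below that are introduced by choice are unique up to this
  equality.\<close>

definition L2 :: "(complex \<Rightarrow> complex) set" where
  "L2 = {f \<in> borel_measurable circle_measure. integrable circle_measure (\<lambda>t. (cmod (f t))\<^sup>2)}"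

definition L2_inner :: "(complex \<Rightarrow> complex) \<Rightarrow> (complex \<Rightarrow> complex) \<Rightarrow> complex" where
  "L2_inner f g = (LINT t|circle_measure. f t * cnj (g t))"

definition fourier_coeff :: "(complex \<Rightarrow> complex) \<Rightarrow> int \<Rightarrow> complex" where
  "fourier_coeff f m = L2_inner f (\<lambda>t. t powi m)"

definition H2 :: "(complex \<Rightarrow> complex) set" where
  "H2 = {f \<in> L2. \<forall>m<0. fourier_coeff f m = 0}"

definition H2_minus :: "(complex \<Rightarrow> complex) set" where
  "H2_minus = {h \<in> L2. \<forall>f\<in>H2. L2_inner h f = 0}"

text \<open>The value at a point of the open unit disk of the holomorphic function with boundary
  values \<open>f \<in> H\<^sup>2\<close>.\<close>

definition disk_value :: "(complex \<Rightarrow> complex) \<Rightarrow> complex \<Rightarrow> complex" where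
  "disk_value f z = (\<Sum>m. fourier_coeff f (int m) * z ^ m)"

definition orth_proj :: "(complex \<Rightarrow> complex) set \<Rightarrow> (complex \<Rightarrow> complex) \<Rightarrow> complex \<Rightarrow> complex" where
  "orth_proj S g = (SOME h. h \<in> S \<and> (\<forall>u\<in>S. L2_inner (\<lambda>t. g t - h t) u = 0))"

definition hankel :: "(complex \<Rightarrow> complex) \<Rightarrow> (complex \<Rightarrow> complex) \<Rightarrow> complex \<Rightarrow> complex" where
  "hankel R f = orth_proj H2_minus (\<lambda>t. R t * f t)"

definition hankel_adjoint :: "(complex \<Rightarrow> complex) \<Rightarrow> (complex \<Rightarrow> complex) \<Rightarrow> complex \<Rightarrow> complex" where
  "hankel_adjoint R h = (SOME u. u \<in> H2 \<and> (\<forall>f\<in>H2. L2_inner u f = L2_inner h (hankel R f)))"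

section \<open>Hilbert space completion\<close>

text \<open>The completion of a space \<open>V\<close> of functions with a scalar product \<open>B\<close> (linear in the first
  argument): Cauchy sequences in \<open>V\<close> modulo sequences tending to zero. Scalar product, scalar
  multiplication and extended functionals are given by limits along representatives.\<close>

type_synonym form = "(complex \<Rightarrow> complex) \<Rightarrow> (complex \<Rightarrow> complex) \<Rightarrow> complex"
type_synonym compl_elem = "(nat \<Rightarrow> complex \<Rightarrow> complex) set"

definition form_norm :: "form \<Rightarrow> (complex \<Rightarrow> complex) \<Rightarrow> real" where
  "form_norm B f = sqrt (Re (B f f))"

definition cauchy_seqs :: "(complex \<Rightarrow> complex) set \<Rightarrow> form \<Rightarrow> (nat \<Rightarrow> complex \<Rightarrow> complex) set" where
  "cauchy_seqs V B = {x. (\<forall>j. x j \<in> V) \<and>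
     (\<forall>e>0. \<exists>N. \<forall>i\<ge>N. \<forall>j\<ge>N. form_norm B (\<lambda>t. x i t - x j t) < e)}"

definition cauchy_rel :: "(complex \<Rightarrow> complex) set \<Rightarrow> form \<Rightarrow> (nat \<Rightarrow> complex \<Rightarrow> complex) rel" where
  "cauchy_rel V B = {(x, y). x \<in> cauchy_seqs V B \<and> y \<in> cauchy_seqs V B \<and>
     (\<lambda>j. form_norm B (\<lambda>t. x j t - y j t)) \<longlonglongrightarrow> 0}"

definition hilbert_completion :: "(complex \<Rightarrow> complex) set \<Rightarrow> form \<Rightarrow> compl_elem set" where
  "hilbert_completion V B = cauchy_seqs V B // cauchy_rel V B"

definition compl_inner :: "form \<Rightarrow> compl_elem \<Rightarrow> compl_elem \<Rightarrow> complex" where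
  "compl_inner B X Y = (THE c. \<forall>x\<in>X. \<forall>y\<in>Y. (\<lambda>j. B (x j) (y j)) \<longlonglongrightarrow> c)"

definition compl_norm :: "form \<Rightarrow> compl_elem \<Rightarrow> real" where
  "compl_norm B X = sqrt (Re (compl_inner B X X))"

definition compl_scale :: "(complex \<Rightarrow> complex) set \<Rightarrow> form \<Rightarrow> complex \<Rightarrow> compl_elem \<Rightarrow> compl_elem" where
  "compl_scale V B c X = (\<Union>x\<in>X. cauchy_rel V B `` {\<lambda>j t. c * x j t})"

definition compl_extend :: "((complex \<Rightarrow> complex) \<Rightarrow> complex) \<Rightarrow> compl_elem \<Rightarrow> complex" where
  "compl_extend \<phi> X = (THE c. \<forall>x\<in>X. (\<lambda>j. \<phi> (x j)) \<longlonglongrightarrow> c)"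

section \<open>The space \<open>H\<^sup>2(\<alpha>)\<close> for the data \<open>\<alpha> = {R, \<nu>}\<close>\<close>

text \<open>The measure \<open>\<nu>\<close> is given by its support \<open>Z\<close> and its point masses \<open>\<nu> \<zeta>\<close> for \<open>\<zeta> \<in> Z\<close>;
  values of \<open>\<nu>\<close> outside \<open>Z\<close> play no role.\<close>

definition admissible :: "complex set \<Rightarrow> (complex \<Rightarrow> complex) set" where
  "admissible Z = {f \<in> H2. finite {\<zeta>\<in>Z. disk_value f \<zeta> \<noteq> 0}}"

text \<open>The sesquilinear form obtained by polarization from
  \<open>\<langle>(I - \<Gamma>\<^sup>*\<Gamma>)f, f\<rangle> + \<Sum>\<^sub>k |f(\<zeta>\<^sub>k)|\<^sup>2 \<nu>\<^sub>k\<close>. The sum has only finitely many nonzero terms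
  on admissible functions.\<close>

definition D_form :: "(complex \<Rightarrow> complex) \<Rightarrow> complex set \<Rightarrow> (complex \<Rightarrow> real) \<Rightarrow> form" where
  "D_form R Z \<nu> f g =
     L2_inner (\<lambda>t. f t - hankel_adjoint R (hankel R f) t) g
     + (\<Sum>\<^sub>\<infinity>\<zeta>\<in>Z. disk_value f \<zeta> * cnj (disk_value g \<zeta>) * of_real (\<nu> \<zeta>))"

definition H2_space :: "(complex \<Rightarrow> complex) \<Rightarrow> complex set \<Rightarrow> (complex \<Rightarrow> real) \<Rightarrow> compl_elem set" where
  "H2_space R Z \<nu> = hilbert_completion (admissible Z) (D_form R Z \<nu>)"

definition point_eval :: "complex \<Rightarrow> compl_elem \<Rightarrow> complex" where
  "point_eval z = compl_extend (\<lambda>f. disk_value f z)"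

definition repr_kernel :: "(complex \<Rightarrow> complex) \<Rightarrow> complex set \<Rightarrow> (complex \<Rightarrow> real) \<Rightarrow> compl_elem" where
  "repr_kernel R Z \<nu> = (THE k. k \<in> H2_space R Z \<nu> \<and>
     (\<forall>f\<in>H2_space R Z \<nu>. compl_inner (D_form R Z \<nu>) f k = point_eval 0 f))"

definition normalized_kernel ::
    "(complex \<Rightarrow> complex) \<Rightarrow> complex set \<Rightarrow> (complex \<Rightarrow> real) \<Rightarrow> compl_elem" where
  "normalized_kernel R Z \<nu> = compl_scale (admissible Z) (D_form R Z \<nu>)
     (of_real (1 / compl_norm (D_form R Z \<nu>) (repr_kernel R Z \<nu>))) (repr_kernel R Z \<nu>)"

end

(* The value of K at the origin is the supremum of |f(0)| over admissible f of D-norm at most 1,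
   so it is enough to bound |f(0)| by the D-norm for large n, in both directions.

   Lower bound: the Blaschke product of all zeros outside a finite set F is admissible, its D-norm
   squared is at most 1 plus the contribution of F, which tends to zero, and its value at the
   origin is as close to 1 as we like.

   Upper bound: let S = t^n R and p = P_-(S f). Then
     ||f||^2 - ||p||^2 = ||f - conj(S) p||^2 + int (1 - |R|^2) |p|^2.
   By log(1 - |R|) in L^1 there is an analytic psi with |psi| <= 1, |psi|^2 <= N^2 (1 - |R|^2) and
   psi(0) close to 1. In psi(0) f(0) = int psi (f - conj(S) p) + int psi conj(S) p the first integral
   is at most ||f - conj(S) p||, and the second is the scalar product of conj(psi) p, an element of
   H^2_- of norm at most N times the D-norm of f, with t^n R conj(psi) / psi, whose projection onto
   H^2_- tends to zero. *)

theory Submission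
  imports Defs
begin

text \<open>The obstacle is that I - \<Gamma>*\<Gamma> need not be bounded below, because |R| may
  come arbitrarily close to 1; the D-norm then controls neither ||f|| nor ||p||. It does control p
  in the weight 1 - |R|^2, and multiplication by conj(psi) turns this into an ordinary L^2 bound. On
  the circle |t^n R| = |R|, so one pair psi, N serves every n, and t^n is left only in front of the
  fixed function R conj(psi) / psi. For fixed psi the limit in n bounds the limit superior of the
  kernel values by 1 / |psi(0)|; psi is improved only afterwards, since N may grow as psi(0)
  approaches 1. The model for psi is the outer function of modulus min(1, N sqrt(1 - |R|)). Minus
  the logarithm of its value at the origin is the integral of max(0, - ln N - ln(1 - |R|) / 2),
  which tends to 0 as N grows because ln(1 - |R|) is integrable. An analytic function below this
  modulus with almost the same value at the origin is assembled as an infinite product of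
  exponentials of polynomials. The lemma on infinite products that gives it also gives the Blaschke
  products.\<close>

section \<open>Semi-inner products and their completions\<close>

text \<open>Elements are functions, not classes, so \<open>B\<close> is only positive semidefinite
  and \<open>nf\<close> may vanish on nonzero functions; passing to classes is left to the
  completion. The instances are \<open>L2\<close> with \<open>L2_inner\<close> and
  \<open>admissible Z\<close> with \<open>D_form\<close>.\<close>

locale semi_inner_space =
  fixes V :: "(complex \<Rightarrow> complex) set" and B :: form
  assumes V_add: "f \<in> V \<Longrightarrow> g \<in> V \<Longrightarrow> (\<lambda>t. f t + g t) \<in> V"
    and V_scale: "f \<in> V \<Longrightarrow> (\<lambda>t. c * f t) \<in> V"
    and B_add: "f \<in> V \<Longrightarrow> g \<in> V \<Longrightarrow> h \<in> V \<Longrightarrow> B (\<lambda>t. f t + g t) h = B f h + B g h"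
    and B_scale: "f \<in> V \<Longrightarrow> h \<in> V \<Longrightarrow> B (\<lambda>t. c * f t) h = c * B f h"
    and B_herm: "f \<in> V \<Longrightarrow> g \<in> V \<Longrightarrow> B g f = cnj (B f g)"
    and B_pos: "f \<in> V \<Longrightarrow> 0 \<le> Re (B f f)"
begin

abbreviation nf :: "(complex \<Rightarrow> complex) \<Rightarrow> real" where "nf \<equiv> form_norm B"

lemma V_diff: "f \<in> V \<Longrightarrow> g \<in> V \<Longrightarrow> (\<lambda>t. f t - g t) \<in> V"
  using V_add[of f "\<lambda>t. (-1) * g t"] V_scale[of g "-1"] by simp

lemma B_diff: "f \<in> V \<Longrightarrow> g \<in> V \<Longrightarrow> h \<in> V \<Longrightarrow> B (\<lambda>t. f t - g t) h = B f h - B g h"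
  using B_add[of f "\<lambda>t. (-1) * g t" h] V_scale[of g "-1"] B_scale[of g h "-1"] by simp

lemma B_diff_right: "f \<in> V \<Longrightarrow> g \<in> V \<Longrightarrow> h \<in> V \<Longrightarrow> B h (\<lambda>t. f t - g t) = B h f - B h g"
  by (subst B_herm) (auto simp: V_diff B_diff B_herm[of h] )

lemma B_add_right: "f \<in> V \<Longrightarrow> g \<in> V \<Longrightarrow> h \<in> V \<Longrightarrow> B h (\<lambda>t. f t + g t) = B h f + B h g"
  by (subst B_herm) (auto simp: V_add B_add B_herm[of h] )

lemma B_scale_right: "f \<in> V \<Longrightarrow> h \<in> V \<Longrightarrow> B h (\<lambda>t. c * f t) = cnj c * B h f"
  by (subst B_herm) (auto simp: V_scale B_scale B_herm[of h] )

lemma nf_nonneg: "f \<in> V \<Longrightarrow> 0 \<le> nf f"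
  by (simp add: form_norm_def B_pos)

lemma B_self: "f \<in> V \<Longrightarrow> B f f = of_real ((nf f)\<^sup>2)"
  using B_herm[of f f] B_pos[of f] by (auto simp: form_norm_def complex_eq_iff)

text \<open>The quadratic expansion behind Cauchy-Schwarz, the triangle inequality, the
  parallelogram law and the variational argument for the kernel.\<close>

lemma nf_diff_scale:
  assumes "f \<in> V" "g \<in> V"
  shows "(nf (\<lambda>t. f t - s * g t))\<^sup>2 = (nf f)\<^sup>2 - 2 * Re (cnj s * B f g) + (cmod s)\<^sup>2 * (nf g)\<^sup>2"
proof -
  have V: "(\<lambda>t. s * g t) \<in> V" "(\<lambda>t. f t - s * g t) \<in> V"
    using assms V_scale V_diff by auto
  have "complex_of_real ((nf (\<lambda>t. f t - s * g t))\<^sup>2)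
      = B f f - cnj s * B f g - s * (cnj (B f g) - cnj s * B g g)"
    unfolding B_self[OF V(2), symmetric]
    using assms V by (simp add: B_diff B_diff_right B_scale B_scale_right B_herm[of f g] algebra_simps)
  then have "(nf (\<lambda>t. f t - s * g t))\<^sup>2 = Re (B f f - cnj s * B f g - s * (cnj (B f g) - cnj s * B g g))"
    by (metis Re_complex_of_real)
  also have "\<dots> = (nf f)\<^sup>2 - 2 * Re (cnj s * B f g) + (cmod s)\<^sup>2 * (nf g)\<^sup>2"
    using assms by (simp add: B_self cmod_power2) (simp add: algebra_simps power2_eq_square)
  finally show ?thesis .
qed

lemma Cauchy_Schwarz:
  assumes "f \<in> V" "g \<in> V"
  shows "cmod (B f g) \<le> nf f * nf g"
proof -
  have Re_self: "Re (of_real r * cnj c * c) = r * (cmod c)\<^sup>2" for r c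
    unfolding cmod_power2 by (simp add: algebra_simps power2_eq_square)
  have ge: "0 \<le> (nf f)\<^sup>2 - 2 * Re (cnj s * B f g) + (cmod s)\<^sup>2 * (nf g)\<^sup>2" for s
    by (metis nf_diff_scale[OF assms] zero_le_power2)
  show ?thesis
  proof (cases "nf g = 0")
    \<comment> \<open>In the degenerate case the quadratic expression in s loses its last term and
      becomes affine, so a nonzero \<open>B f g\<close> would make it negative for large s.\<close>
    case True
    have "cmod (B f g) = 0"
    proof (rule ccontr)
      assume "cmod (B f g) \<noteq> 0"
      define r where "r = ((nf f)\<^sup>2 + 1) / (cmod (B f g))\<^sup>2"
      have "0 \<le> (nf f)\<^sup>2 - 2 * (r * (cmod (B f g))\<^sup>2)"
        using ge[of "of_real r * B f g"]
        unfolding complex_cnj_mult complex_cnj_complex_of_real Re_self by (simp add: True)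
      then show False
        using \<open>cmod (B f g) \<noteq> 0\<close> add_nonneg_pos[of "(nf f)\<^sup>2" 2] by (simp add: r_def)
    qed
    then show ?thesis using True by simp
  next
    case False
    \<comment> \<open>With this r, s = r * B f g minimizes the quadratic expression in s.\<close>
    define r where "r = 1 / (nf g)\<^sup>2"
    have r: "r * (nf g)\<^sup>2 = 1" using False by (simp add: r_def)
    have "0 \<le> (nf f)\<^sup>2 - 2 * (r * (cmod (B f g))\<^sup>2) + (r\<^sup>2 * (cmod (B f g))\<^sup>2) * (nf g)\<^sup>2"
      using ge[of "of_real r * B f g"]
      unfolding complex_cnj_mult complex_cnj_complex_of_real Re_self
      by (simp add: norm_mult power_mult_distrib)
    also have "(r\<^sup>2 * (cmod (B f g))\<^sup>2) * (nf g)\<^sup>2 = (r * (nf g)\<^sup>2) * (r * (cmod (B f g))\<^sup>2)"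
      by (simp add: power2_eq_square)
    finally have "r * (cmod (B f g))\<^sup>2 \<le> (nf f)\<^sup>2" using r by simp
    then have "(cmod (B f g))\<^sup>2 \<le> (nf f * nf g)\<^sup>2"
      using False by (simp add: r_def field_simps power_mult_distrib)
    then show ?thesis
      using assms by (simp add: nf_nonneg abs_le_square_iff[symmetric])
  qed
qed

lemma nf_scale: "f \<in> V \<Longrightarrow> nf (\<lambda>t. c * f t) = cmod c * nf f"
proof -
  assume f: "f \<in> V"
  have "complex_of_real ((nf (\<lambda>t. c * f t))\<^sup>2) = of_real ((cmod c * nf f)\<^sup>2)"
    unfolding B_self[OF V_scale[OF f], symmetric]
    using f by (simp add: V_scale B_scale B_scale_right B_self power_mult_distrib)
      (simp add: complex_norm_square[symmetric])
  then have "(nf (\<lambda>t. c * f t))\<^sup>2 = (cmod c * nf f)\<^sup>2"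
    using of_real_eq_iff by blast
  then show ?thesis
    using f by (simp add: nf_nonneg V_scale)
qed

lemma nf_triangle:
  assumes "f \<in> V" "g \<in> V"
  shows "nf (\<lambda>t. f t + g t) \<le> nf f + nf g"
proof -
  have "(nf (\<lambda>t. f t + g t))\<^sup>2 = (nf f)\<^sup>2 + 2 * Re (B f g) + (nf g)\<^sup>2"
    using nf_diff_scale[OF assms, of "-1"] by simp
  also have "\<dots> \<le> (nf f)\<^sup>2 + 2 * (nf f * nf g) + (nf g)\<^sup>2"
    using order_trans[OF complex_Re_le_cmod Cauchy_Schwarz[OF assms]] by simp
  also have "\<dots> = (nf f + nf g)\<^sup>2" by (simp add: power2_eq_square algebra_simps)
  finally show ?thesis
    using assms nf_nonneg by (meson add_nonneg_nonneg power2_le_imp_le)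
qed

lemma nf_minus_commute: "f \<in> V \<Longrightarrow> g \<in> V \<Longrightarrow> nf (\<lambda>t. f t - g t) = nf (\<lambda>t. g t - f t)"
  using nf_scale[of "\<lambda>t. g t - f t" "-1"] V_diff[of g f] by simp

lemma nf_triangle_diff:
  assumes "f \<in> V" "g \<in> V" "h \<in> V"
  shows "nf (\<lambda>t. f t - h t) \<le> nf (\<lambda>t. f t - g t) + nf (\<lambda>t. g t - h t)"
  using nf_triangle[OF V_diff[OF assms(1,2)] V_diff[OF assms(2,3)]] by simp

lemma nf_le_add_diff:
  assumes "f \<in> V" "g \<in> V"
  shows "nf f \<le> nf g + nf (\<lambda>t. f t - g t)"
  using nf_triangle[OF assms(2) V_diff[OF assms(1,2)]] by simp

lemma parallelogram:
  assumes "f \<in> V" "g \<in> V"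
  shows "(nf (\<lambda>t. f t - g t))\<^sup>2 + (nf (\<lambda>t. f t + g t))\<^sup>2 = 2 * (nf f)\<^sup>2 + 2 * (nf g)\<^sup>2"
  using nf_diff_scale[OF assms, of 1] nf_diff_scale[OF assms, of "-1"] by simp

lemma B_diff_bound:
  assumes "f \<in> V" "f' \<in> V" "g \<in> V" "g' \<in> V"
  shows "cmod (B f g - B f' g') \<le> nf (\<lambda>t. f t - f' t) * nf g + nf f' * nf (\<lambda>t. g t - g' t)"
proof -
  have "B f g - B f' g' = B (\<lambda>t. f t - f' t) g + B f' (\<lambda>t. g t - g' t)"
    using assms by (simp add: B_diff B_diff_right)
  then have "cmod (B f g - B f' g') \<le> cmod (B (\<lambda>t. f t - f' t) g) + cmod (B f' (\<lambda>t. g t - g' t))"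
    by (simp add: norm_triangle_ineq)
  also have "\<dots> \<le> nf (\<lambda>t. f t - f' t) * nf g + nf f' * nf (\<lambda>t. g t - g' t)"
    using assms by (intro add_mono Cauchy_Schwarz V_diff)
  finally show ?thesis .
qed

section \<open>Cauchy sequences and the scalar product on their classes\<close>

lemma cauchy_seqsD: "x \<in> cauchy_seqs V B \<Longrightarrow> x j \<in> V"
  by (simp add: cauchy_seqs_def)

lemma cauchy_seqs_less:
  assumes "x \<in> cauchy_seqs V B" "e > 0"
  obtains N where "\<And>i j. i \<ge> N \<Longrightarrow> j \<ge> N \<Longrightarrow> nf (\<lambda>t. x i t - x j t) < e"
  using assms unfolding cauchy_seqs_def by blast

lemma cauchy_seqs_bounded:
  assumes x: "x \<in> cauchy_seqs V B"
  obtains K where "K > 0" "\<And>j. nf (x j) \<le> K"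
proof -
  note V = cauchy_seqsD[OF x]
  obtain N where N: "\<And>i j. i \<ge> N \<Longrightarrow> j \<ge> N \<Longrightarrow> nf (\<lambda>t. x i t - x j t) < 1"
    using cauchy_seqs_less[OF x zero_less_one] by blast
  define K where "K = (\<Sum>i\<le>N. nf (x i)) + 1"
  have le: "nf (x i) \<le> (\<Sum>i\<le>N. nf (x i))" if "i \<le> N" for i
    using that by (intro member_le_sum) (auto simp: nf_nonneg V)
  have "nf (x j) \<le> K" for j
  proof (cases "j \<le> N")
    case True
    then show ?thesis using le[of j] by (simp add: K_def)
  next
    case False
    then have "nf (x j) \<le> nf (x N) + 1"
      using nf_le_add_diff[OF V V, of j N] N[of j N] by simp
    then show ?thesis using le[of N] by (simp add: K_def)
  qed
  moreover have "K > 0"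
    unfolding K_def by (intro add_nonneg_pos sum_nonneg) (auto simp: nf_nonneg V)
  ultimately show ?thesis using that by blast
qed

lemma cauchy_seqs_convergent:
  assumes x: "x \<in> cauchy_seqs V B" and y: "y \<in> cauchy_seqs V B"
  shows "convergent (\<lambda>j. B (x j) (y j))"
proof -
  note Vx = cauchy_seqsD[OF x] and Vy = cauchy_seqsD[OF y]
  obtain K where K: "K > 0" "\<And>j. nf (x j) \<le> K" using cauchy_seqs_bounded[OF x] by blast
  obtain L where L: "L > 0" "\<And>j. nf (y j) \<le> L" using cauchy_seqs_bounded[OF y] by blast
  have "Cauchy (\<lambda>j. B (x j) (y j))"
  proof (rule metric_CauchyI)
    fix e :: real assume e: "e > 0"
    obtain N1 where N1: "\<And>i j. i \<ge> N1 \<Longrightarrow> j \<ge> N1 \<Longrightarrow> nf (\<lambda>t. x i t - x j t) < e / (2 * L)"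
      using cauchy_seqs_less[OF x, of "e / (2 * L)"] e L(1) by auto
    obtain N2 where N2: "\<And>i j. i \<ge> N2 \<Longrightarrow> j \<ge> N2 \<Longrightarrow> nf (\<lambda>t. y i t - y j t) < e / (2 * K)"
      using cauchy_seqs_less[OF y, of "e / (2 * K)"] e K(1) by auto
    show "\<exists>M. \<forall>m\<ge>M. \<forall>n\<ge>M. dist (B (x m) (y m)) (B (x n) (y n)) < e"
    proof (intro exI allI impI)
      fix m n assume mn: "m \<ge> max N1 N2" "n \<ge> max N1 N2"
      have "dist (B (x m) (y m)) (B (x n) (y n)) \<le> nf (\<lambda>t. x m t - x n t) * nf (y m) + nf (x n) * nf (\<lambda>t. y m t - y n t)"
        unfolding dist_norm by (intro B_diff_bound Vx Vy)
      also have "\<dots> \<le> nf (\<lambda>t. x m t - x n t) * L + K * nf (\<lambda>t. y m t - y n t)"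
        by (intro add_mono mult_left_mono mult_right_mono K L nf_nonneg V_diff Vx Vy)
      also have "\<dots> < e / (2 * L) * L + K * (e / (2 * K))"
        using N1[of m n] N2[of m n] mn K(1) L(1)
        by (intro add_strict_mono mult_strict_right_mono mult_strict_left_mono) auto
      also have "\<dots> = e" using K(1) L(1) by simp
      finally show "dist (B (x m) (y m)) (B (x n) (y n)) < e" .
    qed
  qed
  then show ?thesis by (simp add: Cauchy_convergent_iff)
qed

lemma cauchy_relD:
  assumes "(x, y) \<in> cauchy_rel V B"
  shows "x \<in> cauchy_seqs V B" "y \<in> cauchy_seqs V B" "(\<lambda>j. nf (\<lambda>t. x j t - y j t)) \<longlonglongrightarrow> 0"
  using assms by (auto simp: cauchy_rel_def)

lemma equiv_cauchy_rel: "equiv (cauchy_seqs V B) (cauchy_rel V B)"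
proof (rule equivI)
  show "cauchy_rel V B \<subseteq> cauchy_seqs V B \<times> cauchy_seqs V B"
    by (auto simp: cauchy_rel_def)
  show "refl_on (cauchy_seqs V B) (cauchy_rel V B)"
  proof (rule refl_onI)
    fix x assume x: "x \<in> cauchy_seqs V B"
    have "nf (\<lambda>t. x j t - x j t) = 0" for j
      using nf_scale[OF cauchy_seqsD[OF x, of j], of 0] by simp
    then show "(x, x) \<in> cauchy_rel V B" using x by (simp add: cauchy_rel_def)
  qed
  show "sym (cauchy_rel V B)"
  proof (rule symI)
    fix x y assume xy: "(x, y) \<in> cauchy_rel V B"
    then show "(y, x) \<in> cauchy_rel V B"
      using cauchy_relD[OF xy] nf_minus_commute[OF cauchy_seqsD[OF cauchy_relD(1)[OF xy]] cauchy_seqsD[OF cauchy_relD(2)[OF xy]]]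
      by (simp add: cauchy_rel_def)
  qed
  show "trans (cauchy_rel V B)"
  proof (rule transI)
    fix x y z assume xy: "(x, y) \<in> cauchy_rel V B" and yz: "(y, z) \<in> cauchy_rel V B"
    note V = cauchy_relD(1,2)[OF xy, THEN cauchy_seqsD] cauchy_relD(2)[OF yz, THEN cauchy_seqsD]
    have "(\<lambda>j. nf (\<lambda>t. x j t - z j t)) \<longlonglongrightarrow> 0"
    proof (rule tendsto_sandwich[OF always_eventually always_eventually tendsto_const])
      show "(\<lambda>j. nf (\<lambda>t. x j t - y j t) + nf (\<lambda>t. y j t - z j t)) \<longlonglongrightarrow> 0"
        using tendsto_add[OF cauchy_relD(3)[OF xy] cauchy_relD(3)[OF yz]] by simp
    qed (auto intro!: nf_nonneg V_diff nf_triangle_diff V)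
    then show "(x, z) \<in> cauchy_rel V B"
      using cauchy_relD(1)[OF xy] cauchy_relD(2)[OF yz] by (simp add: cauchy_rel_def)
  qed
qed

abbreviation cls :: "(nat \<Rightarrow> complex \<Rightarrow> complex) \<Rightarrow> compl_elem" where
  "cls x \<equiv> cauchy_rel V B `` {x}"

lemma cls_in: "x \<in> cauchy_seqs V B \<Longrightarrow> cls x \<in> hilbert_completion V B"
  by (simp add: hilbert_completion_def quotientI)

lemma mem_cls: "x \<in> cauchy_seqs V B \<Longrightarrow> x \<in> cls x"
  by (rule equiv_class_self[OF equiv_cauchy_rel])

lemma completionE:
  assumes "X \<in> hilbert_completion V B"
  obtains x where "x \<in> cauchy_seqs V B" "X = cls x"
  using assms unfolding hilbert_completion_def by (auto elim: quotientE)

text \<open>Independence of representatives for the scalar product: Cauchy sequences are bounded, so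
  a null perturbation of either argument changes \<open>B\<close> by a null sequence.\<close>

lemma cauchy_rel_B_tendsto:
  assumes x: "(x, x') \<in> cauchy_rel V B" and y: "(y, y') \<in> cauchy_rel V B"
    and lim: "(\<lambda>j. B (x j) (y j)) \<longlonglongrightarrow> c"
  shows "(\<lambda>j. B (x' j) (y' j)) \<longlonglongrightarrow> c"
proof -
  note V = cauchy_relD(1,2)[OF x, THEN cauchy_seqsD] cauchy_relD(1,2)[OF y, THEN cauchy_seqsD]
  obtain K where K: "K > 0" "\<And>j. nf (x' j) \<le> K" using cauchy_seqs_bounded[OF cauchy_relD(2)[OF x]] by blast
  obtain L where L: "L > 0" "\<And>j. nf (y j) \<le> L" using cauchy_seqs_bounded[OF cauchy_relD(1)[OF y]] by blast
  have "(\<lambda>j. B (x j) (y j) - B (x' j) (y' j)) \<longlonglongrightarrow> 0"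
  proof (rule Lim_null_comparison[OF always_eventually])
    show "(\<lambda>j. nf (\<lambda>t. x j t - x' j t) * L + K * nf (\<lambda>t. y j t - y' j t)) \<longlonglongrightarrow> 0"
      using tendsto_add[OF tendsto_mult_left_zero[OF cauchy_relD(3)[OF x]] tendsto_mult_right_zero[OF cauchy_relD(3)[OF y]]]
      by simp
    show "\<forall>j. norm (B (x j) (y j) - B (x' j) (y' j)) \<le> nf (\<lambda>t. x j t - x' j t) * L + K * nf (\<lambda>t. y j t - y' j t)"
    proof
      fix j
      have "norm (B (x j) (y j) - B (x' j) (y' j)) \<le> nf (\<lambda>t. x j t - x' j t) * nf (y j) + nf (x' j) * nf (\<lambda>t. y j t - y' j t)"
        by (intro B_diff_bound V)
      also have "\<dots> \<le> nf (\<lambda>t. x j t - x' j t) * L + K * nf (\<lambda>t. y j t - y' j t)"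
        by (intro add_mono mult_left_mono mult_right_mono K L nf_nonneg V_diff V)
      finally show "norm (B (x j) (y j) - B (x' j) (y' j)) \<le> nf (\<lambda>t. x j t - x' j t) * L + K * nf (\<lambda>t. y j t - y' j t)" .
    qed
  qed
  from tendsto_diff[OF lim this] show ?thesis by simp
qed

text \<open>\<open>compl_inner\<close> is a definite description over all representatives. A common
  limit exists by independence of representatives, and it is unique because \<open>x\<close> and
  \<open>y\<close> are themselves representatives.\<close>

lemma compl_inner_cls:
  assumes x: "x \<in> cauchy_seqs V B" and y: "y \<in> cauchy_seqs V B"
    and lim: "(\<lambda>j. B (x j) (y j)) \<longlonglongrightarrow> c"
  shows "compl_inner B (cls x) (cls y) = c"
  unfolding compl_inner_def
proof (rule the_equality)
  show "\<forall>x'\<in>cls x. \<forall>y'\<in>cls y. (\<lambda>j. B (x' j) (y' j)) \<longlonglongrightarrow> c"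
    using cauchy_rel_B_tendsto lim by auto
  show "c' = c" if "\<forall>x'\<in>cls x. \<forall>y'\<in>cls y. (\<lambda>j. B (x' j) (y' j)) \<longlonglongrightarrow> c'" for c'
    using that mem_cls[OF x] mem_cls[OF y] lim by (meson LIMSEQ_unique)
qed

lemma cauchy_seqs_scale:
  assumes x: "x \<in> cauchy_seqs V B"
  shows "(\<lambda>j t. c * x j t) \<in> cauchy_seqs V B"
proof -
  note V = cauchy_seqsD[OF x]
  have eq: "nf (\<lambda>t. c * x i t - c * x j t) = cmod c * nf (\<lambda>t. x i t - x j t)" for i j
    using nf_scale[OF V_diff[OF V V], of c i j] by (simp add: algebra_simps)
  have "\<exists>N. \<forall>i\<ge>N. \<forall>j\<ge>N. cmod c * nf (\<lambda>t. x i t - x j t) < e" if e: "e > 0" for e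
  proof -
    have pos: "e / (cmod c + 1) > 0" using e by (simp add: add_nonneg_pos)
    obtain N where N: "\<And>i j. i \<ge> N \<Longrightarrow> j \<ge> N \<Longrightarrow> nf (\<lambda>t. x i t - x j t) < e / (cmod c + 1)"
      using cauchy_seqs_less[OF x pos] by blast
    have "cmod c * nf (\<lambda>t. x i t - x j t) < e" if "i \<ge> N" "j \<ge> N" for i j
    proof -
      have "cmod c * nf (\<lambda>t. x i t - x j t) \<le> (cmod c + 1) * nf (\<lambda>t. x i t - x j t)"
        by (intro mult_right_mono nf_nonneg V_diff V) simp
      also have "\<dots> < e"
        using N[OF that] by (simp add: pos_less_divide_eq add_nonneg_pos mult.commute)
      finally show ?thesis .
    qed
    then show ?thesis by blast
  qed
  then show ?thesis
    by (simp add: cauchy_seqs_def eq V V_scale)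
qed

lemma cauchy_seqs_diff:
  assumes x: "x \<in> cauchy_seqs V B" and y: "y \<in> cauchy_seqs V B"
  shows "(\<lambda>j t. x j t - y j t) \<in> cauchy_seqs V B"
proof -
  note V = cauchy_seqsD[OF x] cauchy_seqsD[OF y]
  have le: "nf (\<lambda>t. (x i t - y i t) - (x j t - y j t)) \<le> nf (\<lambda>t. x i t - x j t) + nf (\<lambda>t. y i t - y j t)" for i j
  proof -
    have "nf (\<lambda>t. (x i t - y i t) - (x j t - y j t)) = nf (\<lambda>t. (x i t - x j t) - (y i t - y j t))"
      by (rule arg_cong[of _ _ nf]) auto
    also have "\<dots> \<le> nf (\<lambda>t. x i t - x j t) + nf (\<lambda>t. y j t - y i t)"
      using nf_triangle[OF V_diff[OF V(1)[of i] V(1)[of j]] V_diff[OF V(2)[of j] V(2)[of i]]] by (simp add: algebra_simps)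
    finally show ?thesis using nf_minus_commute[OF V(2)[of i] V(2)[of j]] by simp
  qed
  have "\<exists>N. \<forall>i\<ge>N. \<forall>j\<ge>N. nf (\<lambda>t. (x i t - y i t) - (x j t - y j t)) < e" if e: "e > 0" for e
  proof -
    have "e / 2 > 0" using e by simp
    obtain N1 where N1: "\<And>i j. i \<ge> N1 \<Longrightarrow> j \<ge> N1 \<Longrightarrow> nf (\<lambda>t. x i t - x j t) < e / 2"
      using cauchy_seqs_less[OF x \<open>e / 2 > 0\<close>] by blast
    obtain N2 where N2: "\<And>i j. i \<ge> N2 \<Longrightarrow> j \<ge> N2 \<Longrightarrow> nf (\<lambda>t. y i t - y j t) < e / 2"
      using cauchy_seqs_less[OF y \<open>e / 2 > 0\<close>] by blast
    have "nf (\<lambda>t. (x i t - y i t) - (x j t - y j t)) < e" if "i \<ge> max N1 N2" "j \<ge> max N1 N2" for i j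
      using le[of i j] N1[of i j] N2[of i j] that by simp
    then show ?thesis by blast
  qed
  then show ?thesis by (simp add: cauchy_seqs_def V V_diff)
qed

lemma compl_scale_cls:
  assumes x: "x \<in> cauchy_seqs V B"
  shows "compl_scale V B c (cls x) = cls (\<lambda>j t. c * x j t)"
proof -
  have "cls (\<lambda>j t. c * x' j t) = cls (\<lambda>j t. c * x j t)" if x': "(x, x') \<in> cauchy_rel V B" for x'
  proof -
    note C = cauchy_relD[OF x']
    have "nf (\<lambda>t. c * x j t - c * x' j t) = cmod c * nf (\<lambda>t. x j t - x' j t)" for j
      using nf_scale[OF V_diff[OF C(1)[THEN cauchy_seqsD] C(2)[THEN cauchy_seqsD]], of c j] by (simp add: algebra_simps)
    then have "(\<lambda>j. nf (\<lambda>t. c * x j t - c * x' j t)) \<longlonglongrightarrow> 0"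
      using tendsto_mult_right_zero[OF C(3), of "cmod c"] by simp
    then have "(\<lambda>j t. c * x j t, \<lambda>j t. c * x' j t) \<in> cauchy_rel V B"
      using C by (simp add: cauchy_rel_def cauchy_seqs_scale)
    then show ?thesis by (metis equiv_cauchy_rel equiv_class_eq)
  qed
  then show ?thesis
    using mem_cls[OF x] unfolding compl_scale_def by blast
qed

text \<open>Testing against the class of x - y shows that x - y has norm tending to zero. This
  nondegeneracy is what makes the definite description in \<open>repr_kernel\<close>
  unambiguous.\<close>

lemma cls_eqI:
  assumes x: "x \<in> cauchy_seqs V B" and y: "y \<in> cauchy_seqs V B"
    and eq: "\<And>Z. Z \<in> hilbert_completion V B \<Longrightarrow> compl_inner B Z (cls x) = compl_inner B Z (cls y)"
  shows "cls x = cls y"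
proof -
  define z where "z = (\<lambda>j t. x j t - y j t)"
  have z: "z \<in> cauchy_seqs V B" using cauchy_seqs_diff[OF x y] by (simp add: z_def)
  note V = x[THEN cauchy_seqsD] y[THEN cauchy_seqsD] z[THEN cauchy_seqsD]
  obtain c where c: "(\<lambda>j. B (z j) (x j)) \<longlonglongrightarrow> c"
    using cauchy_seqs_convergent[OF z x] convergent_def by blast
  obtain d where d: "(\<lambda>j. B (z j) (y j)) \<longlonglongrightarrow> d"
    using cauchy_seqs_convergent[OF z y] convergent_def by blast
  have "c = d"
    using eq[OF cls_in[OF z]] compl_inner_cls[OF z x c] compl_inner_cls[OF z y d] by simp
  have "B (z j) (z j) = B (z j) (x j) - B (z j) (y j)" for j
    using B_diff_right[OF V(1) V(2) V(3), of j j j] by (simp add: z_def)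
  then have "(\<lambda>j. B (z j) (z j)) \<longlonglongrightarrow> 0"
    using tendsto_diff[OF c d] \<open>c = d\<close> by simp
  then have "(\<lambda>j. sqrt (Re (B (z j) (z j)))) \<longlonglongrightarrow> sqrt (Re 0)"
    by (intro tendsto_intros)
  then have "(\<lambda>j. nf (z j)) \<longlonglongrightarrow> 0" by (simp add: form_norm_def)
  then have "(x, y) \<in> cauchy_rel V B" using x y by (simp add: cauchy_rel_def z_def)
  then show ?thesis by (metis equiv_cauchy_rel equiv_class_eq)
qed

end

section \<open>Bounded functionals and the kernels that represent them\<close>

text \<open>The bound makes the infimum in \<open>normalized_kernel_value\<close> positive, and
  \<open>\<phi>_nonzero\<close> makes the affine set where \<phi> = 1 nonempty, so that the kernel
  is not zero and can be normalized.\<close>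

locale bounded_functional = semi_inner_space +
  fixes \<phi> :: "(complex \<Rightarrow> complex) \<Rightarrow> complex" and C :: real
  assumes \<phi>_diff: "f \<in> V \<Longrightarrow> g \<in> V \<Longrightarrow> \<phi> (\<lambda>t. f t - g t) = \<phi> f - \<phi> g"
    and \<phi>_scale: "f \<in> V \<Longrightarrow> \<phi> (\<lambda>t. c * f t) = c * \<phi> f"
    and \<phi>_bound: "f \<in> V \<Longrightarrow> cmod (\<phi> f) \<le> C * nf f"
    and \<phi>_nonzero: "\<exists>f\<in>V. \<phi> f \<noteq> 0"
begin

lemma functional_convergent:
  assumes x: "x \<in> cauchy_seqs V B"
  shows "convergent (\<lambda>j. \<phi> (x j))"
proof -
  note V = cauchy_seqsD[OF x]
  have "Cauchy (\<lambda>j. \<phi> (x j))"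
  proof (rule metric_CauchyI)
    fix e :: real assume e: "e > 0"
    have pos: "e / (\<bar>C\<bar> + 1) > 0" using e by (simp add: add_nonneg_pos)
    obtain N where N: "\<And>i j. i \<ge> N \<Longrightarrow> j \<ge> N \<Longrightarrow> nf (\<lambda>t. x i t - x j t) < e / (\<bar>C\<bar> + 1)"
      using cauchy_seqs_less[OF x pos] by blast
    have "dist (\<phi> (x i)) (\<phi> (x j)) < e" if "i \<ge> N" "j \<ge> N" for i j
    proof -
      have "dist (\<phi> (x i)) (\<phi> (x j)) \<le> C * nf (\<lambda>t. x i t - x j t)"
        using \<phi>_bound[OF V_diff[OF V V], of i j] by (simp add: \<phi>_diff V dist_norm)
      also have "\<dots> \<le> (\<bar>C\<bar> + 1) * nf (\<lambda>t. x i t - x j t)"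
        by (intro mult_right_mono nf_nonneg V_diff V) simp
      also have "\<dots> < e" using N[OF that] by (simp add: pos_less_divide_eq add_nonneg_pos mult.commute)
      finally show ?thesis .
    qed
    then show "\<exists>M. \<forall>m\<ge>M. \<forall>n\<ge>M. dist (\<phi> (x m)) (\<phi> (x n)) < e" by blast
  qed
  then show ?thesis by (simp add: Cauchy_convergent_iff)
qed

lemma compl_extend_cls:
  assumes x: "x \<in> cauchy_seqs V B" and lim: "(\<lambda>j. \<phi> (x j)) \<longlonglongrightarrow> c"
  shows "compl_extend \<phi> (cls x) = c"
  unfolding compl_extend_def
proof (rule the_equality)
  show "\<forall>x'\<in>cls x. (\<lambda>j. \<phi> (x' j)) \<longlonglongrightarrow> c"
  proof
    fix x' assume "x' \<in> cls x"
    then have r: "(x, x') \<in> cauchy_rel V B" by simp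
    note V = cauchy_relD(1,2)[OF r, THEN cauchy_seqsD]
    have "(\<lambda>j. \<phi> (x j) - \<phi> (x' j)) \<longlonglongrightarrow> 0"
    proof (rule Lim_null_comparison[OF always_eventually])
      show "(\<lambda>j. C * nf (\<lambda>t. x j t - x' j t)) \<longlonglongrightarrow> 0"
        using tendsto_mult_right_zero[OF cauchy_relD(3)[OF r]] .
      show "\<forall>j. norm (\<phi> (x j) - \<phi> (x' j)) \<le> C * nf (\<lambda>t. x j t - x' j t)"
        using \<phi>_bound[OF V_diff[OF V(1) V(2)]] by (simp add: \<phi>_diff V)
    qed
    from tendsto_diff[OF lim this] show "(\<lambda>j. \<phi> (x' j)) \<longlonglongrightarrow> c" by simp
  qed
  show "c' = c" if "\<forall>x'\<in>cls x. (\<lambda>j. \<phi> (x' j)) \<longlonglongrightarrow> c'" for c'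
    using that mem_cls[OF x] lim by (meson LIMSEQ_unique)
qed

text \<open>The kernel is represented by multiples of a minimizing sequence \<open>x\<close> for the norm on
  \<open>{f. \<phi> f = 1}\<close>, which is a Cauchy sequence by the parallelogram law.\<close>

lemma normalized_kernel_value:
  defines "k \<equiv> (THE k. k \<in> hilbert_completion V B \<and>
     (\<forall>f\<in>hilbert_completion V B. compl_inner B f k = compl_extend \<phi> f))"
  obtains d where "d > 0" "\<And>f. f \<in> V \<Longrightarrow> d * (cmod (\<phi> f))\<^sup>2 \<le> (nf f)\<^sup>2"
    "\<And>e. e > 0 \<Longrightarrow> \<exists>f\<in>V. \<phi> f = 1 \<and> (nf f)\<^sup>2 < d + e"
    "compl_extend \<phi> (compl_scale V B (of_real (1 / compl_norm B k)) k) = of_real (1 / sqrt d)"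
proof -
  define S where "S = {(nf f)\<^sup>2 |f. f \<in> V \<and> \<phi> f = 1}"
  obtain f0 where f0: "f0 \<in> V" "\<phi> f0 \<noteq> 0" using \<phi>_nonzero by blast
  have C: "C > 0"
    using \<phi>_bound[OF f0(1)] f0(2) nf_nonneg[OF f0(1)]
    by (metis not_less mult_nonpos_nonneg norm_le_zero_iff order_trans)
  have "(\<lambda>t. (1 / \<phi> f0) * f0 t) \<in> V \<and> \<phi> (\<lambda>t. (1 / \<phi> f0) * f0 t) = 1"
    using f0 by (simp only: \<phi>_scale V_scale) simp
  then have Sne: "S \<noteq> {}" unfolding S_def by blast
  have Slow: "1 / C\<^sup>2 \<le> s" if s: "s \<in> S" for s
  proof -
    obtain f where f: "f \<in> V" "\<phi> f = 1" "s = (nf f)\<^sup>2" using s unfolding S_def by blast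
    have "1\<^sup>2 \<le> (C * nf f)\<^sup>2" using \<phi>_bound[OF f(1)] f(2) by (intro power_mono) auto
    then show ?thesis using C f(3) by (simp add: field_simps power_mult_distrib)
  qed
  \<comment> \<open>d is the squared distance from the origin to the affine set \<phi> = 1, hence 1
    / d is the squared norm of the functional.\<close>
  define d where "d = Inf S"
  have bdd: "bdd_below S" using Slow by (meson bdd_belowI)
  have d: "d > 0"
    using cInf_greatest[OF Sne Slow] C unfolding d_def
    by (meson less_le_trans zero_less_divide_1_iff zero_less_power)
  have dle1: "d \<le> (nf f)\<^sup>2" if "f \<in> V" "\<phi> f = 1" for f
    unfolding d_def using that by (intro cInf_lower bdd) (auto simp: S_def)
  have dle: "d * (cmod (\<phi> f))\<^sup>2 \<le> (nf f)\<^sup>2" if f: "f \<in> V" for f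
  proof (cases "\<phi> f = 0")
    case False
    then have "d \<le> (nf (\<lambda>t. (1 / \<phi> f) * f t))\<^sup>2"
      by (intro dle1 V_scale f) (simp only: \<phi>_scale f, simp)
    also have "\<dots> = (cmod (1 / \<phi> f) * nf f)\<^sup>2" by (simp only: nf_scale f)
    finally show ?thesis using False by (simp add: norm_divide power_mult_distrib power_divide field_simps)
  qed simp
  have near: "\<exists>f\<in>V. \<phi> f = 1 \<and> (nf f)\<^sup>2 < d + e" if "e > 0" for e
    using cInf_lessD[OF Sne, of "d + e"] that unfolding d_def S_def by auto
  then have "\<forall>j. \<exists>f\<in>V. \<phi> f = 1 \<and> (nf f)\<^sup>2 < d + 1 / real (Suc j)" by simp
  then obtain x where x: "\<And>j. x j \<in> V" "\<And>j. \<phi> (x j) = 1" "\<And>j. (nf (x j))\<^sup>2 < d + 1 / real (Suc j)"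
    by metis
  have limx: "(\<lambda>j. (nf (x j))\<^sup>2) \<longlonglongrightarrow> d"
  proof (rule tendsto_sandwich[OF always_eventually always_eventually tendsto_const])
    show "(\<lambda>j. d + 1 / real (Suc j)) \<longlonglongrightarrow> d"
      using tendsto_add[OF tendsto_const LIMSEQ_inverse_real_of_nat, of d] by (simp add: inverse_eq_divide)
  qed (use x dle1 in \<open>auto intro: less_imp_le\<close>)
  \<comment> \<open>An exact minimizer would be orthogonal to the null space of \<phi>. For a
    near-minimizer the defect is controlled by its excess over d.\<close>
  have orth: "(cmod (B g (x j)))\<^sup>2 \<le> (nf g)\<^sup>2 * ((nf (x j))\<^sup>2 - d)" if g: "g \<in> V" "\<phi> g = 0" for g j
  proof (cases "nf g = 0")
    case True
    then show ?thesis using Cauchy_Schwarz[OF g(1) x(1), of j] by simp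
  next
    case False
    \<comment> \<open>The scalar that minimizes the norm of x j - s g. Subtracting s g keeps \<phi>
      = 1, so the minimum is still at least d.\<close>
    define s where "s = cnj (B g (x j)) / (nf g)\<^sup>2"
    have "\<phi> (\<lambda>t. x j t - s * g t) = 1"
      using g x by (simp add: \<phi>_diff V_scale \<phi>_scale)
    then have "d \<le> (nf (\<lambda>t. x j t - s * g t))\<^sup>2"
      by (intro dle1 V_diff V_scale x g)
    also have "\<dots> = (nf (x j))\<^sup>2 - 2 * Re (cnj s * B (x j) g) + (cmod s)\<^sup>2 * (nf g)\<^sup>2"
      by (rule nf_diff_scale[OF x(1) g(1)])
    also have "Re (cnj s * B (x j) g) = (cmod (B g (x j)))\<^sup>2 / (nf g)\<^sup>2"
    proof -
      have "cnj s * B (x j) g = of_real ((cmod (B g (x j)))\<^sup>2 / (nf g)\<^sup>2)"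
        using complex_norm_square[of "B g (x j)"] by (simp add: s_def B_herm[OF g(1) x(1)])
      then show ?thesis by (metis Re_complex_of_real)
    qed
    also have "(cmod s)\<^sup>2 * (nf g)\<^sup>2 = (cmod (B g (x j)))\<^sup>2 / (nf g)\<^sup>2"
    proof -
      have "cmod s = cmod (B g (x j)) / (nf g)\<^sup>2" by (simp add: s_def norm_divide norm_power)
      then show ?thesis using False by (simp add: power_divide power2_eq_square)
    qed
    finally have "(cmod (B g (x j)))\<^sup>2 / (nf g)\<^sup>2 \<le> (nf (x j))\<^sup>2 - d" by simp
    then show ?thesis using False by (simp add: field_simps)
  qed
  have xC: "x \<in> cauchy_seqs V B"
  proof -
    have bound: "(nf (\<lambda>t. x i t - x j t))\<^sup>2 \<le> 2 * (1 / real (Suc i)) + 2 * (1 / real (Suc j))" for i j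
    proof -
      have xij: "(\<lambda>t. x i t + x j t) \<in> V" by (intro V_add x)
      have eq: "(\<lambda>t. x i t + x j t) = (\<lambda>t. x i t - (-1) * x j t)" by simp
      \<comment> \<open>The midpoint of x i and x j competes in the infimum, so the squared norm of
        the sum is at least 4 d; the parallelogram law then leaves only the two excesses for the
        difference.\<close>
      have "\<phi> (\<lambda>t. x i t + x j t) = 2"
        unfolding eq by (subst \<phi>_diff) (simp_all only: \<phi>_scale x V_scale, simp)
      then have "4 * d \<le> (nf (\<lambda>t. x i t + x j t))\<^sup>2"
        using dle[OF xij] by (simp add: mult.commute)
      then show ?thesis
        using parallelogram[OF x(1) x(1), of i j] x(3)[of i] x(3)[of j] by simp
    qed
    have "\<exists>N. \<forall>i\<ge>N. \<forall>j\<ge>N. nf (\<lambda>t. x i t - x j t) < e" if e: "e > 0" for e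
    proof -
      obtain N where N: "inverse (real (Suc N)) < e\<^sup>2 / 4" using reals_Archimedean[of "e\<^sup>2 / 4"] e by auto
      have "nf (\<lambda>t. x i t - x j t) < e" if "i \<ge> N" "j \<ge> N" for i j
      proof -
        have "1 / real (Suc i) \<le> inverse (real (Suc N))" "1 / real (Suc j) \<le> inverse (real (Suc N))"
          using that by (simp_all add: field_simps)
        then have "(nf (\<lambda>t. x i t - x j t))\<^sup>2 < e\<^sup>2" using bound[of i j] N by linarith
        then show ?thesis using e by (simp add: power2_less_imp_less)
      qed
      then show ?thesis by blast
    qed
    then show ?thesis by (simp add: cauchy_seqs_def x)
  qed
  have repr: "(\<lambda>j. B (y j) (x j)) \<longlonglongrightarrow> of_real d * c"
    if y: "y \<in> cauchy_seqs V B" and lim: "(\<lambda>j. \<phi> (y j)) \<longlonglongrightarrow> c" for y c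
  proof -
    note V = y[THEN cauchy_seqsD]
    \<comment> \<open>Removing the component along x j puts y j into the null space of \<phi>. That
      part is asymptotically orthogonal to x j, and what remains of the product is \<phi> (y j)
      times the squared norm of x j.\<close>
    define g where "g = (\<lambda>j t. y j t - \<phi> (y j) * x j t)"
    have g: "g j \<in> V" "\<phi> (g j) = 0" for j
      unfolding g_def using x V by (simp_all add: V_diff V_scale \<phi>_diff \<phi>_scale)
    obtain K where K: "K > 0" "\<And>j. nf (y j) \<le> K" using cauchy_seqs_bounded[OF y] by blast
    obtain L where L: "L > 0" "\<And>j. nf (x j) \<le> L" using cauchy_seqs_bounded[OF xC] by blast
    have ng: "nf (g j) \<le> K + C * K * L" for j
    proof -
      have "nf (g j) \<le> nf (y j) + nf (\<lambda>t. (- \<phi> (y j)) * x j t)"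
        using nf_triangle[OF V V_scale[OF x(1)], of j "- \<phi> (y j)" j] by (simp add: g_def)
      also have "nf (\<lambda>t. (- \<phi> (y j)) * x j t) = cmod (\<phi> (y j)) * nf (x j)"
        by (simp only: nf_scale x norm_minus_cancel)
      also have "\<dots> \<le> (C * K) * L"
      proof (intro mult_mono L)
        show "cmod (\<phi> (y j)) \<le> C * K"
          using \<phi>_bound[OF V, of j] K(2)[of j] C by (meson mult_left_mono order_trans less_imp_le)
      qed (use K(1) C x nf_nonneg in auto)
      finally show ?thesis using K(2)[of j] by simp
    qed
    have "(\<lambda>j. (cmod (B (g j) (x j)))\<^sup>2) \<longlonglongrightarrow> 0"
    proof (rule tendsto_sandwich[OF always_eventually always_eventually tendsto_const])
      show "(\<lambda>j. (K + C * K * L)\<^sup>2 * ((nf (x j))\<^sup>2 - d)) \<longlonglongrightarrow> 0"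
        using tendsto_mult[OF tendsto_const[of "(K + C * K * L)\<^sup>2"] tendsto_diff[OF limx tendsto_const[of d]]] by simp
      show "\<forall>j. (cmod (B (g j) (x j)))\<^sup>2 \<le> (K + C * K * L)\<^sup>2 * ((nf (x j))\<^sup>2 - d)"
      proof
        fix j
        have "(nf (g j))\<^sup>2 * ((nf (x j))\<^sup>2 - d) \<le> (K + C * K * L)\<^sup>2 * ((nf (x j))\<^sup>2 - d)"
          using ng[of j] nf_nonneg[OF g(1)] dle1[OF x(1,2)] by (intro mult_right_mono power_mono) auto
        then show "(cmod (B (g j) (x j)))\<^sup>2 \<le> (K + C * K * L)\<^sup>2 * ((nf (x j))\<^sup>2 - d)"
          using orth[OF g, of j j] by linarith
      qed
    qed simp_all
    then have "(\<lambda>j. sqrt ((cmod (B (g j) (x j)))\<^sup>2)) \<longlonglongrightarrow> sqrt 0" by (rule tendsto_real_sqrt)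
    then have "(\<lambda>j. B (g j) (x j)) \<longlonglongrightarrow> 0" by (simp add: tendsto_norm_zero_iff)
    moreover have "(\<lambda>j. \<phi> (y j) * of_real ((nf (x j))\<^sup>2)) \<longlonglongrightarrow> c * of_real d"
      by (intro tendsto_mult lim tendsto_of_real limx)
    moreover have "B (y j) (x j) = B (g j) (x j) + \<phi> (y j) * of_real ((nf (x j))\<^sup>2)" for j
      unfolding g_def using V x by (simp add: B_diff V_scale B_scale B_self)
    ultimately show ?thesis
      using tendsto_add[of "\<lambda>j. B (g j) (x j)" 0 sequentially "\<lambda>j. \<phi> (y j) * of_real ((nf (x j))\<^sup>2)"]
      by (simp add: mult.commute)
  qed
  \<comment> \<open>Pairing with x gives d times the functional, hence the factor 1 / d.\<close>
  define u where "u = (\<lambda>j t. complex_of_real (1 / d) * x j t)"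
  have uC: "u \<in> cauchy_seqs V B" unfolding u_def by (rule cauchy_seqs_scale[OF xC])
  have ku: "compl_inner B F (cls u) = compl_extend \<phi> F" if F: "F \<in> hilbert_completion V B" for F
  proof -
    obtain y where y: "y \<in> cauchy_seqs V B" "F = cls y" using completionE[OF F] .
    obtain c where c: "(\<lambda>j. \<phi> (y j)) \<longlonglongrightarrow> c" using functional_convergent[OF y(1)] convergent_def by blast
    have "(\<lambda>j. of_real (1 / d) * B (y j) (x j)) \<longlonglongrightarrow> of_real (1 / d) * (of_real d * c)"
      by (intro tendsto_mult tendsto_const repr y(1) c)
    moreover have "B (y j) (u j) = of_real (1 / d) * B (y j) (x j)" for j
      unfolding u_def by (subst B_scale_right) (use x y(1)[THEN cauchy_seqsD] in auto)
    ultimately have "(\<lambda>j. B (y j) (u j)) \<longlonglongrightarrow> c" using d by simp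
    from compl_inner_cls[OF y(1) uC this] compl_extend_cls[OF y(1) c] show ?thesis by (simp add: y(2))
  qed
  have k: "k = cls u"
    unfolding k_def
  proof (rule the_equality)
    show "cls u \<in> hilbert_completion V B \<and> (\<forall>f\<in>hilbert_completion V B. compl_inner B f (cls u) = compl_extend \<phi> f)"
      using ku cls_in[OF uC] by blast
    fix k' assume k': "k' \<in> hilbert_completion V B \<and> (\<forall>f\<in>hilbert_completion V B. compl_inner B f k' = compl_extend \<phi> f)"
    then obtain v where v: "v \<in> cauchy_seqs V B" "k' = cls v" using completionE by blast
    show "k' = cls u"
      unfolding v(2) by (rule cls_eqI[OF v(1) uC]) (use k' ku v(2) in auto)
  qed
  have phiu: "(\<lambda>j. \<phi> (u j)) = (\<lambda>j. of_real (1 / d))"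
    unfolding u_def by (simp only: \<phi>_scale x) simp
  \<comment> \<open>The reproducing property applied to the kernel itself: its squared norm is its
    own value under \<phi>.\<close>
  have "compl_inner B (cls u) (cls u) = of_real (1 / d)"
    unfolding ku[OF cls_in[OF uC]] by (rule compl_extend_cls[OF uC]) (simp only: phiu tendsto_const)
  then have nk: "compl_norm B k = 1 / sqrt d"
    unfolding compl_norm_def k by (simp add: real_sqrt_divide)
  have "compl_extend \<phi> (compl_scale V B (of_real (1 / compl_norm B k)) k)
      = compl_extend \<phi> (cls (\<lambda>j t. of_real (sqrt d) * u j t))"
    unfolding nk unfolding k by (simp add: compl_scale_cls[OF uC])
  also have "\<dots> = of_real (1 / sqrt d)"
  proof (rule compl_extend_cls)
    show "(\<lambda>j t. complex_of_real (sqrt d) * u j t) \<in> cauchy_seqs V B" by (rule cauchy_seqs_scale[OF uC])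
    have "\<phi> (\<lambda>t. of_real (sqrt d) * u j t) = of_real (1 / sqrt d)" for j
    proof -
      have "\<phi> (\<lambda>t. of_real (sqrt d) * u j t) = of_real (sqrt d) * of_real (1 / d)"
        using phiu by (simp add: \<phi>_scale uC[THEN cauchy_seqsD] fun_eq_iff)
      also have "\<dots> = of_real (sqrt d * (1 / d))" by simp
      also have "sqrt d * (1 / d) = 1 / sqrt d" using d by (simp add: field_simps)
      finally show ?thesis .
    qed
    then show "(\<lambda>j. \<phi> (\<lambda>t. of_real (sqrt d) * u j t)) \<longlonglongrightarrow> of_real (1 / sqrt d)" by simp
  qed
  finally show ?thesis using that d dle near by blast
qed

end

section \<open>The circle measure\<close>

abbreviation circ :: "complex measure" ("\<T>") where "\<T> \<equiv> circle_measure"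

text \<open>The circle measure before completion. Change of variables and approximation of functions
  are carried out here, where the sets are Borel, and then transferred to
  \<open>\<T>\<close>.\<close>

definition borel_circle :: "complex measure" where
  "borel_circle = distr (uniform_measure lborel {0..2*pi}) (restrict_space borel (sphere 0 1)) cis"

lemma circle_measure_eq: "\<T> = completion borel_circle"
  by (simp add: circle_measure_def borel_circle_def)

lemma cis_measurable: "cis \<in> uniform_measure lborel {0..2*pi} \<rightarrow>\<^sub>M restrict_space borel (sphere 0 1)"
proof -
  have "cis \<in> borel_measurable borel"
    by (intro borel_measurable_continuous_onI continuous_intros)
  then show ?thesis
    by (intro measurable_restrict_space2) (auto simp: measurable_def)
qed

lemma space_borel_circle [simp]: "space borel_circle = sphere 0 1"
  by (simp add: borel_circle_def space_restrict_space)

lemma sets_borel_circle [measurable_cong]: "sets borel_circle = sets (restrict_space borel (sphere 0 1))"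
  by (simp add: borel_circle_def)

lemma space_circle [simp]: "space \<T> = sphere 0 1"
  by (simp add: circle_measure_eq)

lemma emeasure_borel_circle: "emeasure borel_circle (sphere 0 1) = 1"
proof -
  have "cis -` sphere 0 1 \<inter> space (uniform_measure lborel {0..2*pi}) = UNIV" by auto
  moreover have "sphere 0 1 \<in> sets (restrict_space borel (sphere (0::complex) 1))"
    by (simp add: sets_restrict_space_iff)
  ultimately show ?thesis
    unfolding borel_circle_def
    by (subst emeasure_distr[OF cis_measurable]) (simp_all add: emeasure_uniform_measure ennreal_divide_self)
qed

lemma emeasure_circle: "emeasure \<T> (sphere 0 1) = 1"
  using emeasure_borel_circle sets.top[of borel_circle] by (simp add: circle_measure_eq)

interpretation borel_circle: finite_measure borel_circle
  by standard (simp add: emeasure_borel_circle)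

interpretation circle: finite_measure \<T>
  by standard (simp add: emeasure_circle)

lemma measure_circle [simp]: "measure \<T> (sphere 0 1) = 1"
  by (simp add: measure_def emeasure_circle)

lemma borel_circle_continuous: "continuous_on (sphere 0 1) f \<Longrightarrow> f \<in> borel_measurable borel_circle"
  by (subst measurable_cong_sets[OF sets_borel_circle refl]) (rule borel_measurable_continuous_on_restrict)

lemma circle_continuous: "continuous_on (sphere 0 1) f \<Longrightarrow> f \<in> borel_measurable \<T>"
  unfolding circle_measure_eq by (intro measurable_completion borel_circle_continuous)

lemma integrable_circle_bounded:
  fixes f :: "complex \<Rightarrow> 'a :: {banach, second_countable_topology}"
  assumes "f \<in> borel_measurable \<T>" "\<And>t. cmod t = 1 \<Longrightarrow> norm (f t) \<le> K"
  shows "integrable \<T> f"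
  by (rule circle.integrable_const_bound[of _ K]) (use assms in auto)

lemma integrable_circle_continuous:
  fixes f :: "complex \<Rightarrow> 'a :: {banach, second_countable_topology}"
  assumes "continuous_on (sphere 0 1) f"
  shows "integrable \<T> f"
proof -
  have "bounded (f ` sphere 0 1)"
    by (intro compact_imp_bounded compact_continuous_image assms) simp
  then obtain K where "\<And>y. y \<in> f ` sphere 0 1 \<Longrightarrow> norm y \<le> K"
    unfolding bounded_iff by blast
  then show ?thesis by (intro integrable_circle_bounded[where K = K] circle_continuous assms) auto
qed

lemma continuous_on_powi_circle: "continuous_on (sphere 0 1) (\<lambda>t::complex. t powi m)"
  by (intro continuous_intros) auto

lemma integral_powi: "(LINT t|\<T>. t powi m) = (if m = 0 then 1 else 0)"
proof (cases "m = 0")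
  case False
  have "(LINT t|\<T>. t powi m) = (LINT t|borel_circle. t powi m)"
    unfolding circle_measure_eq by (intro integral_completion borel_circle_continuous continuous_on_powi_circle)
  also have "\<dots> = (LINT x|uniform_measure lborel {0..2*pi}. cis x powi m)"
    unfolding borel_circle_def
    by (intro integral_distr cis_measurable borel_measurable_continuous_on_restrict continuous_on_powi_circle)
  also have "\<dots> = (LINT x|lborel. (indicator {0..2*pi} x / (2*pi)) *\<^sub>R cis (of_int m * x))"
  proof -
    have eq: "uniform_measure lborel {0..2*pi} = density lborel (\<lambda>x. ennreal (indicator {0..2*pi} x / (2*pi)))"
      unfolding uniform_measure_def
      by (intro arg_cong[of _ _ "density lborel"] ext)
        (auto simp: indicator_def divide_ennreal[symmetric])
    show ?thesis
      unfolding eq by (subst integral_density) (auto simp: cis_power_int intro!: borel_measurable_continuous_onI continuous_intros)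
  qed
  also have "\<dots> = (LINT x|lborel. (1 / (2*pi)) *\<^sub>R (indicator {0..2*pi} x *\<^sub>R cis (of_int m * x)))"
    by (intro Bochner_Integration.integral_cong) auto
  also have "\<dots> = (1 / (2*pi)) *\<^sub>R (LINT x|lborel. indicator {0..2*pi} x *\<^sub>R cis (of_int m * x))"
    by (rule integral_scaleR_right)
  also have "(LINT x|lborel. indicator {0..2*pi} x *\<^sub>R cis (of_int m * x))
      = cis (of_int m * (2*pi)) / (\<i> * of_int m) - cis (of_int m * 0) / (\<i> * of_int m)"
  proof (rule integral_FTC_atLeastAtMost)
    fix x :: real
    have "((\<lambda>x. exp (\<i> * (of_int m * of_real x)) / (\<i> * of_int m)) has_vector_derivative
        exp (\<i> * (of_int m * of_real x))) (at x within {0..2*pi})"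
      by (rule has_vector_derivative_real_field) (use False in \<open>auto intro!: derivative_eq_intros simp: algebra_simps\<close>)
    then show "((\<lambda>x. cis (of_int m * x) / (\<i> * of_int m)) has_vector_derivative cis (of_int m * x)) (at x within {0..2*pi})"
      by (simp add: cis_conv_exp)
  qed (auto intro!: continuous_intros)
  also have "\<dots> = 0"
    using cis_multiple_2pi[of m] by (simp add: mult.commute)
  finally show ?thesis using False by simp
qed simp

section \<open>The Hilbert space \<open>L\<^sup>2\<close> of the circle\<close>

lemma borel_measurable_cnj [measurable (raw)]:
  "f \<in> borel_measurable M \<Longrightarrow> (\<lambda>t. cnj (f t)) \<in> borel_measurable M"
  by (rule measurable_compose[where g = cnj, OF _ borel_measurable_continuous_onI[OF continuous_on_cnj[OF continuous_on_id]]])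

lemma L2_measurable: "f \<in> L2 \<Longrightarrow> f \<in> borel_measurable \<T>"
  by (simp add: L2_def)

lemma L2_integrable: "f \<in> L2 \<Longrightarrow> integrable \<T> (\<lambda>t. (cmod (f t))\<^sup>2)"
  by (simp add: L2_def)

lemma L2_bounded_mult:
  assumes f: "f \<in> L2" and u: "u \<in> borel_measurable \<T>" and K: "\<And>t. cmod t = 1 \<Longrightarrow> cmod (u t) \<le> K"
  shows "(\<lambda>t. u t * f t) \<in> L2"
  unfolding L2_def
proof (safe)
  show m: "(\<lambda>t. u t * f t) \<in> borel_measurable \<T>" using u L2_measurable[OF f] by simp
  show "integrable \<T> (\<lambda>t. (cmod (u t * f t))\<^sup>2)"
  proof (rule Bochner_Integration.integrable_bound)
    show "integrable \<T> (\<lambda>t. K\<^sup>2 * (cmod (f t))\<^sup>2)" using L2_integrable[OF f] by simp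
    have "(cmod (u t * f t))\<^sup>2 \<le> K\<^sup>2 * (cmod (f t))\<^sup>2" if "cmod t = 1" for t
      using K[OF that] by (simp add: norm_mult power_mult_distrib mult_right_mono power_mono)
    then show "AE t in \<T>. norm ((cmod (u t * f t))\<^sup>2) \<le> norm (K\<^sup>2 * (cmod (f t))\<^sup>2)" by (auto intro!: AE_I2)
  qed (use m in measurable)
qed

lemma L2_bounded:
  assumes "u \<in> borel_measurable \<T>" "\<And>t. cmod t = 1 \<Longrightarrow> cmod (u t) \<le> K"
  shows "u \<in> L2"
proof -
  have "(\<lambda>t. 1) \<in> L2" by (simp add: L2_def)
  from L2_bounded_mult[OF this assms] show ?thesis by simp
qed

lemma L2_cnj: "f \<in> L2 \<Longrightarrow> (\<lambda>t. cnj (f t)) \<in> L2"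
  by (auto simp: L2_def intro: borel_measurable_cnj)

lemma L2_continuous:
  assumes "continuous_on (sphere 0 1) f"
  shows "f \<in> L2"
  unfolding L2_def
  by (auto intro!: circle_continuous integrable_circle_continuous continuous_intros assms)

lemma L2_mult_integrable:
  assumes "f \<in> L2" "g \<in> L2"
  shows "integrable \<T> (\<lambda>t. f t * g t)"
proof (rule Bochner_Integration.integrable_bound)
  show "integrable \<T> (\<lambda>t. (cmod (f t))\<^sup>2 + (cmod (g t))\<^sup>2)"
    using L2_integrable assms by simp
  have "cmod (f t * g t) \<le> (cmod (f t))\<^sup>2 + (cmod (g t))\<^sup>2" for t
    using sum_squares_bound[of "cmod (f t)" "cmod (g t)"] mult_nonneg_nonneg[OF norm_ge_zero[of "f t"] norm_ge_zero[of "g t"]]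
    unfolding norm_mult mult.assoc by linarith
  then show "AE t in \<T>. norm (f t * g t) \<le> norm ((cmod (f t))\<^sup>2 + (cmod (g t))\<^sup>2)" by (auto intro!: AE_I2)
qed (use assms L2_measurable in measurable)

lemma L2_inner_integrable: "f \<in> L2 \<Longrightarrow> g \<in> L2 \<Longrightarrow> integrable \<T> (\<lambda>t. f t * cnj (g t))"
  by (intro L2_mult_integrable L2_cnj)

lemma L2_add:
  assumes "f \<in> L2" "g \<in> L2"
  shows "(\<lambda>t. f t + g t) \<in> L2"
  unfolding L2_def
proof (safe)
  show m: "(\<lambda>t. f t + g t) \<in> borel_measurable \<T>" using assms L2_measurable by simp
  show "integrable \<T> (\<lambda>t. (cmod (f t + g t))\<^sup>2)"
  proof (rule Bochner_Integration.integrable_bound)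
    show "integrable \<T> (\<lambda>t. 2 * ((cmod (f t))\<^sup>2 + (cmod (g t))\<^sup>2))"
      using L2_integrable assms by simp
    have "(cmod (f t + g t))\<^sup>2 \<le> 2 * ((cmod (f t))\<^sup>2 + (cmod (g t))\<^sup>2)" for t
    proof -
      have "(cmod (f t + g t))\<^sup>2 \<le> (cmod (f t) + cmod (g t))\<^sup>2" by (intro power_mono norm_triangle_ineq) simp
      also have "\<dots> \<le> 2 * ((cmod (f t))\<^sup>2 + (cmod (g t))\<^sup>2)"
        using sum_squares_bound[of "cmod (f t)" "cmod (g t)"] by (simp add: power2_sum)
      finally show ?thesis .
    qed
    then show "AE t in \<T>. norm ((cmod (f t + g t))\<^sup>2) \<le> norm (2 * ((cmod (f t))\<^sup>2 + (cmod (g t))\<^sup>2))"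
      by (auto intro!: AE_I2)
  qed (use m in measurable)
qed

lemma L2_scale: "f \<in> L2 \<Longrightarrow> (\<lambda>t. c * f t) \<in> L2"
  by (rule L2_bounded_mult[where K = "cmod c"]) auto

interpretation L2: semi_inner_space L2 L2_inner
proof
  fix f g h :: "complex \<Rightarrow> complex" and c :: complex
  assume f: "f \<in> L2"
  show "(\<lambda>t. c * f t) \<in> L2" using f by (rule L2_scale)
  have "L2_inner f f = (LINT t|\<T>. complex_of_real ((cmod (f t))\<^sup>2))"
    unfolding L2_inner_def by (intro Bochner_Integration.integral_cong refl) (simp only: complex_norm_square)
  then show "0 \<le> Re (L2_inner f f)" by (simp only: integral_complex_of_real) simp
  {
    assume g: "g \<in> L2"
    show "(\<lambda>t. f t + g t) \<in> L2" using f g by (rule L2_add)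
    show "L2_inner g f = cnj (L2_inner f g)"
      unfolding L2_inner_def Bochner_Integration.integral_cnj[symmetric] by (simp add: mult.commute)
    assume h: "h \<in> L2"
    show "L2_inner (\<lambda>t. f t + g t) h = L2_inner f h + L2_inner g h"
      unfolding L2_inner_def using f g h by (simp add: distrib_right L2_inner_integrable)
  }
  assume h: "h \<in> L2"
  show "L2_inner (\<lambda>t. c * f t) h = c * L2_inner f h"
    unfolding L2_inner_def by (simp add: mult.assoc)
qed

abbreviation norm2 :: "(complex \<Rightarrow> complex) \<Rightarrow> real" where "norm2 \<equiv> form_norm L2_inner"

lemma norm2_sq: "(norm2 f)\<^sup>2 = (LINT t|\<T>. (cmod (f t))\<^sup>2)"
proof -
  have "L2_inner f f = (LINT t|\<T>. complex_of_real ((cmod (f t))\<^sup>2))"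
    unfolding L2_inner_def by (intro Bochner_Integration.integral_cong refl) (simp only: complex_norm_square)
  then show ?thesis by (simp add: form_norm_def integral_complex_of_real del: of_real_power)
qed

lemma norm2_mono:
  assumes "f \<in> L2" "g \<in> L2" "AE t in \<T>. cmod (f t) \<le> cmod (g t)"
  shows "norm2 f \<le> norm2 g"
proof -
  have "(norm2 f)\<^sup>2 \<le> (norm2 g)\<^sup>2"
    unfolding norm2_sq using assms by (intro integral_mono_AE L2_integrable) (auto intro: power_mono)
  then show ?thesis by (rule power2_le_imp_le) (rule L2.nf_nonneg[OF assms(2)])
qed

text \<open>Cauchy-Schwarz against the constant 1, whose norm is 1 because the measure is
  normalized. It makes L^2 Cauchy sequences Cauchy in L^1, which is where almost everywhere
  convergent subsequences come from.\<close>

lemma L2_integral_norm_le: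
  assumes f: "f \<in> L2"
  shows "(LINT t|\<T>. cmod (f t)) \<le> norm2 f"
proof -
  define g where "g = (\<lambda>t. complex_of_real (cmod (f t)))"
  have "g \<in> borel_measurable \<T>" unfolding g_def using L2_measurable[OF f] by measurable
  then have g: "g \<in> L2" using L2_integrable[OF f] by (simp add: L2_def g_def)
  have one: "(\<lambda>t. 1) \<in> L2" by (simp add: L2_def)
  have "L2_inner g (\<lambda>t. 1) = of_real (LINT t|\<T>. cmod (f t))"
    unfolding L2_inner_def g_def by (simp add: integral_complex_of_real)
  then have "(LINT t|\<T>. cmod (f t)) \<le> cmod (L2_inner g (\<lambda>t. 1))" by simp
  also have "\<dots> \<le> norm2 g * norm2 (\<lambda>t. 1)" by (rule L2.Cauchy_Schwarz[OF g one])
  also have "norm2 (\<lambda>t. 1) = 1" by (simp add: form_norm_def L2_inner_def)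
  also have "norm2 g = norm2 f"
  proof (rule power2_eq_imp_eq)
    show "(norm2 g)\<^sup>2 = (norm2 f)\<^sup>2" unfolding norm2_sq by (simp add: g_def)
  qed (intro L2.nf_nonneg f g)+
  finally show ?thesis by simp
qed

lemma L2_inner_tendsto:
  assumes V: "\<And>j. x j \<in> L2" "f \<in> L2" "g \<in> L2" and lim: "(\<lambda>j. norm2 (\<lambda>t. x j t - f t)) \<longlonglongrightarrow> 0"
  shows "(\<lambda>j. L2_inner (x j) g) \<longlonglongrightarrow> L2_inner f g"
proof -
  have "(\<lambda>j. L2_inner (x j) g - L2_inner f g) \<longlonglongrightarrow> 0"
  proof (rule Lim_null_comparison[OF always_eventually])
    show "(\<lambda>j. norm2 (\<lambda>t. x j t - f t) * norm2 g) \<longlonglongrightarrow> 0" using tendsto_mult_left_zero[OF lim] .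
    show "\<forall>j. norm (L2_inner (x j) g - L2_inner f g) \<le> norm2 (\<lambda>t. x j t - f t) * norm2 g"
      using L2.Cauchy_Schwarz[OF L2.V_diff[OF V(1) V(2)] V(3)] by (simp add: L2.B_diff V)
  qed
  then show ?thesis by (simp add: LIM_zero_cancel)
qed

lemma norm2_tendsto:
  assumes V: "\<And>j. x j \<in> L2" "f \<in> L2" and lim: "(\<lambda>j. norm2 (\<lambda>t. x j t - f t)) \<longlonglongrightarrow> 0"
  shows "(\<lambda>j. norm2 (x j)) \<longlonglongrightarrow> norm2 f"
proof -
  have "(\<lambda>j. norm2 (x j) - norm2 f) \<longlonglongrightarrow> 0"
  proof (rule Lim_null_comparison[OF always_eventually lim])
    show "\<forall>j. norm (norm2 (x j) - norm2 f) \<le> norm2 (\<lambda>t. x j t - f t)"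
      using L2.nf_le_add_diff[OF V(1) V(2)] L2.nf_le_add_diff[OF V(2) V(1)] L2.nf_minus_commute[OF V(1) V(2)]
      by (auto simp: abs_le_iff algebra_simps)
  qed
  then show ?thesis by (simp add: LIM_zero_cancel)
qed

text \<open>Riesz-Fischer: a subsequence converges almost everywhere, and Fatou's lemma turns this
  into norm convergence of the whole sequence. The subsequence is part of the conclusion because
  pointwise bounds on infinite products are read off along it.\<close>

lemma L2_complete:
  assumes x: "x \<in> cauchy_seqs L2 L2_inner"
  obtains f r where "f \<in> L2" "(\<lambda>j. norm2 (\<lambda>t. x j t - f t)) \<longlonglongrightarrow> 0"
    "strict_mono r" "AE t in \<T>. (\<lambda>i. x (r i) t) \<longlonglongrightarrow> f t"
proof -
  note V = L2.cauchy_seqsD[OF x]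
  have m[measurable]: "x j \<in> borel_measurable \<T>" for j using L2_measurable[OF V] .
  have one: "(\<lambda>t. 1) \<in> L2" by (simp add: L2_def)
  have int: "integrable \<T> (x j)" for j
    using L2_mult_integrable[OF V one, of j] by simp
  have "\<exists>N. \<forall>i\<ge>N. \<forall>j\<ge>N. (LINT t|\<T>. norm (x i t - x j t)) < e" if "e > 0" for e
  proof -
    obtain N where N: "\<And>i j. i \<ge> N \<Longrightarrow> j \<ge> N \<Longrightarrow> norm2 (\<lambda>t. x i t - x j t) < e"
      using L2.cauchy_seqs_less[OF x \<open>e > 0\<close>] by blast
    then show ?thesis
      using L2_integral_norm_le[OF L2.V_diff[OF V V]] by (meson order_le_less_trans)
  qed
  then obtain r where r: "strict_mono r" "AE t in \<T>. Cauchy (\<lambda>i. x (r i) t)"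
    using cauchy_L1_AE_cauchy_subseq[of \<T> x] int by metis
  \<comment> \<open>Where the subsequence diverges, \<open>lim\<close> has an arbitrary value; this
    happens only on a null set.\<close>
  define f where "f = (\<lambda>t. lim (\<lambda>i. x (r i) t))"
  have f[measurable]: "f \<in> borel_measurable \<T>" unfolding f_def by (intro borel_measurable_lim_metric m)
  have lim: "AE t in \<T>. (\<lambda>i. x (r i) t) \<longlonglongrightarrow> f t"
    using r(2) by eventually_elim (simp add: f_def Cauchy_convergent_iff convergent_LIMSEQ_iff)
  have le: "(\<integral>\<^sup>+t. ennreal ((cmod (x j t - f t))\<^sup>2) \<partial>\<T>) \<le> ennreal (e\<^sup>2)"
    if e: "e > 0" and N: "\<And>i j. i \<ge> N \<Longrightarrow> j \<ge> N \<Longrightarrow> norm2 (\<lambda>t. x i t - x j t) < e" and j: "j \<ge> N" for e N j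
  proof -
    have "(\<integral>\<^sup>+t. ennreal ((cmod (x j t - f t))\<^sup>2) \<partial>\<T>) = (\<integral>\<^sup>+t. liminf (\<lambda>i. ennreal ((cmod (x j t - x (r i) t))\<^sup>2)) \<partial>\<T>)"
    proof (rule nn_integral_cong_AE)
      show "AE t in \<T>. ennreal ((cmod (x j t - f t))\<^sup>2) = liminf (\<lambda>i. ennreal ((cmod (x j t - x (r i) t))\<^sup>2))"
        using lim
      proof eventually_elim
        case (elim t)
        then have "(\<lambda>i. ennreal ((cmod (x j t - x (r i) t))\<^sup>2)) \<longlonglongrightarrow> ennreal ((cmod (x j t - f t))\<^sup>2)"
          by (intro tendsto_intros)
        then show ?case by (rule lim_imp_Liminf[OF sequentially_bot, symmetric])
      qed
    qed
    \<comment> \<open>Fatou's lemma, with j fixed and the limit taken only along r.\<close>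
    also have "\<dots> \<le> liminf (\<lambda>i. \<integral>\<^sup>+t. ennreal ((cmod (x j t - x (r i) t))\<^sup>2) \<partial>\<T>)"
      by (rule nn_integral_liminf) measurable
    also have "\<dots> \<le> ennreal (e\<^sup>2)"
    proof (rule Liminf_le)
      have "\<forall>\<^sub>F i in sequentially. i \<ge> N" by (rule eventually_ge_at_top)
      then show "\<forall>\<^sub>F i in sequentially. (\<integral>\<^sup>+t. ennreal ((cmod (x j t - x (r i) t))\<^sup>2) \<partial>\<T>) \<le> ennreal (e\<^sup>2)"
      proof eventually_elim
        case (elim i)
        then have "norm2 (\<lambda>t. x j t - x (r i) t) < e" using N[OF j, of "r i"] seq_suble[OF r(1), of i] by simp
        then have "(norm2 (\<lambda>t. x j t - x (r i) t))\<^sup>2 \<le> e\<^sup>2"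
          using L2.nf_nonneg[OF L2.V_diff[OF V V]] by (intro power_mono) auto
        then show ?case
          unfolding norm2_sq using L2_integrable[OF L2.V_diff[OF V V]]
          by (subst nn_integral_eq_integral) (auto intro: ennreal_leI)
      qed
    qed simp
    finally show ?thesis .
  qed
  obtain N1 where N1: "\<And>i j. i \<ge> N1 \<Longrightarrow> j \<ge> N1 \<Longrightarrow> norm2 (\<lambda>t. x i t - x j t) < 1"
    using L2.cauchy_seqs_less[OF x zero_less_one] by blast
  \<comment> \<open>One finite distance puts x N1 - f, and therefore f, into
    \<open>L2\<close>.\<close>
  have "(\<integral>\<^sup>+t. ennreal (norm ((cmod (x N1 t - f t))\<^sup>2)) \<partial>\<T>) \<le> ennreal (1\<^sup>2)"
    using le[of 1 N1 N1] N1 by simp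
  also have "\<dots> < \<infinity>" by simp
  finally have "(\<integral>\<^sup>+t. ennreal (norm ((cmod (x N1 t - f t))\<^sup>2)) \<partial>\<T>) < \<infinity>" .
  then have "(\<lambda>t. x N1 t - f t) \<in> L2"
    unfolding L2_def by (auto simp: integrable_iff_bounded)
  from L2.V_diff[OF V[of N1] this] have fL: "f \<in> L2" by simp
  have "(\<lambda>j. norm2 (\<lambda>t. x j t - f t)) \<longlonglongrightarrow> 0"
  proof (rule metric_LIMSEQ_I)
    fix e :: real assume e: "e > 0"
    obtain N where N: "\<And>i j. i \<ge> N \<Longrightarrow> j \<ge> N \<Longrightarrow> norm2 (\<lambda>t. x i t - x j t) < e / 2"
      using L2.cauchy_seqs_less[OF x, of "e / 2"] e by auto
    have "dist (norm2 (\<lambda>t. x j t - f t)) 0 < e" if "j \<ge> N" for j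
    proof -
      have "ennreal ((norm2 (\<lambda>t. x j t - f t))\<^sup>2) \<le> ennreal ((e / 2)\<^sup>2)"
      proof -
        have "(\<integral>\<^sup>+t. ennreal ((cmod (x j t - f t))\<^sup>2) \<partial>\<T>) \<le> ennreal ((e / 2)\<^sup>2)"
          by (rule le[of "e / 2" N j]) (use N that e in auto)
        moreover have "(\<integral>\<^sup>+t. ennreal ((cmod (x j t - f t))\<^sup>2) \<partial>\<T>) = ennreal (LINT t|\<T>. (cmod (x j t - f t))\<^sup>2)"
          by (intro nn_integral_eq_integral L2_integrable L2.V_diff V fL) simp
        ultimately show ?thesis unfolding norm2_sq by (simp only:)
      qed
      then have "(norm2 (\<lambda>t. x j t - f t))\<^sup>2 \<le> (e / 2)\<^sup>2"
        by (subst (asm) ennreal_le_iff) auto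
      then have "norm2 (\<lambda>t. x j t - f t) \<le> e / 2" by (rule power2_le_imp_le) (use e in simp)
      then show ?thesis using e L2.nf_nonneg[OF L2.V_diff[OF V fL], of j] by simp
    qed
    then show "\<exists>no. \<forall>n\<ge>no. dist (norm2 (\<lambda>t. x n t - f t)) 0 < e" by blast
  qed
  from that[OF fL this r(1) lim] show ?thesis .
qed

section \<open>Fourier coefficients, Hardy space and Hankel operators\<close>

lemma L2_powi: "(\<lambda>t. t powi m) \<in> L2"
  by (intro L2_continuous continuous_on_powi_circle)

lemma powi_diff_circle: "cmod t = 1 \<Longrightarrow> t powi a * cnj (t powi b) = t powi (a - b)"
proof -
  assume t: "cmod t = 1"
  then have "cnj (t powi b) = inverse (t powi b)"
    using divide_conv_cnj[of "t powi b" 1] by (simp add: norm_power_int inverse_eq_divide)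
  moreover have "t \<noteq> 0" using t by auto
  ultimately show ?thesis by (simp add: power_int_diff divide_inverse)
qed

lemma L2_inner_powi: "L2_inner (\<lambda>t. t powi a) (\<lambda>t. t powi b) = (if a = b then 1 else 0)"
proof -
  have "L2_inner (\<lambda>t. t powi a) (\<lambda>t. t powi b) = (LINT t|\<T>. t powi (a - b))"
    unfolding L2_inner_def by (intro Bochner_Integration.integral_cong refl)
      (auto simp: powi_diff_circle simp del: complex_cnj_power_int)
  then show ?thesis by (simp add: integral_powi)
qed

lemma norm2_powi: "norm2 (\<lambda>t. t powi m) = 1"
  by (simp add: form_norm_def L2_inner_powi)

lemma fourier_coeff_bound: "f \<in> L2 \<Longrightarrow> cmod (fourier_coeff f m) \<le> norm2 f"
  using L2.Cauchy_Schwarz[OF _ L2_powi, of f m] by (simp add: fourier_coeff_def norm2_powi)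

lemma fourier_coeff_powi: "fourier_coeff (\<lambda>t. t powi a) m = (if m = a then 1 else 0)"
  by (simp add: fourier_coeff_def L2_inner_powi)

lemma fourier_coeff_diff:
  "f \<in> L2 \<Longrightarrow> g \<in> L2 \<Longrightarrow> fourier_coeff (\<lambda>t. f t - g t) m = fourier_coeff f m - fourier_coeff g m"
  by (simp add: fourier_coeff_def L2.B_diff L2_powi)

lemma fourier_coeff_add:
  "f \<in> L2 \<Longrightarrow> g \<in> L2 \<Longrightarrow> fourier_coeff (\<lambda>t. f t + g t) m = fourier_coeff f m + fourier_coeff g m"
  by (simp add: fourier_coeff_def L2.B_add L2_powi)

lemma fourier_coeff_scale:
  "f \<in> L2 \<Longrightarrow> fourier_coeff (\<lambda>t. c * f t) m = c * fourier_coeff f m"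
  by (simp add: fourier_coeff_def L2.B_scale L2_powi)

lemma fourier_coeff_shift:
  "fourier_coeff (\<lambda>t. t powi a * f t) m = fourier_coeff f (m - a)"
proof -
  have "t powi a * f t * cnj (t powi m) = f t * cnj (t powi (m - a))" if "cmod t = 1" for t
    using powi_diff_circle[OF that, of a m] powi_diff_circle[OF that, of 0 "m - a"] by (simp add: mult.commute mult.left_commute)
  then show ?thesis
    unfolding fourier_coeff_def L2_inner_def by (intro Bochner_Integration.integral_cong refl) auto
qed

lemma H2_L2: "f \<in> H2 \<Longrightarrow> f \<in> L2"
  by (simp add: H2_def)

lemma H2_add: "f \<in> H2 \<Longrightarrow> g \<in> H2 \<Longrightarrow> (\<lambda>t. f t + g t) \<in> H2"
  by (simp add: H2_def fourier_coeff_add L2.V_add)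

lemma H2_scale: "f \<in> H2 \<Longrightarrow> (\<lambda>t. c * f t) \<in> H2"
  by (simp add: H2_def fourier_coeff_scale L2.V_scale)

lemma H2_powi: "0 \<le> m \<Longrightarrow> (\<lambda>t. t powi m) \<in> H2"
  by (simp add: H2_def L2_powi fourier_coeff_powi)

lemma fourier_coeff_tendsto:
  assumes "\<And>j. x j \<in> L2" "f \<in> L2" "(\<lambda>j. norm2 (\<lambda>t. x j t - f t)) \<longlonglongrightarrow> 0"
  shows "(\<lambda>j. fourier_coeff (x j) m) \<longlonglongrightarrow> fourier_coeff f m"
  unfolding fourier_coeff_def by (intro L2_inner_tendsto assms L2_powi)

lemma H2_minus_L2: "h \<in> H2_minus \<Longrightarrow> h \<in> L2"
  by (simp add: H2_minus_def)

lemma H2_minusD: "h \<in> H2_minus \<Longrightarrow> f \<in> H2 \<Longrightarrow> L2_inner h f = 0"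
  by (simp add: H2_minus_def)

lemma H2_minusD': "h \<in> H2_minus \<Longrightarrow> f \<in> H2 \<Longrightarrow> L2_inner f h = 0"
  using L2.B_herm[OF H2_minus_L2 H2_L2, of h f] by (simp add: H2_minusD)

lemma H2_minus_diff: "f \<in> H2_minus \<Longrightarrow> g \<in> H2_minus \<Longrightarrow> (\<lambda>t. f t - g t) \<in> H2_minus"
  by (simp add: H2_minus_def L2.B_diff L2.V_diff H2_L2)

lemma H2_minus_add: "f \<in> H2_minus \<Longrightarrow> g \<in> H2_minus \<Longrightarrow> (\<lambda>t. f t + g t) \<in> H2_minus"
  by (simp add: H2_minus_def L2.B_add L2.V_add H2_L2)

lemma H2_minus_scale: "f \<in> H2_minus \<Longrightarrow> (\<lambda>t. c * f t) \<in> H2_minus"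
  by (simp add: H2_minus_def L2.B_scale L2.V_scale H2_L2)

lemma H2_minus_powi: "m < 0 \<Longrightarrow> (\<lambda>t. t powi m) \<in> H2_minus"
proof -
  assume m: "m < 0"
  have "L2_inner (\<lambda>t. t powi m) f = 0" if "f \<in> H2" for f
    using L2.B_herm[OF H2_L2[OF that] L2_powi, of m] that m by (simp add: H2_def fourier_coeff_def)
  then show ?thesis by (simp add: H2_minus_def L2_powi)
qed

lemma H2_minus_closed:
  assumes x: "\<And>j. x j \<in> H2_minus" and f: "f \<in> L2" and lim: "(\<lambda>j. norm2 (\<lambda>t. x j t - f t)) \<longlonglongrightarrow> 0"
  shows "f \<in> H2_minus"
proof -
  have "L2_inner f g = 0" if "g \<in> H2" for g
    using L2_inner_tendsto[OF H2_minus_L2[OF x] f H2_L2[OF that] lim] x that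
    by (simp add: H2_minusD LIMSEQ_const_iff)
  then show ?thesis using f by (simp add: H2_minus_def)
qed

text \<open>The projection onto \<open>H2_minus\<close> is the sum of the negative part of the Fourier series.\<close>

lemma negative_part_exists:
  assumes g: "g \<in> L2"
  shows "\<exists>h\<in>H2_minus. (\<forall>u\<in>H2_minus. L2_inner (\<lambda>t. g t - h t) u = 0) \<and> (\<lambda>t. g t - h t) \<in> H2
     \<and> (\<lambda>k. (cmod (fourier_coeff g (- int (Suc k))))\<^sup>2) sums (norm2 h)\<^sup>2"
proof -
  \<comment> \<open>Index k stands for frequency -(k + 1), so that k runs through all negative
    frequencies starting at 0.\<close>
  define c where "c k = fourier_coeff g (- int (Suc k))" for k
  define s where "s n t = (\<Sum>k<n. c k * t powi (- int (Suc k)))" for n and t :: complex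
  have s_Suc: "s (Suc n) = (\<lambda>t. s n t + c n * t powi (- int (Suc n)))" for n
    by (auto simp: s_def)
  have sH: "s n \<in> H2_minus" for n
  proof (induction n)
    case 0
    have "(\<lambda>t::complex. 0 * t powi (-1)) \<in> H2_minus" by (intro H2_minus_scale H2_minus_powi) simp
    then show ?case by (simp add: s_def)
  next
    case (Suc n)
    then show ?case unfolding s_Suc by (intro H2_minus_add H2_minus_scale H2_minus_powi) auto
  qed
  note sL = H2_minus_L2[OF sH]
  have s_coeff: "fourier_coeff (s n) m = (if m < 0 \<and> nat (-m) \<le> n then c (nat (-m) - 1) else 0)" for n m
  proof (induction n)
    case 0
    then show ?case by (auto simp: s_def fourier_coeff_def L2_inner_def)
  next
    case (Suc n)
    have "fourier_coeff (s (Suc n)) m = fourier_coeff (s n) m + c n * (if m = - int (Suc n) then 1 else 0)"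
      unfolding s_Suc by (subst fourier_coeff_add[OF sL L2.V_scale[OF L2_powi]], subst fourier_coeff_scale[OF L2_powi])
         (simp add: fourier_coeff_powi)
    then show ?case unfolding Suc by (auto simp: nat_add_distrib)
  qed
  have ip: "L2_inner f (s n) = (\<Sum>k<n. cnj (c k) * fourier_coeff f (- int (Suc k)))" if f: "f \<in> L2" for f n
  proof (induction n)
    case 0
    then show ?case by (simp add: s_def L2_inner_def)
  next
    case (Suc n)
    show ?case
      unfolding s_Suc
      by (subst L2.B_add_right[OF sL L2.V_scale[OF L2_powi] f], subst L2.B_scale_right[OF L2_powi f])
        (simp add: Suc fourier_coeff_def)
  qed
  have norm_s: "(norm2 (s n))\<^sup>2 = (\<Sum>k<n. (cmod (c k))\<^sup>2)" for n
  proof -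
    have "L2_inner (s n) (s n) = (\<Sum>k<n. cnj (c k) * c k)"
      unfolding ip[OF sL] by (intro sum.cong refl) (auto simp: s_coeff nat_minus_as_int)
    also have "\<dots> = of_real (\<Sum>k<n. (cmod (c k))\<^sup>2)"
      unfolding of_real_sum by (intro sum.cong refl) (simp only: complex_norm_square mult.commute)
    finally show ?thesis
      unfolding L2.B_self[OF sL] of_real_eq_iff .
  qed
  have norm_diff: "(norm2 (\<lambda>t. s n t - s m t))\<^sup>2 = \<bar>(\<Sum>k<n. (cmod (c k))\<^sup>2) - (\<Sum>k<m. (cmod (c k))\<^sup>2)\<bar>" for n m
  proof -
    have *: "(norm2 (\<lambda>t. s n t - s m t))\<^sup>2 = (\<Sum>k<n. (cmod (c k))\<^sup>2) - (\<Sum>k<m. (cmod (c k))\<^sup>2)" if "m \<le> n" for n m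
    proof -
      have "L2_inner (s n) (s m) = (\<Sum>k<m. cnj (c k) * c k)"
        unfolding ip[OF sL] using that by (intro sum.cong refl) (auto simp: s_coeff nat_minus_as_int)
      also have "\<dots> = of_real (\<Sum>k<m. (cmod (c k))\<^sup>2)"
        unfolding of_real_sum by (intro sum.cong refl) (simp only: complex_norm_square mult.commute)
      finally show ?thesis
        using L2.nf_diff_scale[OF sL sL, of n 1 m] by (simp add: norm_s)
    qed
    have mono: "(\<Sum>k<m. (cmod (c k))\<^sup>2) \<le> (\<Sum>k<n. (cmod (c k))\<^sup>2)" if "m \<le> n" for m n
      using that by (intro sum_mono2) auto
    show ?thesis
      using *[of m n] *[of n m] L2.nf_minus_commute[OF sL sL, of n m] mono[of m n] mono[of n m]
      by (cases "m \<le> n") auto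
  qed
  \<comment> \<open>The squared norm of g - s n is nonnegative, and its expansion is the difference
    of the two sides.\<close>
  have Bessel: "(\<Sum>k<n. (cmod (c k))\<^sup>2) \<le> (norm2 g)\<^sup>2" for n
  proof -
    have "L2_inner g (s n) = (\<Sum>k<n. cnj (c k) * c k)"
      unfolding ip[OF g] by (simp add: c_def)
    also have "\<dots> = of_real (\<Sum>k<n. (cmod (c k))\<^sup>2)"
      unfolding of_real_sum by (intro sum.cong refl) (simp only: complex_norm_square mult.commute)
    finally have "(norm2 (\<lambda>t. g t - 1 * s n t))\<^sup>2 = (norm2 g)\<^sup>2 - (\<Sum>k<n. (cmod (c k))\<^sup>2)"
      unfolding L2.nf_diff_scale[OF g sL] norm_s by simp
    moreover have "0 \<le> (norm2 (\<lambda>t. g t - 1 * s n t))\<^sup>2" by (rule zero_le_power2)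
    ultimately show ?thesis by linarith
  qed
  have summ: "summable (\<lambda>k. (cmod (c k))\<^sup>2)"
    by (intro summableI_nonneg_bounded[OF _ Bessel]) simp
  have "s \<in> cauchy_seqs L2 L2_inner"
  proof -
    have "\<exists>N. \<forall>i\<ge>N. \<forall>j\<ge>N. norm2 (\<lambda>t. s i t - s j t) < e" if e: "e > 0" for e
    proof -
      have "Cauchy (\<lambda>n. \<Sum>k<n. (cmod (c k))\<^sup>2)"
        using summ by (simp add: summable_iff_convergent Cauchy_convergent_iff)
      then obtain N where N: "\<And>i j. i \<ge> N \<Longrightarrow> j \<ge> N \<Longrightarrow> dist (\<Sum>k<i. (cmod (c k))\<^sup>2) (\<Sum>k<j. (cmod (c k))\<^sup>2) < e\<^sup>2"
        using metric_CauchyD[of "\<lambda>n. \<Sum>k<n. (cmod (c k))\<^sup>2" "e\<^sup>2"] e by auto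
      have "norm2 (\<lambda>t. s i t - s j t) < e" if "i \<ge> N" "j \<ge> N" for i j
      proof (rule power2_less_imp_less)
        show "(norm2 (\<lambda>t. s i t - s j t))\<^sup>2 < e\<^sup>2" using N[OF that] by (simp only: norm_diff dist_real_def)
      qed (use e in simp)
      then show ?thesis by blast
    qed
    then show ?thesis by (simp add: cauchy_seqs_def sL)
  qed
  then obtain h where h: "h \<in> L2" "(\<lambda>j. norm2 (\<lambda>t. s j t - h t)) \<longlonglongrightarrow> 0"
    by (rule L2_complete)
  have hH: "h \<in> H2_minus" by (rule H2_minus_closed[OF sH h])
  \<comment> \<open>Frequency m is contained in s j as soon as j is at least -m, so the coefficient
    is eventually constant in j. Hence g - h has no negative frequencies.\<close>
  have hc: "fourier_coeff h m = fourier_coeff g m" if m: "m < 0" for m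
  proof -
    have "(\<lambda>j. fourier_coeff (s j) m) \<longlonglongrightarrow> fourier_coeff g m"
    proof (rule tendsto_eventually)
      have "\<forall>\<^sub>F j in sequentially. j \<ge> nat (- m)" by (rule eventually_ge_at_top)
      then show "\<forall>\<^sub>F j in sequentially. fourier_coeff (s j) m = fourier_coeff g m"
      proof eventually_elim
        case (elim j)
        have "- int (Suc (nat (- m) - 1)) = m" using m by linarith
        then have "c (nat (- m) - 1) = fourier_coeff g m" unfolding c_def by (simp only:)
        then show ?case using elim m by (simp add: s_coeff)
      qed
    qed
    with fourier_coeff_tendsto[OF sL h] show ?thesis using LIMSEQ_unique by blast
  qed
  have diff: "(\<lambda>t. g t - h t) \<in> H2"
    using g h(1) hc by (simp add: H2_def L2.V_diff fourier_coeff_diff)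
  have "(\<lambda>n. \<Sum>k<n. (cmod (c k))\<^sup>2) \<longlonglongrightarrow> (norm2 h)\<^sup>2"
    using tendsto_power[OF norm2_tendsto[OF sL h], of 2] by (simp only: norm_s)
  then have "(\<lambda>k. (cmod (c k))\<^sup>2) sums (norm2 h)\<^sup>2" by (simp add: sums_def)
  then show ?thesis
    using hH diff H2_minusD' unfolding c_def by blast
qed

text \<open>\<open>orth_proj\<close> is a choice, so it may differ from the Fourier sum h of the
  previous lemma. Their difference lies in \<open>H2_minus\<close> and is orthogonal to itself,
  hence has norm zero, and coefficients and norm carry over from h.\<close>

lemma orth_proj_H2_minus:
  assumes g: "g \<in> L2"
  shows "orth_proj H2_minus g \<in> H2_minus"
    and "u \<in> H2_minus \<Longrightarrow> L2_inner (\<lambda>t. g t - orth_proj H2_minus g t) u = 0"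
    and "(\<lambda>t. g t - orth_proj H2_minus g t) \<in> H2"
    and "(\<lambda>k. (cmod (fourier_coeff g (- int (Suc k))))\<^sup>2) sums (norm2 (orth_proj H2_minus g))\<^sup>2"
proof -
  define p where "p = orth_proj H2_minus g"
  obtain h where h: "h \<in> H2_minus" "\<And>u. u \<in> H2_minus \<Longrightarrow> L2_inner (\<lambda>t. g t - h t) u = 0"
     "(\<lambda>t. g t - h t) \<in> H2" "(\<lambda>k. (cmod (fourier_coeff g (- int (Suc k))))\<^sup>2) sums (norm2 h)\<^sup>2"
    using negative_part_exists[OF g] by blast
  have "p \<in> H2_minus \<and> (\<forall>u\<in>H2_minus. L2_inner (\<lambda>t. g t - p t) u = 0)"
    unfolding p_def orth_proj_def by (rule someI[of _ h]) (use h in blast)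
  then have p: "p \<in> H2_minus" "\<And>u. u \<in> H2_minus \<Longrightarrow> L2_inner (\<lambda>t. g t - p t) u = 0" by auto
  note L = g H2_minus_L2[OF h(1)] H2_minus_L2[OF p(1)]
  have d: "(\<lambda>t. h t - p t) \<in> H2_minus" by (intro H2_minus_diff h p)
  have "L2_inner (\<lambda>t. h t - p t) (\<lambda>t. h t - p t) = 0"
    using p(2)[OF d] h(2)[OF d] L by (simp add: L2.B_diff H2_minus_L2[OF d])
  then have nz: "norm2 (\<lambda>t. h t - p t) = 0" by (simp add: form_norm_def)
  \<comment> \<open>Read as a constant sequence, h converges to p in norm, so the continuity lemmas
    yield equality of norms and of coefficients.\<close>
  then have conv: "(\<lambda>j::nat. norm2 (\<lambda>t. h t - p t)) \<longlonglongrightarrow> 0" by simp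
  have "norm2 h = norm2 p"
    using norm2_tendsto[OF L(2) L(3) conv] by (simp add: LIMSEQ_const_iff)
  with h(4) show "(\<lambda>k. (cmod (fourier_coeff g (- int (Suc k))))\<^sup>2) sums (norm2 p)\<^sup>2" by simp
  have "fourier_coeff h m = fourier_coeff p m" for m
    using fourier_coeff_tendsto[OF L(2) L(3) conv, of m] by (simp add: LIMSEQ_const_iff)
  then show "(\<lambda>t. g t - p t) \<in> H2"
    using h(3) L by (simp add: H2_def L2.V_diff fourier_coeff_diff)
  show "p \<in> H2_minus" "u \<in> H2_minus \<Longrightarrow> L2_inner (\<lambda>t. g t - p t) u = 0" using p by auto
qed

lemma norm2_orth_proj_le:
  assumes g: "g \<in> L2"
  shows "norm2 (orth_proj H2_minus g) \<le> norm2 g"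
proof -
  let ?p = "orth_proj H2_minus g"
  note p = orth_proj_H2_minus[OF g]
  have "L2_inner g ?p = L2_inner ?p ?p"
    using p(2)[OF p(1)] g p(1)[THEN H2_minus_L2] by (simp add: L2.B_diff)
  then have "(norm2 ?p)\<^sup>2 = cmod (L2_inner g ?p)"
    by (simp only: L2.B_self[OF p(1)[THEN H2_minus_L2]] norm_of_real) simp
  also have "\<dots> \<le> norm2 g * norm2 ?p" by (rule L2.Cauchy_Schwarz[OF g p(1)[THEN H2_minus_L2]])
  finally show ?thesis
    using L2.nf_nonneg[OF g] L2.nf_nonneg[OF p(1)[THEN H2_minus_L2]]
    by (cases "norm2 ?p = 0") (simp_all add: power2_eq_square)
qed

section \<open>Hankel operators and their adjoints\<close>

text \<open>The adjoint sends h to the projection of cnj R * h onto \<open>H2\<close>, which is the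
  witness \<open>?u\<close>. Exhibiting one function with the adjoint property is enough, because
  \<open>hankel_adjoint\<close> is defined by choice.\<close>

lemma hankel_adjoint:
  assumes R: "R \<in> borel_measurable \<T>" "\<And>t. cmod t = 1 \<Longrightarrow> cmod (R t) \<le> K" and h: "h \<in> H2_minus"
  shows "hankel_adjoint R h \<in> H2" "f \<in> H2 \<Longrightarrow> L2_inner (hankel_adjoint R h) f = L2_inner h (hankel R f)"
proof -
  define G where "G = (\<lambda>t. cnj (R t) * h t)"
  have G: "G \<in> L2"
    unfolding G_def using R h by (intro L2_bounded_mult[where K = K] H2_minus_L2 borel_measurable_cnj) auto
  let ?u = "\<lambda>t. G t - orth_proj H2_minus G t"
  have "L2_inner ?u f = L2_inner h (hankel R f)" if f: "f \<in> H2" for f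
  proof -
    have Rf: "(\<lambda>t. R t * f t) \<in> L2" using R f by (intro L2_bounded_mult[where K = K] H2_L2)
    note p = orth_proj_H2_minus[OF Rf]
    have "L2_inner ?u f = L2_inner G f"
      using G f orth_proj_H2_minus(1)[OF G] by (simp add: L2.B_diff H2_minus_L2 H2_L2 H2_minusD)
    also have "\<dots> = L2_inner h (\<lambda>t. R t * f t)"
      unfolding L2_inner_def G_def by (simp add: algebra_simps)
    also have "\<dots> = L2_inner h (orth_proj H2_minus (\<lambda>t. R t * f t))"
      using H2_minusD[OF h p(3)] Rf h p(1) by (simp add: L2.B_diff_right H2_minus_L2)
    finally show ?thesis by (simp add: hankel_def)
  qed
  then have ex: "?u \<in> H2 \<and> (\<forall>f\<in>H2. L2_inner ?u f = L2_inner h (hankel R f))"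
    using orth_proj_H2_minus(3)[OF G] by blast
  have "hankel_adjoint R h \<in> H2 \<and> (\<forall>f\<in>H2. L2_inner (hankel_adjoint R h) f = L2_inner h (hankel R f))"
    unfolding hankel_adjoint_def by (rule someI[of _ ?u]) (rule ex)
  then show "hankel_adjoint R h \<in> H2" "f \<in> H2 \<Longrightarrow> L2_inner (hankel_adjoint R h) f = L2_inner h (hankel R f)"
    by auto
qed

lemma hankel_H2_minus:
  assumes R: "R \<in> borel_measurable \<T>" "\<And>t. cmod t = 1 \<Longrightarrow> cmod (R t) \<le> K" and f: "f \<in> H2"
  shows "hankel R f \<in> H2_minus"
  unfolding hankel_def
  by (intro orth_proj_H2_minus L2_bounded_mult[where K = K] H2_L2 R f)

section \<open>Point evaluations\<close>

lemma disk_value_summable: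
  assumes f: "f \<in> L2" and z: "cmod z < 1"
  shows "summable (\<lambda>m. fourier_coeff f (int m) * z ^ m)"
proof (rule summable_comparison_test[OF exI[of _ 0]])
  show "summable (\<lambda>m. norm2 f * cmod z ^ m)" using z by (intro summable_mult summable_geometric) simp
  show "\<forall>m\<ge>0. norm (fourier_coeff f (int m) * z ^ m) \<le> norm2 f * cmod z ^ m"
    using fourier_coeff_bound[OF f] by (auto simp: norm_mult norm_power intro: mult_right_mono)
qed

lemma disk_value_add: "f \<in> L2 \<Longrightarrow> g \<in> L2 \<Longrightarrow> cmod z < 1 \<Longrightarrow> disk_value (\<lambda>t. f t + g t) z = disk_value f z + disk_value g z"
  unfolding disk_value_def by (simp add: fourier_coeff_add distrib_right suminf_add disk_value_summable)

lemma disk_value_diff: "f \<in> L2 \<Longrightarrow> g \<in> L2 \<Longrightarrow> cmod z < 1 \<Longrightarrow> disk_value (\<lambda>t. f t - g t) z = disk_value f z - disk_value g z"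
  unfolding disk_value_def by (simp add: fourier_coeff_diff left_diff_distrib suminf_diff disk_value_summable)

lemma disk_value_scale: "f \<in> L2 \<Longrightarrow> cmod z < 1 \<Longrightarrow> disk_value (\<lambda>t. c * f t) z = c * disk_value f z"
  unfolding disk_value_def by (simp add: fourier_coeff_scale mult.assoc suminf_mult disk_value_summable)

lemma disk_value_0: "disk_value f 0 = fourier_coeff f 0"
proof -
  have "(\<Sum>m. fourier_coeff f (int m) * 0 ^ m) = (\<Sum>m\<in>{0}. fourier_coeff f (int m) * 0 ^ m)"
    by (rule suminf_finite) auto
  then show ?thesis by (simp add: disk_value_def)
qed

text \<open>Each coefficient is bounded by \<open>norm2 f\<close> and the geometric series is
  summed. This is cruder than Cauchy-Schwarz but suffices for continuity of the point
  values.\<close>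

lemma disk_value_bound:
  assumes f: "f \<in> L2" and z: "cmod z < 1"
  shows "cmod (disk_value f z) \<le> norm2 f / (1 - cmod z)"
proof -
  have s: "summable (\<lambda>m. norm2 f * cmod z ^ m)" using z by (intro summable_mult summable_geometric) simp
  have "cmod (disk_value f z) \<le> (\<Sum>m. norm2 f * cmod z ^ m)"
    unfolding disk_value_def using fourier_coeff_bound[OF f] s
    by (intro norm_suminf_le) (auto simp: norm_mult norm_power intro: mult_right_mono)
  also have "\<dots> = norm2 f / (1 - cmod z)"
    using z by (subst suminf_mult) (auto simp: suminf_geometric summable_geometric)
  finally show ?thesis .
qed

lemma disk_value_tendsto:
  assumes V: "\<And>j. x j \<in> L2" "f \<in> L2" and lim: "(\<lambda>j. norm2 (\<lambda>t. x j t - f t)) \<longlonglongrightarrow> 0" and z: "cmod z < 1"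
  shows "(\<lambda>j. disk_value (x j) z) \<longlonglongrightarrow> disk_value f z"
proof -
  have "(\<lambda>j. disk_value (x j) z - disk_value f z) \<longlonglongrightarrow> 0"
  proof (rule Lim_null_comparison[OF always_eventually])
    show "(\<lambda>j. norm2 (\<lambda>t. x j t - f t) / (1 - cmod z)) \<longlonglongrightarrow> 0" using tendsto_divide_zero[OF lim] .
    show "\<forall>j. norm (disk_value (x j) z - disk_value f z) \<le> norm2 (\<lambda>t. x j t - f t) / (1 - cmod z)"
      using disk_value_bound[OF L2.V_diff[OF V] z] by (simp add: disk_value_diff V z)
  qed
  then show ?thesis by (simp add: LIM_zero_cancel)
qed

section \<open>Multipliers of the Hardy space\<close>

text \<open>Stands for the bounded analytic functions, given by boundary values. Multiplicativity in
  the disk is built in because \<open>disk_value\<close> is a power series in Fourier coefficients,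
  from which the effect of a pointwise product on the circle cannot be read off directly.\<close>

definition H2_multiplier :: "(complex \<Rightarrow> complex) \<Rightarrow> bool" where
  "H2_multiplier \<psi> \<longleftrightarrow> \<psi> \<in> borel_measurable \<T> \<and> (\<exists>K. \<forall>t. cmod t = 1 \<longrightarrow> cmod (\<psi> t) \<le> K) \<and>
     (\<forall>f\<in>H2. (\<lambda>t. \<psi> t * f t) \<in> H2 \<and>
       (\<forall>z. cmod z < 1 \<longrightarrow> disk_value (\<lambda>t. \<psi> t * f t) z = disk_value \<psi> z * disk_value f z))"

lemma H2_multiplierI:
  assumes "\<psi> \<in> borel_measurable \<T>" "\<And>t. cmod t = 1 \<Longrightarrow> cmod (\<psi> t) \<le> K"
    "\<And>f. f \<in> H2 \<Longrightarrow> (\<lambda>t. \<psi> t * f t) \<in> H2"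
    "\<And>f z. f \<in> H2 \<Longrightarrow> cmod z < 1 \<Longrightarrow> disk_value (\<lambda>t. \<psi> t * f t) z = disk_value \<psi> z * disk_value f z"
  shows "H2_multiplier \<psi>"
  using assms unfolding H2_multiplier_def by blast

lemma H2_multiplierD:
  assumes "H2_multiplier \<psi>"
  shows "\<psi> \<in> borel_measurable \<T>" "f \<in> H2 \<Longrightarrow> (\<lambda>t. \<psi> t * f t) \<in> H2"
    "f \<in> H2 \<Longrightarrow> cmod z < 1 \<Longrightarrow> disk_value (\<lambda>t. \<psi> t * f t) z = disk_value \<psi> z * disk_value f z"
  using assms unfolding H2_multiplier_def by blast+

lemma H2_multiplier_bounded:
  assumes "H2_multiplier \<psi>"
  obtains K where "K \<ge> 0" "\<And>t. cmod t = 1 \<Longrightarrow> cmod (\<psi> t) \<le> K"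
proof -
  obtain K where "\<And>t. cmod t = 1 \<Longrightarrow> cmod (\<psi> t) \<le> K"
    using assms unfolding H2_multiplier_def by blast
  then show ?thesis using that[of "max K 0"] by (simp add: le_max_iff_disj)
qed

lemma H2_one: "(\<lambda>t. 1) \<in> H2"
  using H2_powi[of 0] by simp

lemma H2_multiplier_H2: "H2_multiplier \<psi> \<Longrightarrow> \<psi> \<in> H2"
  using H2_multiplierD(2)[OF _ H2_one] by simp

lemma disk_value_power: "disk_value (\<lambda>t. t ^ k) z = z ^ k"
proof -
  have c: "fourier_coeff (\<lambda>t. t ^ k) m = (if m = int k then 1 else 0)" for m
    using fourier_coeff_powi[of "int k" m] by simp
  have "(\<Sum>m. fourier_coeff (\<lambda>t. t ^ k) (int m) * z ^ m)
      = (\<Sum>m\<in>{k}. fourier_coeff (\<lambda>t. t ^ k) (int m) * z ^ m)"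
    by (rule suminf_finite) (auto simp: c)
  then show ?thesis by (simp add: disk_value_def c)
qed

lemma circle_measurable_id: "(\<lambda>t. t) \<in> borel_measurable \<T>"
  by (rule circle_continuous) (rule continuous_on_id)

lemma disk_value_one: "disk_value (\<lambda>t. 1) z = 1"
  using disk_value_power[of 0] by simp

lemma disk_value_const: "cmod z < 1 \<Longrightarrow> disk_value (\<lambda>t. c) z = c"
  using disk_value_scale[OF H2_L2[OF H2_one], of z c] by (simp add: disk_value_one)

lemma H2_multiplier_const: "H2_multiplier (\<lambda>t. c)"
  by (rule H2_multiplierI[where K = "cmod c"])
    (simp_all add: H2_scale disk_value_scale H2_L2 disk_value_const)

lemma H2_multiplier_add:
  assumes "H2_multiplier \<psi>" "H2_multiplier \<phi>"
  shows "H2_multiplier (\<lambda>t. \<psi> t + \<phi> t)"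
proof -
  obtain K where K: "\<And>t. cmod t = 1 \<Longrightarrow> cmod (\<psi> t) \<le> K" using H2_multiplier_bounded[OF assms(1)] by blast
  obtain L where L: "\<And>t. cmod t = 1 \<Longrightarrow> cmod (\<phi> t) \<le> L" using H2_multiplier_bounded[OF assms(2)] by blast
  note D = H2_multiplierD[OF assms(1)] H2_multiplierD[OF assms(2)]
  show ?thesis
  proof (rule H2_multiplierI[where K = "K + L"])
    show "cmod (\<psi> t + \<phi> t) \<le> K + L" if "cmod t = 1" for t
      using norm_triangle_ineq[of "\<psi> t" "\<phi> t"] K[OF that] L[OF that] by linarith
  qed (use D assms in \<open>simp_all add: distrib_right H2_add disk_value_add H2_L2 H2_multiplier_H2\<close>)
qed

lemma H2_multiplier_mult:
  assumes "H2_multiplier \<psi>" "H2_multiplier \<phi>"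
  shows "H2_multiplier (\<lambda>t. \<psi> t * \<phi> t)"
proof -
  obtain K where K: "K \<ge> 0" "\<And>t. cmod t = 1 \<Longrightarrow> cmod (\<psi> t) \<le> K" using H2_multiplier_bounded[OF assms(1)] by blast
  obtain L where L: "L \<ge> 0" "\<And>t. cmod t = 1 \<Longrightarrow> cmod (\<phi> t) \<le> L" using H2_multiplier_bounded[OF assms(2)] by blast
  note D = H2_multiplierD[OF assms(1)] H2_multiplierD[OF assms(2)]
  show ?thesis
  proof (rule H2_multiplierI[where K = "K * L"])
    show "cmod (\<psi> t * \<phi> t) \<le> K * L" if "cmod t = 1" for t
      unfolding norm_mult using K L that by (intro mult_mono) auto
  qed (use D assms in \<open>simp_all add: mult.assoc H2_multiplier_H2\<close>)
qed

lemma disk_value_mult: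
  "H2_multiplier \<psi> \<Longrightarrow> H2_multiplier \<phi> \<Longrightarrow> cmod z < 1 \<Longrightarrow> disk_value (\<lambda>t. \<psi> t * \<phi> t) z = disk_value \<psi> z * disk_value \<phi> z"
  by (simp add: H2_multiplierD H2_multiplier_H2)

lemma disk_value_shift:
  assumes f: "f \<in> H2" and z: "cmod z < 1"
  shows "disk_value (\<lambda>t. t * f t) z = z * disk_value f z"
proof -
  have c: "fourier_coeff (\<lambda>t. t * f t) m = fourier_coeff f (m - 1)" for m
    using fourier_coeff_shift[of 1 f m] by simp
  have s: "summable (\<lambda>m. fourier_coeff (\<lambda>t. t * f t) (int m) * z ^ m)"
    by (rule disk_value_summable[OF L2_bounded_mult[where K = 1] z]) (use H2_L2[OF f] circle_measurable_id in auto)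
  have "disk_value (\<lambda>t. t * f t) z = fourier_coeff f (- 1) + (\<Sum>m. z * (fourier_coeff f (int m) * z ^ m))"
    using suminf_split_head[OF s] by (simp add: disk_value_def c algebra_simps)
  also have "\<dots> = z * disk_value f z"
    using f suminf_mult[OF disk_value_summable[OF H2_L2[OF f] z], of z] by (simp add: H2_def disk_value_def)
  finally show ?thesis .
qed

lemma H2_multiplier_id: "H2_multiplier (\<lambda>t. t)"
proof (rule H2_multiplierI[where K = 1])
  show "(\<lambda>t. t * f t) \<in> H2" if "f \<in> H2" for f
  proof -
    have "(\<lambda>t. t * f t) \<in> L2" by (rule L2_bounded_mult[where K = 1]) (use H2_L2[OF that] circle_measurable_id in auto)
    then show ?thesis using that fourier_coeff_shift[of 1 f] by (simp add: H2_def)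
  qed
  show "disk_value (\<lambda>t. t * f t) z = disk_value (\<lambda>t. t) z * disk_value f z" if "f \<in> H2" "cmod z < 1" for f z
    using disk_value_shift[OF that] disk_value_power[of 1 z] by simp
qed (auto intro: circle_measurable_id)

lemma disk_value_id: "disk_value (\<lambda>t. t) z = z"
  using disk_value_power[of 1 z] by simp

lemma H2_multiplier_power: "H2_multiplier \<psi> \<Longrightarrow> H2_multiplier (\<lambda>t. \<psi> t ^ n)"
  by (induction n) (simp_all add: H2_multiplier_const H2_multiplier_mult)

lemma H2_multiplier_sum:
  "(\<And>i. i \<in> I \<Longrightarrow> H2_multiplier (\<psi> i)) \<Longrightarrow> H2_multiplier (\<lambda>t. \<Sum>i\<in>I. \<psi> i t)"
  by (induction I rule: infinite_finite_induct) (simp_all add: H2_multiplier_const H2_multiplier_add)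

text \<open>The quotient g of f by 1 - cnj a * t satisfies g - cnj a * t * g = f. For m < 0 the
  coefficient of f vanishes, so g_m = cnj a * g_(m-1); iterating towards minus infinity, with
  bounded coefficients and |a| < 1, forces g_m = 0. The value at z comes from the same
  identity.\<close>

lemma H2_multiplier_inverse:
  assumes a: "cmod a < 1"
  shows "H2_multiplier (\<lambda>t. 1 / (1 - cnj a * t))"
    and "cmod z < 1 \<Longrightarrow> disk_value (\<lambda>t. 1 / (1 - cnj a * t)) z = 1 / (1 - cnj a * z)"
proof -
  have ge: "1 - cmod a \<le> cmod (1 - cnj a * t)" if "cmod t \<le> 1" for t
  proof -
    have "cmod (cnj a * t) \<le> cmod a" using that by (simp add: norm_mult mult_left_le)
    then show ?thesis using norm_triangle_ineq2[of 1 "cnj a * t"] by simp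
  qed
  have nz: "1 - cnj a * t \<noteq> 0" if "cmod t \<le> 1" for t
    using ge[OF that] a by auto
  have cont: "continuous_on (sphere 0 1) (\<lambda>t. 1 / (1 - cnj a * t))"
    using nz by (intro continuous_intros) auto
  have bound: "cmod (1 / (1 - cnj a * t)) \<le> 1 / (1 - cmod a)" if "cmod t = 1" for t
    using ge[of t] that a by (simp add: norm_divide frac_le)
  have main: "(\<lambda>t. 1 / (1 - cnj a * t) * f t) \<in> H2 \<and>
      (\<forall>z. cmod z < 1 \<longrightarrow> disk_value (\<lambda>t. 1 / (1 - cnj a * t) * f t) z = 1 / (1 - cnj a * z) * disk_value f z)"
    if f: "f \<in> H2" for f
  proof -
    define g where "g = (\<lambda>t. 1 / (1 - cnj a * t) * f t)"
    have g: "g \<in> L2" unfolding g_def by (intro L2_bounded_mult[OF H2_L2[OF f] circle_continuous[OF cont] bound])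
    have tg: "(\<lambda>t. t powi 1 * g t) \<in> L2"
      by (intro L2_bounded_mult[where K = 1] g circle_continuous continuous_on_powi_circle) simp
    have pt: "g t - cnj a * (t * g t) = f t" if "cmod t = 1" for t
    proof -
      have "(1 - cnj a * t) * g t = f t" using nz[of t] that by (simp add: g_def)
      then show ?thesis by (simp add: algebra_simps)
    qed
    have fg: "fourier_coeff f m = fourier_coeff g m - cnj a * fourier_coeff g (m - 1)" for m
    proof -
      have "fourier_coeff f m = fourier_coeff (\<lambda>t. g t - cnj a * (t powi 1 * g t)) m"
        unfolding fourier_coeff_def L2_inner_def
        by (intro Bochner_Integration.integral_cong refl) (auto simp: pt)
      also have "\<dots> = fourier_coeff g m - cnj a * fourier_coeff g (m - 1)"
        by (subst fourier_coeff_diff[OF g L2.V_scale[OF tg]], subst fourier_coeff_scale[OF tg], subst fourier_coeff_shift) simp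
      finally show ?thesis .
    qed
    have "fourier_coeff g m = 0" if m: "m < 0" for m
    proof -
      have "fourier_coeff g m = cnj a ^ k * fourier_coeff g (m - int k)" for k
      proof (induction k)
        case (Suc k)
        have "fourier_coeff g (m - int k) = cnj a * fourier_coeff g (m - int (Suc k))"
          using fg[of "m - int k"] f m by (simp add: H2_def algebra_simps)
        then show ?case using Suc by simp
      qed simp
      then have "cmod (fourier_coeff g m) \<le> cmod a ^ k * norm2 g" for k
        using fourier_coeff_bound[OF g, of "m - int k"]
        by (metis complex_mod_cnj mult_left_mono norm_ge_zero norm_mult norm_power zero_le_power)
      moreover have "(\<lambda>k. cmod a ^ k * norm2 g) \<longlonglongrightarrow> 0 * norm2 g"
        using a by (intro tendsto_intros LIMSEQ_realpow_zero) auto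
      ultimately have "cmod (fourier_coeff g m) \<le> 0 * norm2 g"
        by (intro LIMSEQ_le_const[where X = "\<lambda>k. cmod a ^ k * norm2 g"]) auto
      then show ?thesis by simp
    qed
    then have gH: "g \<in> H2" using g by (simp add: H2_def)
    have "disk_value g z = 1 / (1 - cnj a * z) * disk_value f z" if z: "cmod z < 1" for z
    proof -
      have "fourier_coeff f m = fourier_coeff (\<lambda>t. g t - cnj a * (t * g t)) m" for m
        unfolding fourier_coeff_def L2_inner_def
        by (intro Bochner_Integration.integral_cong refl) (auto simp: pt)
      then have "disk_value f z = disk_value (\<lambda>t. g t - cnj a * (t * g t)) z"
        unfolding disk_value_def by simp
      also have "\<dots> = (1 - cnj a * z) * disk_value g z"
        by (subst disk_value_diff[OF g L2.V_scale[OF tg[simplified]] z], subst disk_value_scale[OF tg[simplified] z],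
            subst disk_value_shift[OF gH z]) (simp add: algebra_simps)
      finally show ?thesis using nz[of z] z by (simp add: field_simps)
    qed
    with gH show ?thesis unfolding g_def by blast
  qed
  have one: "disk_value (\<lambda>t. 1 / (1 - cnj a * t)) z = 1 / (1 - cnj a * z)" if "cmod z < 1" for z
    using main[OF H2_one] that by (simp add: disk_value_one)
  then show "cmod z < 1 \<Longrightarrow> disk_value (\<lambda>t. 1 / (1 - cnj a * t)) z = 1 / (1 - cnj a * z)" .
  show "H2_multiplier (\<lambda>t. 1 / (1 - cnj a * t))"
    by (rule H2_multiplierI[OF circle_continuous[OF cont] bound]) (use main one in auto)
qed

lemma norm2_cong_AE:
  assumes "f \<in> L2" "g \<in> L2" "AE t in \<T>. cmod (f t) = cmod (g t)"
  shows "norm2 f = norm2 g"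
  by (intro antisym norm2_mono) (use assms in \<open>auto elim: eventually_mono\<close>)

lemma norm2_bounded:
  assumes f: "f \<in> L2" and le: "\<And>t. cmod t = 1 \<Longrightarrow> cmod (f t) \<le> K"
  shows "norm2 f \<le> K"
proof -
  have "0 \<le> K" using order_trans[OF norm_ge_zero le[of 1]] by simp
  have one: "(\<lambda>t. of_real K) \<in> L2" by (simp add: L2_def)
  have "norm2 f \<le> norm2 (\<lambda>t. of_real K)"
    using le \<open>0 \<le> K\<close> by (intro norm2_mono f one AE_I2) auto
  also have "norm2 (\<lambda>t. of_real K) = K"
    using \<open>0 \<le> K\<close> by (simp add: form_norm_def L2_inner_def real_sqrt_mult)
  finally show ?thesis .
qed

text \<open>Moving f to the other side of the scalar product gives a bound uniform in m, although u
  * f need not be square integrable.\<close>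

lemma fourier_coeff_mult_bound:
  assumes u: "u \<in> L2" and f: "f \<in> L2"
  shows "cmod (fourier_coeff (\<lambda>t. u t * f t) m) \<le> norm2 u * norm2 f"
proof -
  define g where "g = (\<lambda>t. t powi m * cnj (f t))"
  have g: "g \<in> L2" unfolding g_def
    by (rule L2_bounded_mult[OF L2_cnj[OF f] circle_continuous[OF continuous_on_powi_circle], where K = 1]) (simp add: norm_power_int)
  have "fourier_coeff (\<lambda>t. u t * f t) m = L2_inner u g"
    unfolding fourier_coeff_def L2_inner_def g_def by (simp add: mult_ac)
  moreover have "norm2 g = norm2 f"
    by (intro norm2_cong_AE g f AE_I2) (simp add: g_def norm_mult norm_power_int)
  ultimately show ?thesis using L2.Cauchy_Schwarz[OF u g] by simp
qed

text \<open>With f unbounded and no common bound on the \<open>x j\<close>, the products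
  \<open>x j * f\<close> need not converge in L^2. Their Fourier coefficients converge uniformly in
  the frequency, which is enough for the vanishing of the negative ones and for the power series in
  the disk.\<close>

lemma H2_multiplier_limit:
  assumes x: "\<And>j. H2_multiplier (x j)" and \<psi>: "\<psi> \<in> borel_measurable \<T>" "\<And>t. cmod t = 1 \<Longrightarrow> cmod (\<psi> t) \<le> K"
    and lim: "(\<lambda>j. norm2 (\<lambda>t. x j t - \<psi> t)) \<longlonglongrightarrow> 0"
  shows "H2_multiplier \<psi>"
proof (rule H2_multiplierI[OF \<psi>])
  have \<psi>L: "\<psi> \<in> L2" by (rule L2_bounded[OF \<psi>])
  note xL = H2_L2[OF H2_multiplier_H2[OF x]]
  fix f assume f: "f \<in> H2"
  note fL = H2_L2[OF f]
  have \<psi>f: "(\<lambda>t. \<psi> t * f t) \<in> L2" by (rule L2_bounded_mult[OF fL \<psi>])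
  have xf: "(\<lambda>t. x j t * f t) \<in> H2" for j by (rule H2_multiplierD(2)[OF x f])
  have bound: "cmod (fourier_coeff (\<lambda>t. x j t * f t) m - fourier_coeff (\<lambda>t. \<psi> t * f t) m) \<le> norm2 (\<lambda>t. x j t - \<psi> t) * norm2 f" for j m
    using fourier_coeff_mult_bound[OF L2.V_diff[OF xL \<psi>L] fL, of j m] fourier_coeff_diff[OF H2_L2[OF xf] \<psi>f, of j m]
    by (simp add: left_diff_distrib)
  have to0: "(\<lambda>j. norm2 (\<lambda>t. x j t - \<psi> t) * norm2 f) \<longlonglongrightarrow> 0"
    by (rule tendsto_mult_left_zero[OF lim])
  have coeff: "(\<lambda>j. fourier_coeff (\<lambda>t. x j t * f t) m) \<longlonglongrightarrow> fourier_coeff (\<lambda>t. \<psi> t * f t) m" for m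
    by (rule LIM_zero_cancel, rule Lim_null_comparison[OF always_eventually to0]) (use bound in auto)
  have "fourier_coeff (\<lambda>t. \<psi> t * f t) m = 0" if "m < 0" for m
    using coeff[of m] xf that by (simp add: H2_def LIMSEQ_const_iff)
  then show \<psi>fH: "(\<lambda>t. \<psi> t * f t) \<in> H2" using \<psi>f by (simp add: H2_def)
  fix z :: complex assume z: "cmod z < 1"
  have "(\<lambda>j. disk_value (\<lambda>t. x j t * f t) z) \<longlonglongrightarrow> disk_value (\<lambda>t. \<psi> t * f t) z"
  proof (rule LIM_zero_cancel, rule Lim_null_comparison[OF always_eventually])
    show "(\<lambda>j. norm2 (\<lambda>t. x j t - \<psi> t) * norm2 f / (1 - cmod z)) \<longlonglongrightarrow> 0"
      by (rule tendsto_divide_zero[OF to0])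
    show "\<forall>j. norm (disk_value (\<lambda>t. x j t * f t) z - disk_value (\<lambda>t. \<psi> t * f t) z) \<le> norm2 (\<lambda>t. x j t - \<psi> t) * norm2 f / (1 - cmod z)"
    proof
      fix j
      let ?c = "\<lambda>m. fourier_coeff (\<lambda>t. x j t * f t) (int m) - fourier_coeff (\<lambda>t. \<psi> t * f t) (int m)"
      let ?N = "norm2 (\<lambda>t. x j t - \<psi> t) * norm2 f"
      have "disk_value (\<lambda>t. x j t * f t) z - disk_value (\<lambda>t. \<psi> t * f t) z = (\<Sum>m. ?c m * z ^ m)"
        unfolding disk_value_def
        by (subst suminf_diff[OF disk_value_summable[OF H2_L2[OF xf] z] disk_value_summable[OF \<psi>f z]]) (simp add: left_diff_distrib)
      also have "norm \<dots> \<le> (\<Sum>m. ?N * cmod z ^ m)"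
        using z bound by (intro norm_suminf_le summable_mult summable_geometric) (auto simp: norm_mult norm_power intro: mult_right_mono)
      also have "\<dots> = ?N / (1 - cmod z)"
        using z by (subst suminf_mult) (auto simp: suminf_geometric summable_geometric)
      finally show "norm (disk_value (\<lambda>t. x j t * f t) z - disk_value (\<lambda>t. \<psi> t * f t) z) \<le> ?N / (1 - cmod z)" .
    qed
  qed
  moreover have "(\<lambda>j. disk_value (\<lambda>t. x j t * f t) z) \<longlonglongrightarrow> disk_value \<psi> z * disk_value f z"
    unfolding H2_multiplierD(3)[OF x f z]
    by (intro tendsto_mult tendsto_const disk_value_tendsto xL \<psi>L lim z)
  ultimately show "disk_value (\<lambda>t. \<psi> t * f t) z = disk_value \<psi> z * disk_value f z"
    by (rule LIMSEQ_unique)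
qed

text \<open>Taylor polynomials of the exponential are multipliers, and since |q| <= K on the circle
  their error is at most the error of the series for exp K, uniformly in t.\<close>

lemma H2_multiplier_exp:
  assumes q: "H2_multiplier q"
  shows "H2_multiplier (\<lambda>t. exp (q t))" and "cmod z < 1 \<Longrightarrow> disk_value (\<lambda>t. exp (q t)) z = exp (disk_value q z)"
proof -
  obtain K where K: "K \<ge> 0" "\<And>t. cmod t = 1 \<Longrightarrow> cmod (q t) \<le> K" using H2_multiplier_bounded[OF q] by blast
  define x where "x n t = (\<Sum>k<n. (1 / fact k) * q t ^ k)" for n t
  have x: "H2_multiplier (x n)" for n
    unfolding x_def by (intro H2_multiplier_sum H2_multiplier_mult H2_multiplier_const H2_multiplier_power q)
  have meas: "(\<lambda>t. exp (q t)) \<in> borel_measurable \<T>"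
    using H2_multiplierD(1)[OF q] by measurable
  have bound: "cmod (exp (q t)) \<le> exp K" if "cmod t = 1" for t
    using norm_exp[of "q t"] K(2)[OF that] by (meson exp_le_cancel_iff order_trans)
  note L = H2_L2[OF H2_multiplier_H2[OF x]] L2_bounded[OF meas bound]
  have tail: "cmod (x n t - exp (q t)) \<le> exp K - (\<Sum>k<n. K ^ k / fact k)" if t: "cmod t = 1" for n t
  proof -
    have s1: "(\<lambda>k. q t ^ k /\<^sub>R fact k) sums exp (q t)" by (rule exp_converges)
    have s2: "(\<lambda>k. K ^ k /\<^sub>R fact k) sums exp K" by (rule exp_converges)
    have "exp (q t) - x n t = (\<Sum>k. q t ^ (k + n) /\<^sub>R fact (k + n))"
      using suminf_minus_initial_segment[OF sums_summable[OF s1], of n] sums_unique[OF s1]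
      by (simp add: x_def scaleR_conv_of_real divide_inverse mult.commute)
    also have "norm \<dots> \<le> (\<Sum>k. K ^ (k + n) /\<^sub>R fact (k + n))"
    proof (rule norm_suminf_le)
      show "norm (q t ^ (k + n) /\<^sub>R fact (k + n)) \<le> K ^ (k + n) /\<^sub>R fact (k + n)" for k
        using K(2)[OF t] by (simp add: norm_power mult_left_mono power_mono)
      show "summable (\<lambda>k. K ^ (k + n) /\<^sub>R fact (k + n))"
        using sums_summable[OF s2] by (subst summable_iff_shift)
    qed
    also have "\<dots> = exp K - (\<Sum>k<n. K ^ k / fact k)"
      using suminf_minus_initial_segment[OF sums_summable[OF s2], of n] sums_unique[OF s2]
      by (simp add: divide_inverse mult.commute)
    finally show ?thesis by (simp add: norm_minus_commute)
  qed
  have lim: "(\<lambda>n. norm2 (\<lambda>t. x n t - exp (q t))) \<longlonglongrightarrow> 0"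
  proof (rule tendsto_sandwich[OF always_eventually always_eventually tendsto_const])
    show "\<forall>n. 0 \<le> norm2 (\<lambda>t. x n t - exp (q t))" using L2.nf_nonneg[OF L2.V_diff[OF L]] by blast
    show "\<forall>n. norm2 (\<lambda>t. x n t - exp (q t)) \<le> exp K - (\<Sum>k<n. K ^ k / fact k)"
      using norm2_bounded[OF L2.V_diff[OF L] tail] by blast
    have "(\<lambda>k. K ^ k / fact k) sums exp K" using exp_converges[of K] by (simp add: divide_inverse mult.commute)
    then have "(\<lambda>n. exp K - (\<Sum>k<n. K ^ k / fact k)) \<longlonglongrightarrow> exp K - exp K"
      unfolding sums_def by (intro tendsto_intros)
    then show "(\<lambda>n. exp K - (\<Sum>k<n. K ^ k / fact k)) \<longlonglongrightarrow> 0" by simp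
  qed
  show "H2_multiplier (\<lambda>t. exp (q t))" by (rule H2_multiplier_limit[OF x meas bound lim])
  show "disk_value (\<lambda>t. exp (q t)) z = exp (disk_value q z)" if z: "cmod z < 1"
  proof -
    have pow: "disk_value (\<lambda>t. q t ^ k) z = disk_value q z ^ k" for k
      by (induction k) (simp_all add: disk_value_one disk_value_mult q H2_multiplier_power z)
    have "disk_value (x n) z = (\<Sum>k<n. disk_value q z ^ k /\<^sub>R fact k)" for n
    proof (induction n)
      case 0
      then show ?case using disk_value_const[OF z, of 0] by (simp add: x_def)
    next
      case (Suc n)
      have "x (Suc n) = (\<lambda>t. x n t + (1 / fact n) * q t ^ n)" by (simp add: x_def fun_eq_iff)
      moreover have "(\<lambda>t. q t ^ n) \<in> L2" by (intro H2_L2 H2_multiplier_H2 H2_multiplier_power q)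
      ultimately show ?case using Suc L(1)[of n]
        by (simp only: disk_value_add disk_value_scale L2.V_scale z pow) (simp add: scaleR_conv_of_real divide_inverse)
    qed
    then have "(\<lambda>n. disk_value (x n) z) \<longlonglongrightarrow> exp (disk_value q z)"
      using exp_converges[of "disk_value q z"] by (simp add: sums_def)
    with disk_value_tendsto[OF L lim z] show ?thesis by (rule LIMSEQ_unique)
  qed
qed

section \<open>Schur functions and their infinite products\<close>

text \<open>The unit ball of the bounded analytic functions. The bound is asked at every point of
  the circle, so that products can be estimated pointwise without exceptional sets.\<close>

definition Schur :: "(complex \<Rightarrow> complex) \<Rightarrow> bool" where
  "Schur \<psi> \<longleftrightarrow> H2_multiplier \<psi> \<and> (\<forall>t. cmod t = 1 \<longrightarrow> cmod (\<psi> t) \<le> 1)"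

lemma SchurD: "Schur \<psi> \<Longrightarrow> H2_multiplier \<psi>" "Schur \<psi> \<Longrightarrow> cmod t = 1 \<Longrightarrow> cmod (\<psi> t) \<le> 1"
  by (auto simp: Schur_def)

lemma Schur_L2: "Schur \<psi> \<Longrightarrow> \<psi> \<in> L2"
  by (intro H2_L2 H2_multiplier_H2 SchurD)

lemma Schur_prod:
  assumes g: "\<And>i. Schur (g i)" and I: "finite I"
  shows "Schur (\<lambda>t. \<Prod>i\<in>I. g i t)"
    and "cmod z < 1 \<Longrightarrow> disk_value (\<lambda>t. \<Prod>i\<in>I. g i t) z = (\<Prod>i\<in>I. disk_value (g i) z)"
proof -
  show S: "Schur (\<lambda>t. \<Prod>i\<in>I. g i t)" for I :: "'a set"
  proof -
    have "H2_multiplier (\<lambda>t. \<Prod>i\<in>I. g i t)"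
      by (induction I rule: infinite_finite_induct) (simp_all add: H2_multiplier_const H2_multiplier_mult SchurD g)
    moreover have "cmod (\<Prod>i\<in>I. g i t) \<le> 1" if "cmod t = 1" for t
      unfolding prod_norm[symmetric] by (intro prod_le_1) (auto simp: SchurD g that)
    ultimately show ?thesis by (simp add: Schur_def)
  qed
  show "disk_value (\<lambda>t. \<Prod>i\<in>I. g i t) z = (\<Prod>i\<in>I. disk_value (g i) z)" if z: "cmod z < 1"
    using I by (induction I) (simp_all add: disk_value_one disk_value_mult SchurD(1)[OF S] SchurD(1)[OF g] z)
qed

text \<open>For a Schur function \<open>Q\<close> one has \<open>\<parallel>Q - 1\<parallel>\<^sup>2 \<le> 2 - 2 Re Q(0)\<close>; this turns convergence of the
  products of the values at the origin into convergence in \<open>L\<^sup>2\<close>.\<close>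

lemma Schur_infinite_product:
  assumes g: "\<And>i. Schur (g i)" and c: "\<And>i. disk_value (g i) 0 = of_real (c i)" "\<And>i. 0 \<le> c i" "\<And>i. c i \<le> 1"
    and \<delta>: "0 < \<delta>" "\<And>k. \<delta> \<le> (\<Prod>i<k. c i)"
  obtains \<psi> where "Schur \<psi>" "AE t in \<T>. \<forall>k. cmod (\<psi> t) \<le> cmod (\<Prod>i<k. g i t)"
    "\<And>z. cmod z < 1 \<Longrightarrow> (\<lambda>k. \<Prod>i<k. disk_value (g i) z) \<longlonglongrightarrow> disk_value \<psi> z"
proof -
  define P where "P k t = (\<Prod>i<k. g i t)" for k t
  define C where "C k = (\<Prod>i<k. c i)" for k
  have P: "Schur (P k)" for k
    unfolding P_def by (rule Schur_prod(1)[OF g]) simp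
  have Pval: "disk_value (P k) z = (\<Prod>i<k. disk_value (g i) z)" if "cmod z < 1" for k z
    unfolding P_def using that by (intro Schur_prod(2)[OF g]) auto
  note PL = Schur_L2[OF P]
  have C: "\<delta> \<le> C k" "C k \<le> 1" for k
    unfolding C_def using \<delta> c by (auto intro: prod_le_1)
  have dec: "C m \<le> C l" if "l \<le> m" for l m
  proof -
    have "C m = C l * (\<Prod>i\<in>{l..<m}. c i)"
      unfolding C_def lessThan_atLeast0 using that by (subst prod.atLeastLessThan_concat) auto
    moreover have "(\<Prod>i\<in>{l..<m}. c i) \<le> 1" using c by (intro prod_le_1) auto
    ultimately show ?thesis using C(1)[of l] \<delta>(1) by (simp add: mult_left_le)
  qed
  \<comment> \<open>Write P m = P l * Q. Since |P l| <= 1, the difference is no larger than Q - 1,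
    where Q(0) = C m / C l; dividing by C l >= \<delta> gives the constant 2 / \<delta>.\<close>
  have diff: "(norm2 (\<lambda>t. P m t - P l t))\<^sup>2 \<le> 2 / \<delta> * (C l - C m)" if lm: "l \<le> m" for l m
  proof -
    define Q where "Q t = (\<Prod>i\<in>{l..<m}. g i t)" for t
    have Q: "Schur Q" "disk_value Q 0 = of_real (\<Prod>i\<in>{l..<m}. c i)"
      unfolding Q_def using Schur_prod[OF g, of "{l..<m}"] c by auto
    have QL: "Q \<in> L2" and oneL: "(\<lambda>t. 1) \<in> L2" by (auto intro: Schur_L2 Q H2_L2 H2_one)
    have PQ: "P m t = P l t * Q t" for t
      unfolding P_def Q_def lessThan_atLeast0 using lm by (subst prod.atLeastLessThan_concat) auto
    have "cmod (P m t - P l t) \<le> cmod (Q t - 1)" if "cmod t = 1" for t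
    proof -
      have "P m t - P l t = P l t * (Q t - 1)" by (simp add: PQ algebra_simps)
      then have "cmod (P m t - P l t) = cmod (P l t) * cmod (Q t - 1)" by (simp add: norm_mult)
      also have "\<dots> \<le> 1 * cmod (Q t - 1)" by (intro mult_right_mono SchurD(2)[OF P that]) simp
      finally show ?thesis by simp
    qed
    then have "norm2 (\<lambda>t. P m t - P l t) \<le> norm2 (\<lambda>t. Q t - 1)"
      by (intro norm2_mono L2.V_diff PL QL oneL AE_I2) auto
    then have "(norm2 (\<lambda>t. P m t - P l t))\<^sup>2 \<le> (norm2 (\<lambda>t. Q t - 1))\<^sup>2"
      by (intro power_mono L2.nf_nonneg L2.V_diff PL)
    also have "\<dots> = (norm2 Q)\<^sup>2 - 2 * Re (L2_inner Q (\<lambda>t. 1)) + (norm2 (\<lambda>t. 1))\<^sup>2"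
      using L2.nf_diff_scale[OF QL oneL, of 1] by simp
    also have "L2_inner Q (\<lambda>t. 1) = disk_value Q 0" by (simp add: disk_value_0 fourier_coeff_def)
    also have "(norm2 (\<lambda>t. 1))\<^sup>2 = 1" using norm2_powi[of 0] by simp
    also have "(norm2 Q)\<^sup>2 - 2 * Re (disk_value Q 0) + 1 \<le> 1 - 2 * (\<Prod>i\<in>{l..<m}. c i) + 1"
      using norm2_bounded[OF QL, of 1] SchurD(2)[OF Q(1)] L2.nf_nonneg[OF QL]
      unfolding Q(2) Re_complex_of_real by (simp add: power_le_one)
    also have "\<dots> = 2 * (1 - (\<Prod>i\<in>{l..<m}. c i))" by simp
    also have "\<dots> \<le> 2 * ((C l - C m) / \<delta>)"
    proof -
      have "C m = C l * (\<Prod>i\<in>{l..<m}. c i)"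
        unfolding C_def lessThan_atLeast0 using lm by (subst prod.atLeastLessThan_concat) auto
      then have "1 - (\<Prod>i\<in>{l..<m}. c i) = (C l - C m) / C l" using C(1)[of l] \<delta>(1) by (simp add: field_simps)
      also have "\<dots> \<le> (C l - C m) / \<delta>" using dec[OF lm] C(1)[of l] \<delta>(1) by (intro divide_left_mono) auto
      finally show ?thesis by (intro mult_left_mono) auto
    qed
    finally show ?thesis by simp
  qed
  have "P \<in> cauchy_seqs L2 L2_inner"
  proof -
    have "convergent C"
    proof (rule Bseq_monoseq_convergent)
      show "Bseq C" using C \<delta>(1) by (intro BseqI'[where K = 1]) (smt (verit) real_norm_def)
      show "monoseq C" using dec by (auto simp: monoseq_def)
    qed
    then have "Cauchy C" by (simp add: Cauchy_convergent_iff)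
    have "\<exists>N. \<forall>i\<ge>N. \<forall>j\<ge>N. norm2 (\<lambda>t. P i t - P j t) < e" if e: "e > 0" for e
    proof -
      have "e\<^sup>2 * \<delta> / 2 > 0" using e \<delta>(1) by simp
      then obtain N where N: "\<And>i j. i \<ge> N \<Longrightarrow> j \<ge> N \<Longrightarrow> dist (C i) (C j) < e\<^sup>2 * \<delta> / 2"
        using metric_CauchyD[OF \<open>Cauchy C\<close>] by blast
      have *: "norm2 (\<lambda>t. P i t - P j t) < e" if "i \<ge> N" "j \<ge> N" "j \<le> i" for i j
      proof (rule power2_less_imp_less)
        have "C j - C i < e\<^sup>2 * \<delta> / 2" using N[OF that(1,2)] unfolding dist_real_def by linarith
        then have "2 / \<delta> * (C j - C i) < e\<^sup>2" using \<delta>(1) by (simp add: field_simps)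
        then show "(norm2 (\<lambda>t. P i t - P j t))\<^sup>2 < e\<^sup>2" using diff[OF that(3)] by linarith
      qed (use e in simp)
      have "norm2 (\<lambda>t. P i t - P j t) < e" if "i \<ge> N" "j \<ge> N" for i j
        using *[of i j] *[of j i] that L2.nf_minus_commute[OF PL PL, of i j] by (cases "j \<le> i") auto
      then show ?thesis by blast
    qed
    then show ?thesis by (simp add: cauchy_seqs_def PL)
  qed
  then obtain \<phi> r where \<phi>: "\<phi> \<in> L2" "(\<lambda>j. norm2 (\<lambda>t. P j t - \<phi> t)) \<longlonglongrightarrow> 0" and r: "strict_mono r"
    and ae: "AE t in \<T>. (\<lambda>i. P (r i) t) \<longlonglongrightarrow> \<phi> t"
    by (rule L2_complete)
  \<comment> \<open>The moduli of the partial products decrease, so a limit along the subsequence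
    lies below every one of them.\<close>
  have le: "AE t in \<T>. \<forall>k. cmod (\<phi> t) \<le> cmod (P k t)"
    using ae AE_space
  proof eventually_elim
    case (elim t)
    then have t: "cmod t = 1" by simp
    have mono: "cmod (P m t) \<le> cmod (P l t)" if "l \<le> m" for l m
    proof -
      have "P m t = P l t * (\<Prod>i\<in>{l..<m}. g i t)"
        unfolding P_def lessThan_atLeast0 using that by (subst prod.atLeastLessThan_concat) auto
      moreover have "cmod (\<Prod>i\<in>{l..<m}. g i t) \<le> 1" by (intro SchurD(2)[OF Schur_prod(1)[OF g]] t) simp
      ultimately show ?thesis by (simp add: norm_mult mult_left_le)
    qed
    have "cmod (\<phi> t) \<le> cmod (P k t)" for k
    proof (rule LIMSEQ_le_const2[OF tendsto_norm[OF elim(1)]])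
      show "\<exists>N. \<forall>n\<ge>N. norm (P (r n) t) \<le> cmod (P k t)"
        using mono seq_suble[OF r] by (meson order_trans)
    qed
    then show ?case by blast
  qed
  \<comment> \<open>The L^2 limit is bounded by 1 only almost everywhere, while \<open>Schur\<close>
    asks for every point; the exceptional null set is overwritten by 0.\<close>
  define \<psi> where "\<psi> t = (if cmod (\<phi> t) \<le> 1 then \<phi> t else 0)" for t
  have m[measurable]: "\<phi> \<in> borel_measurable \<T>" using L2_measurable[OF \<phi>(1)] .
  have \<psi>m: "\<psi> \<in> borel_measurable \<T>" unfolding \<psi>_def by measurable
  have \<psi>1: "cmod (\<psi> t) \<le> 1" for t by (simp add: \<psi>_def)
  have \<psi>L: "\<psi> \<in> L2" by (rule L2_bounded[OF \<psi>m \<psi>1])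
  have eq: "AE t in \<T>. \<psi> t = \<phi> t"
    using le
  proof eventually_elim
    case (elim t)
    \<comment> \<open>The empty product at k = 0 supplies the bound 1.\<close>
    from elim[rule_format, of 0] show ?case by (simp add: \<psi>_def P_def)
  qed
  have "norm2 (\<lambda>t. P j t - \<phi> t) = norm2 (\<lambda>t. P j t - \<psi> t)" for j
    using eq by (intro norm2_cong_AE L2.V_diff PL \<phi> \<psi>L) (auto elim: eventually_mono)
  with \<phi>(2) have lim: "(\<lambda>j. norm2 (\<lambda>t. P j t - \<psi> t)) \<longlonglongrightarrow> 0" by simp
  have "Schur \<psi>"
    unfolding Schur_def using H2_multiplier_limit[OF SchurD(1)[OF P] \<psi>m \<psi>1 lim] \<psi>1 by blast
  moreover have "AE t in \<T>. \<forall>k. cmod (\<psi> t) \<le> cmod (\<Prod>i<k. g i t)"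
    using eq le by eventually_elim (simp add: P_def)
  moreover have "(\<lambda>k. \<Prod>i<k. disk_value (g i) z) \<longlonglongrightarrow> disk_value \<psi> z" if "cmod z < 1" for z
    using disk_value_tendsto[OF PL \<psi>L lim that] by (simp add: Pval that)
  ultimately show ?thesis using that by blast
qed

section \<open>Blaschke products\<close>

text \<open>A Blaschke factor, rotated so that its value at the origin is |a|, which is real and
  nonnegative as \<open>Schur_infinite_product\<close> demands. It is written with sums and products
  so that the closure rules for multipliers apply.\<close>

definition blaschke :: "complex \<Rightarrow> complex \<Rightarrow> complex" where
  "blaschke a t = (of_real (cmod a) / a) * ((a + (-1) * t) * (1 / (1 - cnj a * t)))"

lemma Schur_blaschke:
  assumes a: "cmod a < 1" "a \<noteq> 0"
  shows "Schur (blaschke a)" "disk_value (blaschke a) a = 0" "disk_value (blaschke a) 0 = of_real (cmod a)"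
proof -
  have m: "H2_multiplier (\<lambda>t. a + (-1) * t)"
    by (intro H2_multiplier_add H2_multiplier_mult H2_multiplier_const H2_multiplier_id)
  note m2 = H2_multiplier_mult[OF m H2_multiplier_inverse(1)[OF a(1)]]
  have mult: "H2_multiplier (blaschke a)"
    unfolding blaschke_def by (intro H2_multiplier_mult[OF H2_multiplier_const m2])
  have val: "disk_value (blaschke a) z = of_real (cmod a) / a * ((a - z) * (1 / (1 - cnj a * z)))" if z: "cmod z < 1" for z
  proof -
    have idL: "(\<lambda>t. t) \<in> L2" by (intro H2_L2 H2_multiplier_H2 H2_multiplier_id)
    have aL: "(\<lambda>t. a) \<in> L2" by (intro H2_L2 H2_multiplier_H2 H2_multiplier_const)
    have "disk_value (\<lambda>t. a + (-1) * t) z = a + (-1) * z"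
      by (subst disk_value_add[OF aL L2.V_scale[OF idL] z], subst disk_value_scale[OF idL z])
        (simp add: disk_value_const[OF z] disk_value_id)
    then show ?thesis
      unfolding blaschke_def
      by (subst disk_value_mult[OF H2_multiplier_const m2 z], subst disk_value_mult[OF m H2_multiplier_inverse(1)[OF a(1)] z])
        (simp add: disk_value_const[OF z] H2_multiplier_inverse(2)[OF a(1) z])
  qed
  have "cmod (blaschke a t) \<le> 1" if t: "cmod t = 1" for t
  proof -
    have tc: "t * cnj t = 1" using t complex_norm_square[of t] by simp
    have "1 - cnj a * t = t * cnj (t - a)" using tc by (simp add: algebra_simps)
    then have "cmod (1 - cnj a * t) = cmod (t - a)" by (simp only: norm_mult complex_mod_cnj t mult_1)
    then show ?thesis
      unfolding blaschke_def using a by (simp add: norm_mult norm_divide norm_minus_commute)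
  qed
  with mult show "Schur (blaschke a)" by (simp add: Schur_def)
  show "disk_value (blaschke a) a = 0" "disk_value (blaschke a) 0 = of_real (cmod a)"
    using val[OF a(1)] val[of 0] a by simp_all
qed

text \<open>The Weierstrass product inequality; the induction step is (1 - c j) (1 - P) >= 0, where
  P is the product of the other factors.\<close>

lemma one_minus_sum_le_prod:
  fixes c :: "'a \<Rightarrow> real"
  assumes "finite I" "\<And>i. i \<in> I \<Longrightarrow> 0 \<le> c i" "\<And>i. i \<in> I \<Longrightarrow> c i \<le> 1"
  shows "1 - (\<Sum>i\<in>I. 1 - c i) \<le> (\<Prod>i\<in>I. c i)"
  using assms
proof (induction I)
  case (insert j I)
  have p: "0 \<le> (\<Prod>i\<in>I. c i)" "(\<Prod>i\<in>I. c i) \<le> 1" using insert.prems by (auto intro: prod_nonneg prod_le_1)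
  have "0 \<le> (1 - c j) * (1 - (\<Prod>i\<in>I. c i))" using p insert.prems by simp
  then have "c j + (\<Prod>i\<in>I. c i) - 1 \<le> c j * (\<Prod>i\<in>I. c i)" by (simp add: algebra_simps)
  with insert show ?case by simp
qed simp

text \<open>The condition \<epsilon> < 1 keeps all partial products at the origin above 1 -
  \<epsilon> > 0. This lower bound gives both convergence and the size of the value there.\<close>

lemma blaschke_product_exists:
  assumes W: "countable W" "W \<subseteq> ball 0 1 - {0}" and "\<epsilon> < 1"
    and sum: "\<And>I. finite I \<Longrightarrow> I \<subseteq> W \<Longrightarrow> (\<Sum>\<zeta>\<in>I. 1 - cmod \<zeta>) \<le> \<epsilon>"
  obtains \<psi> where "Schur \<psi>" "\<And>\<zeta>. \<zeta> \<in> W \<Longrightarrow> disk_value \<psi> \<zeta> = 0" "1 - \<epsilon> \<le> Re (disk_value \<psi> 0)"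
proof -
  define I where "I = to_nat_on W ` W"
  define e where "e i = inv_into W (to_nat_on W) i" for i
  have inj: "inj_on (to_nat_on W) W" using W(1) by (rule inj_on_to_nat_on)
  have e: "e i \<in> W" if "i \<in> I" for i
    using that unfolding e_def I_def by (rule inv_into_into)
  define g where "g i = (if i \<in> I then blaschke (e i) else (\<lambda>t. 1))" for i
  define c where "c i = (if i \<in> I then cmod (e i) else 1)" for i
  have eW: "cmod (e i) < 1" "e i \<noteq> 0" if "i \<in> I" for i
    using e[OF that] W(2) by auto
  have one: "Schur (\<lambda>t. 1)" by (simp add: Schur_def H2_multiplier_const)
  have g: "Schur (g i)" "disk_value (g i) 0 = of_real (c i)" for i
    using Schur_blaschke[OF eW, of i] one by (auto simp: g_def c_def disk_value_one)
  have c: "0 \<le> c i" "c i \<le> 1" for i using eW[of i] by (auto simp: c_def)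
  have low: "1 - \<epsilon> \<le> (\<Prod>i<k. c i)" for k
  proof -
    have inje: "inj_on e I" unfolding e_def I_def by (rule inj_on_inv_into) simp
    have "(\<Sum>i<k. 1 - c i) = (\<Sum>i\<in>{..<k} \<inter> I. 1 - cmod (e i))"
      by (rule sum.mono_neutral_cong_right) (auto simp: c_def)
    also have "\<dots> = (\<Sum>\<zeta>\<in>e ` ({..<k} \<inter> I). 1 - cmod \<zeta>)"
      by (subst sum.reindex) (auto intro: inj_on_subset[OF inje])
    also have "\<dots> \<le> \<epsilon>" by (rule sum) (auto intro: e)
    finally show ?thesis using one_minus_sum_le_prod[of "{..<k}" c] c by simp
  qed
  obtain \<psi> where \<psi>: "Schur \<psi>" "\<And>z. cmod z < 1 \<Longrightarrow> (\<lambda>k. \<Prod>i<k. disk_value (g i) z) \<longlonglongrightarrow> disk_value \<psi> z"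
    by (rule Schur_infinite_product[OF g c _ low]) (use \<open>\<epsilon> < 1\<close> in auto)
  have "disk_value \<psi> \<zeta> = 0" if \<zeta>: "\<zeta> \<in> W" for \<zeta>
  proof -
    define j where "j = to_nat_on W \<zeta>"
    have j: "j \<in> I" "e j = \<zeta>" using \<zeta> inj by (auto simp: j_def I_def e_def)
    have z: "cmod \<zeta> < 1" using \<zeta> W(2) by auto
    have 0: "disk_value (g j) \<zeta> = 0"
      using Schur_blaschke(2)[OF eW[OF j(1)]] j by (simp add: g_def)
    have "\<forall>\<^sub>F k in sequentially. k \<ge> Suc j" by (rule eventually_ge_at_top)
    then have "\<forall>\<^sub>F k in sequentially. (\<Prod>i<k. disk_value (g i) \<zeta>) = 0"
    proof eventually_elim
      case (elim k)
      then have "j \<in> {..<k}" by simp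
      then show ?case using 0 by (intro prod_zero) auto
    qed
    from LIMSEQ_unique[OF \<psi>(2)[OF z] tendsto_eventually[OF this]] show ?thesis .
  qed
  moreover have "1 - \<epsilon> \<le> Re (disk_value \<psi> 0)"
  proof (rule LIMSEQ_le_const[OF tendsto_Re[OF \<psi>(2)]])
    have "Re (\<Prod>i<k. disk_value (g i) 0) = (\<Prod>i<k. c i)" for k
      by (simp add: g(2) flip: of_real_prod)
    then show "\<exists>N. \<forall>n\<ge>N. 1 - \<epsilon> \<le> Re (\<Prod>i<n. disk_value (g i) 0)" using low by simp
  qed simp
  ultimately show ?thesis by (rule that[OF \<psi>(1)])
qed

section \<open>Approximation by trigonometric polynomials\<close>

text \<open>The Borel measure is used so that sets can be built up from closed ones. Approximants
  are continuous on the whole plane, as the functions of \<open>infdist\<close> used for closed sets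
  are.\<close>

definition L1_approximable :: "(complex \<Rightarrow> real) \<Rightarrow> bool" where
  "L1_approximable f \<longleftrightarrow> integrable borel_circle f \<and>
     (\<forall>e>0. \<exists>g. continuous_on UNIV g \<and> (LINT x|borel_circle. \<bar>f x - g x\<bar>) < e)"

lemma integrable_borel_circle_continuous:
  fixes g :: "complex \<Rightarrow> real"
  assumes "continuous_on UNIV g"
  shows "integrable borel_circle g"
proof -
  have c: "continuous_on (sphere 0 1) g" using assms by (rule continuous_on_subset) simp
  show ?thesis
    using integrable_circle_continuous[OF c] borel_circle_continuous[OF c]
    unfolding circle_measure_eq by (simp add: integrable_completion)
qed

lemma L1_approximable_continuous: "continuous_on UNIV g \<Longrightarrow> L1_approximable g"
  unfolding L1_approximable_def by (auto intro!: integrable_borel_circle_continuous exI[of _ g])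

lemma L1_approximable_add:
  assumes "L1_approximable f" "L1_approximable g"
  shows "L1_approximable (\<lambda>x. f x + g x)"
  unfolding L1_approximable_def
proof (intro conjI allI impI)
  have int: "integrable borel_circle f" "integrable borel_circle g"
    using assms by (auto simp: L1_approximable_def)
  then show "integrable borel_circle (\<lambda>x. f x + g x)" by simp
  fix e :: real assume "e > 0"
  then have e2: "e / 2 > 0" by simp
  obtain u where u: "continuous_on UNIV u" "(LINT x|borel_circle. \<bar>f x - u x\<bar>) < e / 2"
    using assms(1) e2 unfolding L1_approximable_def by blast
  obtain v where v: "continuous_on UNIV v" "(LINT x|borel_circle. \<bar>g x - v x\<bar>) < e / 2"
    using assms(2) e2 unfolding L1_approximable_def by blast
  have i: "integrable borel_circle (\<lambda>x. \<bar>f x - u x\<bar>)" "integrable borel_circle (\<lambda>x. \<bar>g x - v x\<bar>)"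
    using int integrable_borel_circle_continuous u v by auto
  have "(LINT x|borel_circle. \<bar>f x + g x - (u x + v x)\<bar>) \<le> (LINT x|borel_circle. \<bar>f x - u x\<bar> + \<bar>g x - v x\<bar>)"
    using int integrable_borel_circle_continuous[OF u(1)] integrable_borel_circle_continuous[OF v(1)]
    by (intro integral_mono) auto
  also have "\<dots> < e" using u v i by simp
  finally show "\<exists>h. continuous_on UNIV h \<and> (LINT x|borel_circle. \<bar>f x + g x - h x\<bar>) < e"
    using u v by (intro exI[of _ "\<lambda>x. u x + v x"]) (auto intro: continuous_intros)
qed

lemma L1_approximable_scale:
  assumes "L1_approximable f"
  shows "L1_approximable (\<lambda>x. f x * c)"
  unfolding L1_approximable_def
proof (intro conjI allI impI)
  have int: "integrable borel_circle f" using assms by (auto simp: L1_approximable_def)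
  then show "integrable borel_circle (\<lambda>x. f x * c)" by simp
  fix e :: real assume e: "e > 0"
  have "e / (\<bar>c\<bar> + 1) > 0" using e by (simp add: add_nonneg_pos)
  then obtain u where u: "continuous_on UNIV u" "(LINT x|borel_circle. \<bar>f x - u x\<bar>) < e / (\<bar>c\<bar> + 1)"
    using assms unfolding L1_approximable_def by blast
  have "(LINT x|borel_circle. \<bar>f x * c - u x * c\<bar>) = (LINT x|borel_circle. \<bar>f x - u x\<bar>) * \<bar>c\<bar>"
    by (simp add: abs_mult left_diff_distrib[symmetric])
  also have "\<dots> \<le> (LINT x|borel_circle. \<bar>f x - u x\<bar>) * (\<bar>c\<bar> + 1)"
    by (intro mult_left_mono) auto
  also have "\<dots> < e" using u(2) by (simp add: pos_less_divide_eq add_nonneg_pos)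
  finally show "\<exists>h. continuous_on UNIV h \<and> (LINT x|borel_circle. \<bar>f x * c - h x\<bar>) < e"
    using u by (intro exI[of _ "\<lambda>x. u x * c"]) (auto intro: continuous_intros)
qed

text \<open>Dominated convergence gives L^1 convergence of \<open>s i\<close> to f, so half of the
  error is spent there and half on approximating one \<open>s i\<close>. The lemma serves closed
  sets, countable unions and limits of simple functions.\<close>

lemma L1_approximable_dominated:
  assumes s: "\<And>i. L1_approximable (s i)" and f: "f \<in> borel_measurable borel_circle"
    and lim: "\<And>x. x \<in> sphere 0 1 \<Longrightarrow> (\<lambda>i. s i x) \<longlonglongrightarrow> f x"
    and w: "integrable borel_circle w" "\<And>i x. x \<in> sphere 0 1 \<Longrightarrow> \<bar>s i x\<bar> \<le> w x"
  shows "L1_approximable f"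
  unfolding L1_approximable_def
proof (intro conjI allI impI)
  have si: "integrable borel_circle (s i)" for i using s by (auto simp: L1_approximable_def)
  have fw: "\<bar>f x\<bar> \<le> w x" if "x \<in> sphere 0 1" for x
    using tendsto_rabs[OF lim[OF that]] w(2)[OF that] by (intro LIMSEQ_le_const2) auto
  show int: "integrable borel_circle f"
    by (rule Bochner_Integration.integrable_bound[OF w(1) f]) (use fw in \<open>auto intro!: AE_I2\<close>, force)
  fix e :: real assume e: "e > 0"
  have "(\<lambda>i. LINT x|borel_circle. \<bar>f x - s i x\<bar>) \<longlonglongrightarrow> (LINT x|borel_circle. 0)"
  proof (rule integral_dominated_convergence[where w = "\<lambda>x. 2 * w x"])
    show "AE x in borel_circle. (\<lambda>i. \<bar>f x - s i x\<bar>) \<longlonglongrightarrow> 0"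
    proof (rule AE_I2)
      fix x assume "x \<in> space borel_circle"
      then have "(\<lambda>i. \<bar>f x - s i x\<bar>) \<longlonglongrightarrow> \<bar>f x - f x\<bar>" using lim by (intro tendsto_intros) auto
      then show "(\<lambda>i. \<bar>f x - s i x\<bar>) \<longlonglongrightarrow> 0" by simp
    qed
    show "AE x in borel_circle. norm \<bar>f x - s i x\<bar> \<le> 2 * w x" for i
    proof (rule AE_I2)
      fix x assume "x \<in> space borel_circle"
      then have "\<bar>f x\<bar> \<le> w x" "\<bar>s i x\<bar> \<le> w x" using fw w(2) by auto
      then show "norm \<bar>f x - s i x\<bar> \<le> 2 * w x" by simp
    qed
  qed (use f si borel_measurable_integrable w(1) in auto)
  then have "\<forall>\<^sub>F i in sequentially. (LINT x|borel_circle. \<bar>f x - s i x\<bar>) < e / 2"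
    using e by (intro order_tendstoD) auto
  then obtain i where i: "(LINT x|borel_circle. \<bar>f x - s i x\<bar>) < e / 2"
    by (auto simp: eventually_sequentially)
  obtain g where g: "continuous_on UNIV g" "(LINT x|borel_circle. \<bar>s i x - g x\<bar>) < e / 2"
    using s[of i] e half_gt_zero unfolding L1_approximable_def by blast
  note gi = integrable_borel_circle_continuous[OF g(1)]
  have "(LINT x|borel_circle. \<bar>f x - g x\<bar>) \<le> (LINT x|borel_circle. \<bar>f x - s i x\<bar> + \<bar>s i x - g x\<bar>)"
    using int si gi by (intro integral_mono) auto
  also have "\<dots> = (LINT x|borel_circle. \<bar>f x - s i x\<bar>) + (LINT x|borel_circle. \<bar>s i x - g x\<bar>)"
    using int si gi by (intro Bochner_Integration.integral_add) auto
  also have "\<dots> < e" using i g(2) by simp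
  finally show "\<exists>g. continuous_on UNIV g \<and> (LINT x|borel_circle. \<bar>f x - g x\<bar>) < e"
    using g(1) by blast
qed

lemma borel_measurable_borel_circle: "f \<in> borel_measurable borel \<Longrightarrow> f \<in> borel_measurable borel_circle"
  by (subst measurable_cong_sets[OF sets_borel_circle refl]) (rule measurable_restrict_space1)

text \<open>Induction from the closed sets, which are stable under intersection and generate the
  Borel sets. The indicator of a closed set is a pointwise limit of the continuous bumps
  \<open>s n\<close>, which are 1 on the set and 0 at distance at least 1 / n from it.\<close>

lemma L1_approximable_indicator:
  assumes "A \<in> sets (borel :: complex measure)"
  shows "L1_approximable (indicator A)"
proof -
  have "Int_stable (Collect closed :: complex set set)"
    by (auto simp: Int_stable_def)
  moreover have "Collect closed \<subseteq> Pow (UNIV :: complex set)" by simp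
  moreover have "A \<in> sigma_sets UNIV (Collect closed)"
    using assms by (simp add: borel_eq_closed)
  ultimately show ?thesis
  proof (induction rule: sigma_sets_induct_disjoint)
    case (basic A)
    then have A: "closed A" by simp
    show ?case
    \<comment> \<open>By convention \<open>infdist\<close> to the empty set is 0, so the bumps would
      be 1 there instead of 0.\<close>
    proof (cases "A = {}")
      case True
      then show ?thesis using L1_approximable_continuous[of "\<lambda>x. 0"] by simp
    next
      case False
      define s where "s n x = max 0 (1 - real n * infdist x A)" for n x
      show ?thesis
      proof (rule L1_approximable_dominated[where s = s and w = "\<lambda>x. 1"])
        show "L1_approximable (s i)" for i
          unfolding s_def by (intro L1_approximable_continuous continuous_intros)
        show "indicator A \<in> borel_measurable borel_circle"
          using A by (intro borel_measurable_borel_circle) auto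
        show "(\<lambda>i. s i x) \<longlonglongrightarrow> indicator A x" for x
        proof (cases "x \<in> A")
          case True
          then show ?thesis by (simp add: s_def)
        next
          case x: False
          then have pos: "infdist x A > 0"
            using in_closed_iff_infdist_zero[OF A False, of x] infdist_nonneg[of x A] by linarith
          obtain N where N: "real N * infdist x A > 1" using ex_less_of_nat_mult[OF pos, of 1] by auto
          have "\<forall>\<^sub>F i in sequentially. i \<ge> N" by (rule eventually_ge_at_top)
          then have "\<forall>\<^sub>F i in sequentially. s i x = 0"
          proof eventually_elim
            case (elim i)
            then have "real N * infdist x A \<le> real i * infdist x A" using pos by (intro mult_right_mono) auto
            then show ?case using N by (simp add: s_def)
          qed
          then show ?thesis using x by (simp add: tendsto_eventually)
        qed
        show "\<bar>s i x\<bar> \<le> 1" for i x using infdist_nonneg[of x A] by (simp add: s_def)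
      qed simp
    qed
  next
    case empty
    then show ?case using L1_approximable_continuous[of "\<lambda>x. 0"] by simp
  next
    case (compl A)
    have eq: "(indicator (UNIV - A) :: complex \<Rightarrow> real) = (\<lambda>x. 1 + indicator A x * (-1))"
      by (auto simp: indicator_def)
    show ?case
      unfolding eq by (intro L1_approximable_add L1_approximable_scale compl L1_approximable_continuous continuous_intros)
  next
    case (union A)
    have meas: "A i \<in> sets borel" for i using union(2) by (auto simp: borel_eq_closed)
    have eq: "(\<lambda>x. \<Sum>i<n. indicator (A i) x :: real) = indicator (\<Union>i<n. A i)" for n
      by (intro ext indicator_UN_disjoint[symmetric]) (use union(1) in \<open>auto simp: disjoint_family_on_def\<close>)
    show ?case
    proof (rule L1_approximable_dominated[where s = "\<lambda>n. indicator (\<Union>i<n. A i)" and w = "\<lambda>x. 1"])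
      show "L1_approximable (indicator (\<Union>i<n. A i))" for n
        unfolding eq[symmetric]
        by (induction n) (auto intro: L1_approximable_continuous L1_approximable_add union)
      show "indicator (\<Union>i. A i) \<in> borel_measurable borel_circle"
        using meas by (intro borel_measurable_borel_circle) auto
      show "(\<lambda>n. indicator (\<Union>i<n. A i) x) \<longlonglongrightarrow> (indicator (\<Union>i. A i) x :: real)" for x
        by (rule LIMSEQ_indicator_UN)
    qed (auto simp: indicator_def)
  qed
qed

lemma L1_approximable_integrable:
  assumes "integrable borel_circle f"
  shows "L1_approximable f"
  using assms
proof (induction rule: integrable_induct)
  case (base A c)
  have "A \<in> sets borel" using base(1) by (auto simp: sets_borel_circle sets_restrict_space_iff)
  then show ?case using L1_approximable_scale[OF L1_approximable_indicator] by simp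
next
  case (add f g)
  then show ?case by (intro L1_approximable_add)
next
  case (lim f s)
  show ?case
    \<comment> \<open>The factor 2 is the bound that \<open>integrable_induct\<close> provides for
      its approximating sequence.\<close>
    by (rule L1_approximable_dominated[where s = s and w = "\<lambda>x. 2 * \<bar>f x\<bar>"]) (use lim in auto)
qed

text \<open>The chain is: a Borel version of f, a continuous L^1 approximation, its positive part, a
  polynomial uniformly close by Stone-Weierstrass, and an upward shift that restores
  nonnegativity.\<close>

lemma nonneg_polynomial_approx:
  assumes f: "integrable \<T> f" "AE t in \<T>. 0 \<le> f t" and e: "0 < e"
  obtains p where "real_polynomial_function p" "\<And>t. cmod t = 1 \<Longrightarrow> 0 \<le> p t" "(LINT t|\<T>. \<bar>f t - p t\<bar>) < e"
proof -
  obtain g where g: "g \<in> borel_measurable borel_circle" "AE t in borel_circle. f t = g t"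
    using completion_ex_borel_measurable_real[of f borel_circle] f(1) unfolding circle_measure_eq by blast
  have fg: "AE t in \<T>. f t = g t" unfolding circle_measure_eq by (rule AE_completion[OF g(2)])
  have gT: "g \<in> borel_measurable \<T>" unfolding circle_measure_eq by (rule measurable_completion[OF g(1)])
  have "integrable \<T> g" using f(1) fg gT by (subst integrable_cong_AE[where g = f]) auto
  then have "integrable borel_circle g"
    unfolding circle_measure_eq using g(1) by (simp add: integrable_completion)
  then obtain u where u: "continuous_on UNIV u" "(LINT x|borel_circle. \<bar>g x - u x\<bar>) < e / 2"
    using L1_approximable_integrable e half_gt_zero unfolding L1_approximable_def by blast
  have uc: "continuous_on (sphere 0 1) u" using u(1) by (rule continuous_on_subset) simp
  have ui: "integrable \<T> u" by (rule integrable_circle_continuous[OF uc])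
  have "(LINT t|\<T>. \<bar>f t - u t\<bar>) = (LINT t|\<T>. \<bar>g t - u t\<bar>)"
    using fg f(1) gT ui borel_measurable_integrable by (intro integral_cong_AE) auto
  also have "\<dots> = (LINT x|borel_circle. \<bar>g x - u x\<bar>)"
    unfolding circle_measure_eq using g(1) borel_circle_continuous[OF uc] by (intro integral_completion) auto
  finally have fu: "(LINT t|\<T>. \<bar>f t - u t\<bar>) < e / 2" using u(2) by simp
  \<comment> \<open>Taking the positive part does not increase the distance to f, because f is
    nonnegative almost everywhere.\<close>
  define v where "v t = max 0 (u t)" for t
  have vc: "continuous_on (sphere 0 1) v" unfolding v_def by (intro continuous_intros uc)
  obtain q where q: "real_polynomial_function q" "\<And>t. t \<in> sphere 0 1 \<Longrightarrow> \<bar>v t - q t\<bar> < e / 4"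
    using Stone_Weierstrass_real_polynomial_function[of "sphere 0 1" v "e / 4"] vc e by auto
  \<comment> \<open>The shift equals the uniform error of q, so p cannot be negative on the circle,
    and p stays within e / 2 of v.\<close>
  define p where "p t = q t + e / 4" for t
  have p: "real_polynomial_function p" unfolding p_def by (rule real_polynomial_function.intros(3)[OF q(1) real_polynomial_function.intros(2)])
  have vp: "\<bar>v t - p t\<bar> \<le> e / 2" "0 \<le> p t" if "cmod t = 1" for t
  proof -
    have "\<bar>v t - q t\<bar> < e / 4" "0 \<le> v t" using q(2)[of t] that by (auto simp: v_def)
    then show "\<bar>v t - p t\<bar> \<le> e / 2" "0 \<le> p t" unfolding p_def by linarith+
  qed
  have pc: "continuous_on (sphere 0 1) p"
    using p by (intro continuous_at_imp_continuous_on ballI continuous_real_polymonial_function)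
  note pi = integrable_circle_continuous[OF pc]
  have "(LINT t|\<T>. \<bar>f t - p t\<bar>) \<le> (LINT t|\<T>. \<bar>f t - u t\<bar> + e / 2)"
  proof (rule integral_mono_AE)
    show "AE t in \<T>. \<bar>f t - p t\<bar> \<le> \<bar>f t - u t\<bar> + e / 2"
      using f(2) AE_space
    proof eventually_elim
      case (elim t)
      then have "\<bar>f t - v t\<bar> \<le> \<bar>f t - u t\<bar>" by (simp add: v_def)
      moreover have "\<bar>v t - p t\<bar> \<le> e / 2" using vp(1)[of t] elim(2) by simp
      ultimately show ?case by linarith
    qed
  qed (use f(1) ui pi in auto)
  also have "\<dots> = (LINT t|\<T>. \<bar>f t - u t\<bar>) + e / 2"
    using f(1) ui by simp
  also have "\<dots> < e" using fu by simp
  finally show ?thesis using that[OF p] vp(2) by blast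
qed

section \<open>Analytic minorants\<close>

inductive trig_poly :: "(complex \<Rightarrow> complex) \<Rightarrow> bool" where
  monom: "trig_poly (\<lambda>t. a * t powi m)"
| add: "trig_poly f \<Longrightarrow> trig_poly g \<Longrightarrow> trig_poly (\<lambda>t. f t + g t)"

text \<open>Equality is asserted on the circle because the exponent law for \<open>powi\<close>
  fails at t = 0 when positive and negative exponents meet.\<close>

lemma trig_poly_mult:
  assumes "trig_poly f" "trig_poly g"
  shows "\<exists>h. trig_poly h \<and> (\<forall>t. cmod t = 1 \<longrightarrow> h t = f t * g t)"
  using assms(1)
proof induction
  case (monom a m)
  show ?case
    using assms(2)
  proof induction
    case (monom b n)
    have "(a * b) * t powi (m + n) = (a * t powi m) * (b * t powi n)" if "cmod t = 1" for t
      using that by (subst power_int_add) auto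
    then show ?case using trig_poly.monom[of "a * b" "m + n"] by blast
  next
    case (add g1 g2)
    then obtain h1 h2 where "trig_poly h1" "\<forall>t. cmod t = 1 \<longrightarrow> h1 t = (a * t powi m) * g1 t"
      "trig_poly h2" "\<forall>t. cmod t = 1 \<longrightarrow> h2 t = (a * t powi m) * g2 t" by blast
    then show ?case by (intro exI[of _ "\<lambda>t. h1 t + h2 t"]) (auto intro: trig_poly.add simp: algebra_simps)
  qed
next
  case (add f1 f2)
  then obtain h1 h2 where "trig_poly h1" "\<forall>t. cmod t = 1 \<longrightarrow> h1 t = f1 t * g t"
    "trig_poly h2" "\<forall>t. cmod t = 1 \<longrightarrow> h2 t = f2 t * g t" by blast
  then show ?case by (intro exI[of _ "\<lambda>t. h1 t + h2 t"]) (auto intro: trig_poly.add simp: algebra_simps)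
qed

lemma trig_poly_of_real_polynomial:
  fixes p :: "complex \<Rightarrow> real"
  assumes "real_polynomial_function p"
  shows "\<exists>h. trig_poly h \<and> (\<forall>t. cmod t = 1 \<longrightarrow> h t = of_real (p t))"
  using assms
proof induction
  case (linear f)
  interpret bounded_linear f by fact
  \<comment> \<open>A real linear f is f(1) Re t + f(\<i>) Im t; A and B arise from writing Re t and
    Im t through t and 1 / t on the circle.\<close>
  define A where "A = (of_real (f 1) - \<i> * of_real (f \<i>)) / 2"
  define B where "B = (of_real (f 1) + \<i> * of_real (f \<i>)) / 2"
  have "A * t powi 1 + B * t powi (-1) = of_real (f t)" if t: "cmod t = 1" for t
  proof -
    have "t = Re t *\<^sub>R 1 + Im t *\<^sub>R \<i>" by (simp add: complex_eq_iff)
    then have "f t = f (Re t *\<^sub>R 1 + Im t *\<^sub>R \<i>)" by simp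
    then have ft: "f t = Re t * f 1 + Im t * f \<i>" by (simp only: add scaleR real_scaleR_def)
    have "inverse t = cnj t"
      using t complex_norm_square[of t] by (intro inverse_unique) simp
    then have inv: "t powi (-1) = cnj t" by (simp add: power_int_minus)
    show ?thesis unfolding ft A_def B_def inv by (simp add: complex_eq_iff field_simps)
  qed
  then show ?case by (intro exI[of _ "\<lambda>t. A * t powi 1 + B * t powi (-1)"] conjI trig_poly.intros) auto
next
  case (const c)
  show ?case using trig_poly.monom[of "of_real c" 0] by (auto intro!: exI[of _ "\<lambda>t. of_real c * t powi 0"])
next
  case (add f g)
  then obtain h1 h2 where "trig_poly h1" "\<forall>t. cmod t = 1 \<longrightarrow> h1 t = of_real (f t)"
    "trig_poly h2" "\<forall>t. cmod t = 1 \<longrightarrow> h2 t = of_real (g t)" by blast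
  then show ?case by (intro exI[of _ "\<lambda>t. h1 t + h2 t"]) (auto intro: trig_poly.add)
next
  case (mult f g)
  then obtain h1 h2 where h: "trig_poly h1" "\<forall>t. cmod t = 1 \<longrightarrow> h1 t = of_real (f t)"
    "trig_poly h2" "\<forall>t. cmod t = 1 \<longrightarrow> h2 t = of_real (g t)" by blast
  then show ?case using trig_poly_mult[OF h(1,3)] by auto
qed

text \<open>On the circle a monomial of negative exponent is the conjugate of one of positive
  exponent, so exchanging it for its conjugate leaves the real part alone.\<close>

lemma trig_poly_Re_analytic:
  assumes "trig_poly h"
  shows "\<exists>q. H2_multiplier q \<and> (\<forall>t. cmod t = 1 \<longrightarrow> Re (q t) = Re (h t))"
  using assms
proof induction
  case (monom a m)
  show ?case
  proof (cases "0 \<le> m")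
    case True
    then obtain k where "m = int k" using nonneg_int_cases by blast
    then show ?thesis
      by (intro exI[of _ "\<lambda>t. a * t ^ k"] conjI H2_multiplier_mult H2_multiplier_const H2_multiplier_power H2_multiplier_id) auto
  next
    case False
    then obtain k where m: "m = - int k" by (metis int_cases4 linorder_le_cases of_nat_0_le_iff)
    have "Re (cnj a * t ^ k) = Re (a * t powi m)" if t: "cmod t = 1" for t
    proof -
      have "inverse t = cnj t"
        using t complex_norm_square[of t] by (intro inverse_unique) simp
      then have "a * t powi m = cnj (cnj a * t ^ k)" by (simp add: m power_int_minus flip: power_inverse)
      then show ?thesis by (simp only: cnj.simps(1))
    qed
    then show ?thesis
      by (intro exI[of _ "\<lambda>t. cnj a * t ^ k"] conjI H2_multiplier_mult H2_multiplier_const H2_multiplier_power H2_multiplier_id) auto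
  qed
next
  case (add f g)
  then obtain q1 q2 where "H2_multiplier q1" "\<forall>t. cmod t = 1 \<longrightarrow> Re (q1 t) = Re (f t)"
    "H2_multiplier q2" "\<forall>t. cmod t = 1 \<longrightarrow> Re (q2 t) = Re (g t)" by blast
  then show ?case by (intro exI[of _ "\<lambda>t. q1 t + q2 t"]) (auto intro: H2_multiplier_add)
qed

lemma disk_value_0_integral: "disk_value f 0 = (LINT t|\<T>. f t)"
  by (simp add: disk_value_0 fourier_coeff_def L2_inner_def)

text \<open>g is the outer function of modulus exp (- p). For a polynomial p the analytic q with
  real part p is again a polynomial, hence bounded, and exp of a multiplier is available. The value
  at the origin is the exponential of a mean value.\<close>

lemma outer_of_polynomial:
  assumes p: "real_polynomial_function p" "\<And>t. cmod t = 1 \<Longrightarrow> 0 \<le> p t"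
  obtains g where "Schur g" "\<And>t. cmod t = 1 \<Longrightarrow> cmod (g t) = exp (- p t)"
    "disk_value g 0 = of_real (exp (- (LINT t|\<T>. p t)))"
proof -
  obtain q where q: "H2_multiplier q" "\<And>t. cmod t = 1 \<Longrightarrow> Re (q t) = p t"
    using trig_poly_of_real_polynomial[OF p(1)] trig_poly_Re_analytic by (metis Re_complex_of_real)
  \<comment> \<open>Adding \<i> y to -q cancels the phase at the origin, so that the value there is
    real and positive.\<close>
  define y where "y = Im (disk_value q 0)"
  define u where "u t = (-1) * q t + \<i> * of_real y" for t
  have u: "H2_multiplier u"
    unfolding u_def by (intro H2_multiplier_add H2_multiplier_mult H2_multiplier_const q)
  have qi: "integrable \<T> q"
    using H2_multiplier_bounded[OF q(1)] integrable_circle_bounded[OF H2_multiplierD(1)[OF q(1)]] by metis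
  have "Re (disk_value q 0) = (LINT t|\<T>. Re (q t))"
    unfolding disk_value_0_integral using qi by simp
  also have "\<dots> = (LINT t|\<T>. p t)" by (intro Bochner_Integration.integral_cong refl) (auto simp: q)
  finally have "disk_value u 0 = of_real (- (LINT t|\<T>. p t))"
    unfolding disk_value_0_integral u_def using qi
    by (simp add: y_def disk_value_0_integral complex_eq_iff)
  then have val: "disk_value (\<lambda>t. exp (u t)) 0 = of_real (exp (- (LINT t|\<T>. p t)))"
    using H2_multiplier_exp(2)[OF u, of 0] by (simp add: exp_of_real flip: of_real_minus)
  have norm: "cmod (exp (u t)) = exp (- p t)" if "cmod t = 1" for t
    using q(2)[OF that] by (simp add: u_def)
  have "Schur (\<lambda>t. exp (u t))"
    unfolding Schur_def using H2_multiplier_exp(1)[OF u] norm p(2) by (simp add: norm)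
  from that[OF this norm val] show ?thesis .
qed

text \<open>The outer function of a decomposition \<open>L \<le> \<Sum>i. c i\<close> almost everywhere into nonnegative
  trigonometric polynomials \<open>c i\<close>, where \<open>c i\<close> approximates the remainder \<open>r i\<close> in \<open>L\<^sup>1\<close> and
  \<open>r (i + 1) = \<bar>r i - c i\<bar>\<close>.\<close>

lemma analytic_minorant:
  assumes L: "integrable \<T> L" "AE t in \<T>. 0 \<le> L t" and \<epsilon>: "0 < \<epsilon>"
  obtains \<psi> where "Schur \<psi>" "AE t in \<T>. cmod (\<psi> t) \<le> exp (- L t)"
    "exp (- ((LINT t|\<T>. L t) + \<epsilon>)) \<le> Re (disk_value \<psi> 0)"
proof -
  have "\<forall>f e. integrable \<T> f \<and> (AE t in \<T>. 0 \<le> f t) \<and> 0 < e \<longrightarrow>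
      (\<exists>p. real_polynomial_function p \<and> (\<forall>t. cmod t = 1 \<longrightarrow> 0 \<le> p t) \<and> (LINT t|\<T>. \<bar>f t - p t\<bar>) < e)"
    using nonneg_polynomial_approx by metis
  \<comment> \<open>A choice function for the approximating polynomials, so that the remainders can
    be defined by recursion.\<close>
  then obtain F where F: "\<And>f e. integrable \<T> f \<Longrightarrow> (AE t in \<T>. 0 \<le> f t) \<Longrightarrow> 0 < (e::real) \<Longrightarrow>
      real_polynomial_function (F f e) \<and> (\<forall>t. cmod t = 1 \<longrightarrow> 0 \<le> F f e t) \<and> (LINT t|\<T>. \<bar>f t - F f e t\<bar>) < e"
    by metis
  \<comment> \<open>The sum of all \<eta> i is \<epsilon> / 2, and each of them enters the bound on
    the integrals twice.\<close>
  define \<eta> where "\<eta> i = \<epsilon> / 4 * (1 / 2) ^ i" for i :: nat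
  have \<eta>: "\<eta> i > 0" for i using \<epsilon> by (simp add: \<eta>_def)
  define r where "r = rec_nat L (\<lambda>i f t. \<bar>f t - F f (\<eta> i) t\<bar>)"
  define c where "c i = F (r i) (\<eta> i)" for i
  have r0: "r 0 = L" and rS: "r (Suc i) = (\<lambda>t. \<bar>r i t - c i t\<bar>)" for i by (simp_all add: r_def c_def)
  have poly_int: "integrable \<T> p" if "real_polynomial_function p" for p :: "complex \<Rightarrow> real"
    by (intro integrable_circle_continuous continuous_at_imp_continuous_on ballI continuous_real_polymonial_function that)
  have r: "integrable \<T> (r i) \<and> (AE t in \<T>. 0 \<le> r i t)" for i
  proof (induction i)
    case 0
    then show ?case using L by (simp add: r0)
  next
    case (Suc i)
    then have "real_polynomial_function (c i)" unfolding c_def using F \<eta> by blast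
    then show ?case unfolding rS using Suc poly_int by auto
  qed
  have c: "real_polynomial_function (c i)" "\<And>t. cmod t = 1 \<Longrightarrow> 0 \<le> c i t" for i
    unfolding c_def using F r \<eta> by blast+
  have rS_int: "(LINT t|\<T>. r (Suc i) t) < \<eta> i" for i
    unfolding rS using F[of "r i" "\<eta> i"] r \<eta> by (simp add: c_def)
  note ri = conjunct1[OF r] and ci = poly_int[OF c(1)]
  have c_int: "(LINT t|\<T>. c i t) \<le> (LINT t|\<T>. r i t) + (LINT t|\<T>. r (Suc i) t)" for i
  proof -
    have "(LINT t|\<T>. c i t) \<le> (LINT t|\<T>. r i t + r (Suc i) t)"
      unfolding rS using ri ci by (intro integral_mono) auto
    also have "\<dots> = (LINT t|\<T>. r i t) + (LINT t|\<T>. r (Suc i) t)" by (intro Bochner_Integration.integral_add ri)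
    finally show ?thesis .
  qed
  have sum_c: "(\<Sum>i<k. LINT t|\<T>. c i t) \<le> (LINT t|\<T>. L t) + \<epsilon>" for k
  proof -
    \<comment> \<open>The integral of c k is at most that of r k plus that of r (k + 1). Keeping the
      current remainder on the left closes the induction.\<close>
    have "(\<Sum>i<k. LINT t|\<T>. c i t) + (LINT t|\<T>. r k t) \<le> (LINT t|\<T>. L t) + 2 * (\<Sum>i<k. \<eta> i)"
    proof (induction k)
      case 0
      then show ?case by (simp add: r0)
    next
      case (Suc k)
      then show ?case using c_int[of k] rS_int[of k] by simp
    qed
    moreover have "0 \<le> (LINT t|\<T>. r k t)" using r by (intro integral_nonneg_AE) blast
    moreover have "(\<Sum>i<k. \<eta> i) \<le> \<epsilon> / 2"
    proof -
      have "(\<Sum>i<k. \<eta> i) = \<epsilon> / 4 * (\<Sum>i<k. (1 / 2) ^ i)" unfolding \<eta>_def by (simp add: sum_distrib_left)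
      also have "\<dots> = \<epsilon> / 4 * (2 * (1 - (1 / 2) ^ k))" by (subst sum_gp_strict) auto
      also have "\<dots> \<le> \<epsilon> / 4 * 2" using \<epsilon> by (intro mult_left_mono) auto
      finally show ?thesis by simp
    qed
    ultimately show ?thesis by simp
  qed
  have "\<forall>i. \<exists>g. Schur g \<and> (\<forall>t. cmod t = 1 \<longrightarrow> cmod (g t) = exp (- c i t)) \<and>
      disk_value g 0 = of_real (exp (- (LINT t|\<T>. c i t)))"
    using outer_of_polynomial[OF c] by metis
  then obtain g where g: "\<And>i. Schur (g i)" "\<And>i t. cmod t = 1 \<Longrightarrow> cmod (g i t) = exp (- c i t)"
      "\<And>i. disk_value (g i) 0 = of_real (exp (- (LINT t|\<T>. c i t)))" by metis
  have c_nonneg: "0 \<le> (LINT t|\<T>. c i t)" for i using c(2) by (intro integral_nonneg_AE AE_I2) auto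
  have prod_exp: "(\<Prod>i<k. exp (- (LINT t|\<T>. c i t))) = exp (- (\<Sum>i<k. LINT t|\<T>. c i t))" for k
    by (simp add: exp_sum sum_negf[symmetric])
  have low: "exp (- ((LINT t|\<T>. L t) + \<epsilon>)) \<le> (\<Prod>i<k. exp (- (LINT t|\<T>. c i t)))" for k
    unfolding prod_exp using sum_c[of k] by simp
  obtain \<psi> where \<psi>: "Schur \<psi>" "AE t in \<T>. \<forall>k. cmod (\<psi> t) \<le> cmod (\<Prod>i<k. g i t)"
    "\<And>z. cmod z < 1 \<Longrightarrow> (\<lambda>k. \<Prod>i<k. disk_value (g i) z) \<longlonglongrightarrow> disk_value \<psi> z"
    by (rule Schur_infinite_product[OF g(1) g(3) _ _ exp_gt_zero low]) (use c_nonneg in auto)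
  \<comment> \<open>L^1 convergence makes the remainders vanish almost everywhere along a
    subsequence. That is enough, since |\<psi>| lies below every partial product.\<close>
  have "(\<lambda>i. LINT t|\<T>. norm (r (Suc i) t)) \<longlonglongrightarrow> 0"
  proof (rule tendsto_sandwich[OF always_eventually always_eventually tendsto_const])
    show "\<forall>i. 0 \<le> (LINT t|\<T>. norm (r (Suc i) t))" by (intro allI integral_nonneg_AE) auto
    show "\<forall>i. (LINT t|\<T>. norm (r (Suc i) t)) \<le> \<eta> i" using rS_int by (auto simp: rS intro: less_imp_le)
    show "\<eta> \<longlonglongrightarrow> 0" unfolding \<eta>_def by (intro tendsto_mult_right_zero LIMSEQ_realpow_zero) auto
  qed
  then obtain s where s: "strict_mono s" "AE t in \<T>. (\<lambda>i. r (Suc (s i)) t) \<longlonglongrightarrow> 0"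
    using tendsto_L1_AE_subseq[of \<T> "\<lambda>i. r (Suc i)"] ri by blast
  have "AE t in \<T>. cmod (\<psi> t) \<le> exp (- L t)"
    using \<psi>(2) s(2) AE_space
  proof eventually_elim
    case (elim t)
    then have t: "cmod t = 1" by simp
    \<comment> \<open>At each step r k <= c k + |r k - c k|, and the last term is the next
      remainder.\<close>
    have Lr: "L t \<le> (\<Sum>i<k. c i t) + r k t" for k
      by (induction k) (auto simp: r0 rS)
    have "cmod (\<psi> t) \<le> exp (- L t + r (Suc (s i)) t)" for i
    proof -
      let ?k = "Suc (s i)"
      have "cmod (\<psi> t) \<le> cmod (\<Prod>i<?k. g i t)" using elim(1) by blast
      also have "\<dots> = (\<Prod>i<?k. exp (- c i t))" unfolding prod_norm[symmetric] by (simp add: g(2) t)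
      also have "\<dots> = exp (- (\<Sum>i<?k. c i t))" by (subst sum_negf[symmetric]) (simp only: exp_sum finite_lessThan)
      also have "\<dots> \<le> exp (- L t + r ?k t)" using Lr[of ?k] by simp
      finally show ?thesis .
    qed
    moreover have "(\<lambda>i. exp (- L t + r (Suc (s i)) t)) \<longlonglongrightarrow> exp (- L t + 0)"
      using elim(2) by (intro tendsto_intros)
    ultimately have "cmod (\<psi> t) \<le> exp (- L t + 0)"
      by (intro LIMSEQ_le_const[where X = "\<lambda>i. exp (- L t + r (Suc (s i)) t)"]) auto
    then show ?case by simp
  qed
  moreover have "exp (- ((LINT t|\<T>. L t) + \<epsilon>)) \<le> Re (disk_value \<psi> 0)"
  proof (rule LIMSEQ_le_const[OF tendsto_Re[OF \<psi>(3)]])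
    have "Re (\<Prod>i<k. disk_value (g i) 0) = (\<Prod>i<k. exp (- (LINT t|\<T>. c i t)))" for k
      unfolding g(3) of_real_prod[symmetric] Re_complex_of_real ..
    then show "\<exists>N. \<forall>n\<ge>N. exp (- ((LINT t|\<T>. L t) + \<epsilon>)) \<le> Re (\<Prod>i<n. disk_value (g i) 0)"
      using low by auto
  qed simp
  ultimately show ?thesis by (rule that[OF \<psi>(1)])
qed

section \<open>The space \<open>H\<^sup>2(\<alpha>)\<close>\<close>

text \<open>S and \<mu> stand for the symbol and the masses of one \<alpha>_n. The condition on
  log(1 - |R|) enters through the Schur function \<psi> that is handed to the lemmas below.\<close>

locale hankel_data =
  fixes S :: "complex \<Rightarrow> complex" and Z :: "complex set" and \<mu> :: "complex \<Rightarrow> real"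
  assumes S_measurable: "S \<in> borel_measurable \<T>"
    and S_bounded: "cmod t = 1 \<Longrightarrow> cmod (S t) \<le> 1"
    and Z_disk: "Z \<subseteq> ball 0 1"
    and \<mu>_nonneg: "\<zeta> \<in> Z \<Longrightarrow> 0 \<le> \<mu> \<zeta>"
begin

definition point_form :: form where
  "point_form f g = (\<Sum>\<^sub>\<infinity>\<zeta>\<in>Z. disk_value f \<zeta> * cnj (disk_value g \<zeta>) * of_real (\<mu> \<zeta>))"

lemma S_L2: "f \<in> L2 \<Longrightarrow> (\<lambda>t. S t * f t) \<in> L2"
  by (rule L2_bounded_mult[OF _ S_measurable S_bounded])

lemma hankel_in: "f \<in> H2 \<Longrightarrow> hankel S f \<in> H2_minus"
  by (rule hankel_H2_minus[OF S_measurable S_bounded])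

lemma norm2_hankel_le:
  assumes f: "f \<in> H2"
  shows "(norm2 (hankel S f))\<^sup>2 \<le> (norm2 f)\<^sup>2"
proof (intro power_mono L2.nf_nonneg H2_minus_L2 hankel_in f)
  have "norm2 (hankel S f) \<le> norm2 (\<lambda>t. S t * f t)"
    unfolding hankel_def by (intro norm2_orth_proj_le S_L2 H2_L2 f)
  also have "\<dots> \<le> norm2 f"
    using S_bounded f by (intro norm2_mono S_L2 H2_L2 AE_I2) (auto simp: norm_mult mult_left_le_one_le)
  finally show "norm2 (hankel S f) \<le> norm2 f" .
qed

lemma L2_inner_hankel:
  assumes f: "f \<in> H2" and h: "h \<in> H2_minus"
  shows "L2_inner (hankel S f) h = L2_inner (\<lambda>t. S t * f t) h"
proof -
  note Sf = S_L2[OF H2_L2[OF f]]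
  show ?thesis
    using orth_proj_H2_minus(2)[OF Sf h] Sf h hankel_in[OF f]
    by (simp add: hankel_def L2.B_diff H2_minus_L2)
qed

lemma admissibleD: "f \<in> admissible Z \<Longrightarrow> f \<in> H2" "f \<in> admissible Z \<Longrightarrow> finite {\<zeta>\<in>Z. disk_value f \<zeta> \<noteq> 0}"
  by (auto simp: admissible_def)

lemma D_form_eq:
  assumes f: "f \<in> H2" and g: "g \<in> H2"
  shows "D_form S Z \<mu> f g = L2_inner f g - L2_inner (hankel S f) (hankel S g) + point_form f g"
  unfolding D_form_def point_form_def
  using hankel_adjoint[OF S_measurable S_bounded hankel_in[OF f]] f g by (simp add: L2.B_diff H2_L2)

lemma point_form_finite:
  assumes "finite F" "F \<subseteq> Z" "\<And>\<zeta>. \<zeta> \<in> Z - F \<Longrightarrow> disk_value f \<zeta> = 0 \<or> disk_value g \<zeta> = 0"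
  shows "point_form f g = (\<Sum>\<zeta>\<in>F. disk_value f \<zeta> * cnj (disk_value g \<zeta>) * of_real (\<mu> \<zeta>))"
proof -
  have "point_form f g = (\<Sum>\<^sub>\<infinity>\<zeta>\<in>F. disk_value f \<zeta> * cnj (disk_value g \<zeta>) * of_real (\<mu> \<zeta>))"
    unfolding point_form_def by (rule infsum_cong_neutral) (use assms in auto)
  then show ?thesis using assms(1) by simp
qed

lemma point_form_diag:
  assumes "finite F" "F \<subseteq> Z" "\<And>\<zeta>. \<zeta> \<in> Z - F \<Longrightarrow> disk_value f \<zeta> = 0"
  shows "point_form f f = of_real (\<Sum>\<zeta>\<in>F. (cmod (disk_value f \<zeta>))\<^sup>2 * \<mu> \<zeta>)"
proof -
  have "point_form f f = (\<Sum>\<zeta>\<in>F. disk_value f \<zeta> * cnj (disk_value f \<zeta>) * of_real (\<mu> \<zeta>))"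
    by (rule point_form_finite) (use assms in auto)
  then show ?thesis by (simp only: of_real_sum of_real_mult complex_norm_square)
qed

lemma disk_value_Z: 
  assumes "\<zeta> \<in> Z" "f \<in> L2" "g \<in> L2"
  shows "disk_value (\<lambda>t. f t + g t) \<zeta> = disk_value f \<zeta> + disk_value g \<zeta>"
    "disk_value (\<lambda>t. c * f t) \<zeta> = c * disk_value f \<zeta>"
  using assms Z_disk by (auto intro!: disk_value_add disk_value_scale)

sublocale D: semi_inner_space "admissible Z" "D_form S Z \<mu>"
proof
  fix f g h :: "complex \<Rightarrow> complex" and c :: complex
  assume f: "f \<in> admissible Z"
  note fD = admissibleD[OF f]
  show V_scale: "(\<lambda>t. c * f t) \<in> admissible Z"
  proof -
    have "{\<zeta>\<in>Z. disk_value (\<lambda>t. c * f t) \<zeta> \<noteq> 0} \<subseteq> {\<zeta>\<in>Z. disk_value f \<zeta> \<noteq> 0}"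
      using disk_value_Z(2)[OF _ H2_L2[OF fD(1)] H2_L2[OF fD(1)]] by auto
    then show ?thesis using fD finite_subset by (auto simp: admissible_def H2_scale)
  qed
  note norm2_hankel_le[OF fD(1)]
  moreover have "0 \<le> Re (point_form f f)"
  proof -
    have "0 \<le> (\<Sum>\<zeta> | \<zeta> \<in> Z \<and> disk_value f \<zeta> \<noteq> 0. (cmod (disk_value f \<zeta>))\<^sup>2 * \<mu> \<zeta>)"
      using \<mu>_nonneg by (intro sum_nonneg) auto
    then show ?thesis by (subst point_form_diag[OF fD(2)]) auto
  qed
  ultimately show "0 \<le> Re (D_form S Z \<mu> f f)"
    using fD hankel_in[OF fD(1)] by (simp add: D_form_eq L2.B_self H2_L2 H2_minus_L2 flip: of_real_power)
  {
    assume g: "g \<in> admissible Z"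
    note gD = admissibleD[OF g]
    show "(\<lambda>t. f t + g t) \<in> admissible Z"
    proof -
      have "{\<zeta>\<in>Z. disk_value (\<lambda>t. f t + g t) \<zeta> \<noteq> 0} \<subseteq> {\<zeta>\<in>Z. disk_value f \<zeta> \<noteq> 0} \<union> {\<zeta>\<in>Z. disk_value g \<zeta> \<noteq> 0}"
        using disk_value_Z(1)[OF _ H2_L2[OF fD(1)] H2_L2[OF gD(1)]] by auto
      then show ?thesis using fD gD finite_subset by (auto simp: admissible_def H2_add)
    qed
    have "point_form g f = cnj (point_form f g)"
    proof -
      let ?F = "{\<zeta>\<in>Z. disk_value f \<zeta> \<noteq> 0}"
      have "point_form g f = (\<Sum>\<zeta>\<in>?F. disk_value g \<zeta> * cnj (disk_value f \<zeta>) * of_real (\<mu> \<zeta>))"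
        by (rule point_form_finite[OF fD(2)]) auto
      moreover have "point_form f g = (\<Sum>\<zeta>\<in>?F. disk_value f \<zeta> * cnj (disk_value g \<zeta>) * of_real (\<mu> \<zeta>))"
        by (rule point_form_finite[OF fD(2)]) auto
      ultimately show ?thesis by (simp add: mult_ac)
    qed
    then show "D_form S Z \<mu> g f = cnj (D_form S Z \<mu> f g)"
      using L2.B_herm[OF H2_L2[OF fD(1)] H2_L2[OF gD(1)]]
        L2.B_herm[OF H2_minus_L2[OF hankel_in[OF fD(1)]] H2_minus_L2[OF hankel_in[OF gD(1)]]]
      by (simp add: D_form_eq fD gD)
    assume h: "h \<in> admissible Z"
    note hD = admissibleD[OF h]
    note fL = H2_L2[OF fD(1)] and gL = H2_L2[OF gD(1)] and hL = H2_L2[OF hD(1)]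
    have "point_form (\<lambda>t. f t + g t) h = point_form f h + point_form g h"
    proof -
      \<comment> \<open>The finite set is taken from the fixed argument h, so the three sums to be
        compared run over the same points.\<close>
      let ?F = "{\<zeta>\<in>Z. disk_value h \<zeta> \<noteq> 0}"
      have *: "point_form u h = (\<Sum>\<zeta>\<in>?F. disk_value u \<zeta> * cnj (disk_value h \<zeta>) * of_real (\<mu> \<zeta>))" for u
        by (rule point_form_finite[OF hD(2)]) auto
      show ?thesis
        unfolding * sum.distrib[symmetric]
        using disk_value_Z(1)[OF _ fL gL] by (intro sum.cong) (auto simp: algebra_simps)
    qed
    \<comment> \<open>\<open>hankel\<close> is defined by choice and need not be additive as a
      function. Additivity is obtained after pairing with an element of \<open>H2_minus\<close>,
      where S times the argument can replace it.\<close>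
    moreover have "L2_inner (hankel S (\<lambda>t. f t + g t)) (hankel S h) = L2_inner (hankel S f) (hankel S h) + L2_inner (hankel S g) (hankel S h)"
      using fL gL hankel_in[OF hD(1)]
      by (simp add: L2_inner_hankel fD gD H2_add distrib_left L2.B_add S_L2 H2_minus_L2)
    ultimately show "D_form S Z \<mu> (\<lambda>t. f t + g t) h = D_form S Z \<mu> f h + D_form S Z \<mu> g h"
      using fL gL hL by (simp add: D_form_eq fD gD hD H2_add L2.B_add)
  }
  assume h: "h \<in> admissible Z"
  note hD = admissibleD[OF h]
  note fL = H2_L2[OF fD(1)] and hL = H2_L2[OF hD(1)]
  have "point_form (\<lambda>t. c * f t) h = c * point_form f h"
  proof -
    let ?F = "{\<zeta>\<in>Z. disk_value h \<zeta> \<noteq> 0}"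
    have *: "point_form u h = (\<Sum>\<zeta>\<in>?F. disk_value u \<zeta> * cnj (disk_value h \<zeta>) * of_real (\<mu> \<zeta>))" for u
      by (rule point_form_finite[OF hD(2)]) auto
    show ?thesis
      unfolding * sum_distrib_left
      using disk_value_Z(2)[OF _ fL fL] by (intro sum.cong) (auto simp: algebra_simps)
  qed
  moreover have "L2_inner (hankel S (\<lambda>t. c * f t)) (hankel S h) = c * L2_inner (hankel S f) (hankel S h)"
  proof -
    have "(\<lambda>t. S t * (c * f t)) = (\<lambda>t. c * (S t * f t))" by (simp add: mult_ac)
    then show ?thesis
      using fL hankel_in[OF hD(1)]
      by (simp add: L2_inner_hankel fD H2_scale L2.B_scale S_L2 H2_minus_L2)
  qed
  ultimately show "D_form S Z \<mu> (\<lambda>t. c * f t) h = c * D_form S Z \<mu> f h"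
    using fL hL by (simp add: D_form_eq fD hD H2_scale L2.B_scale algebra_simps)
qed

lemma D_norm_sq:
  assumes f: "f \<in> admissible Z" and F: "finite F" "F \<subseteq> Z" "\<And>\<zeta>. \<zeta> \<in> Z - F \<Longrightarrow> disk_value f \<zeta> = 0"
  shows "(D.nf f)\<^sup>2 = (norm2 f)\<^sup>2 - (norm2 (hankel S f))\<^sup>2 + (\<Sum>\<zeta>\<in>F. (cmod (disk_value f \<zeta>))\<^sup>2 * \<mu> \<zeta>)"
proof -
  note fD = admissibleD[OF f]
  have pf: "point_form f f = of_real (\<Sum>\<zeta>\<in>F. (cmod (disk_value f \<zeta>))\<^sup>2 * \<mu> \<zeta>)"
    by (rule point_form_diag) (use F in auto)
  have "complex_of_real ((D.nf f)\<^sup>2) = of_real ((norm2 f)\<^sup>2 - (norm2 (hankel S f))\<^sup>2 + (\<Sum>\<zeta>\<in>F. (cmod (disk_value f \<zeta>))\<^sup>2 * \<mu> \<zeta>))"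
    unfolding D.B_self[OF f, symmetric] D_form_eq[OF fD(1) fD(1)] pf
      L2.B_self[OF H2_L2[OF fD(1)]] L2.B_self[OF H2_minus_L2[OF hankel_in[OF fD(1)]]]
    by (simp only: of_real_add of_real_diff)
  then show ?thesis unfolding of_real_eq_iff .
qed

lemma norm2_hankel_le_D_norm:
  assumes f: "f \<in> admissible Z"
  shows "(norm2 f)\<^sup>2 - (norm2 (hankel S f))\<^sup>2 \<le> (D.nf f)\<^sup>2"
proof -
  let ?F = "{\<zeta>\<in>Z. disk_value f \<zeta> \<noteq> 0}"
  have "(D.nf f)\<^sup>2 = (norm2 f)\<^sup>2 - (norm2 (hankel S f))\<^sup>2 + (\<Sum>\<zeta>\<in>?F. (cmod (disk_value f \<zeta>))\<^sup>2 * \<mu> \<zeta>)"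
    by (rule D_norm_sq[OF f admissibleD(2)[OF f]]) auto
  moreover have "0 \<le> (\<Sum>\<zeta>\<in>?F. (cmod (disk_value f \<zeta>))\<^sup>2 * \<mu> \<zeta>)"
    using \<mu>_nonneg by (intro sum_nonneg) auto
  ultimately show ?thesis by linarith
qed

text \<open>With \<open>p = \<Gamma>f\<close> one has
  \<open>\<parallel>f\<parallel>\<^sup>2 - \<parallel>p\<parallel>\<^sup>2 = \<parallel>f - cnj S * p\<parallel>\<^sup>2 + \<integral> (1 - \<bar>S\<bar>\<^sup>2) \<bar>p\<bar>\<^sup>2\<close>, and \<open>\<psi>(0) f(0)\<close> is the integral of
  \<open>\<psi> * (f - cnj S * p) + \<psi> * cnj S * p\<close>. Moving \<open>cnj \<psi>\<close> onto \<open>p\<close> in the second summand keeps the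
  product in \<open>H2_minus\<close>.\<close>

lemma value_at_origin_bound:
  assumes f: "f \<in> H2" and \<psi>: "Schur \<psi>" and N: "0 \<le> N" "AE t in \<T>. (cmod (\<psi> t))\<^sup>2 \<le> N\<^sup>2 * (1 - (cmod (S t))\<^sup>2)"
  defines "\<tau> \<equiv> norm2 (orth_proj H2_minus (\<lambda>t. S t * (cnj (\<psi> t) / \<psi> t)))"
  shows "cmod (disk_value \<psi> 0) * cmod (disk_value f 0) \<le> (1 + N * \<tau>) * sqrt ((norm2 f)\<^sup>2 - (norm2 (hankel S f))\<^sup>2)"
proof -
  define p where "p = hankel S f"
  have pH: "p \<in> H2_minus" unfolding p_def by (rule hankel_in[OF f])
  note pL = H2_minus_L2[OF pH] and fL = H2_L2[OF f]
  have [measurable]: "\<psi> \<in> borel_measurable \<T>" "S \<in> borel_measurable \<T>" "p \<in> borel_measurable \<T>"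
    using H2_multiplierD(1)[OF SchurD(1)[OF \<psi>]] S_measurable L2_measurable[OF pL] by auto
  have SpL: "(\<lambda>t. cnj (S t) * p t) \<in> L2"
    by (rule L2_bounded_mult[OF pL, where K = 1]) (use S_bounded in auto)
  define G where "G t = f t - cnj (S t) * p t" for t
  have GL: "G \<in> L2" unfolding G_def by (intro L2.V_diff fL SpL)
  define b where "b = (LINT t|\<T>. (1 - (cmod (S t))\<^sup>2) * (cmod (p t))\<^sup>2)"
  have S2: "(cmod (S t))\<^sup>2 \<le> 1" if "cmod t = 1" for t using S_bounded[OF that] by (simp add: power_le_one)
  have b0: "0 \<le> b" unfolding b_def by (intro integral_nonneg_AE AE_I2) (use S2 in auto)
  have i2: "integrable \<T> (\<lambda>t. (cmod (S t))\<^sup>2 * (cmod (p t))\<^sup>2)"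
    using L2_integrable[OF SpL] by (simp add: norm_mult power_mult_distrib)
  have bi: "integrable \<T> (\<lambda>t. (1 - (cmod (S t))\<^sup>2) * (cmod (p t))\<^sup>2)"
    using L2_integrable[OF pL] i2 by (simp add: left_diff_distrib)
  have bsq: "b = (norm2 p)\<^sup>2 - (norm2 (\<lambda>t. cnj (S t) * p t))\<^sup>2"
    unfolding b_def norm2_sq using L2_integrable[OF pL] i2
    by (simp add: left_diff_distrib norm_mult power_mult_distrib)
  \<comment> \<open>The cross term in the expansion of the squared norm of G is the squared norm of
    p, because p is the projection of S * f.\<close>
  have "L2_inner f (\<lambda>t. cnj (S t) * p t) = L2_inner (\<lambda>t. S t * f t) p"
    unfolding L2_inner_def by (simp add: mult_ac)
  also have "\<dots> = L2_inner p p" using L2_inner_hankel[OF f pH] by (simp add: p_def)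
  finally have "(norm2 G)\<^sup>2 = (norm2 f)\<^sup>2 - 2 * (norm2 p)\<^sup>2 + (norm2 (\<lambda>t. cnj (S t) * p t))\<^sup>2"
    using L2.nf_diff_scale[OF fL SpL, of 1] unfolding G_def L2.B_self[OF pL] by simp
  then have D: "(norm2 f)\<^sup>2 - (norm2 p)\<^sup>2 = (norm2 G)\<^sup>2 + b" using bsq by simp
  define E where "E = (norm2 f)\<^sup>2 - (norm2 p)\<^sup>2"
  have E_nonneg: "0 \<le> E" unfolding E_def D using b0 by simp
  have GD: "norm2 G \<le> sqrt E"
    using b0 unfolding E_def D by (intro real_le_rsqrt) simp
  define u where "u t = cnj (\<psi> t) * p t" for t
  have uL: "u \<in> L2" unfolding u_def by (rule L2_bounded_mult[OF pL, where K = 1]) (use SchurD(2)[OF \<psi>] in auto)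
  have uH: "u \<in> H2_minus"
    unfolding H2_minus_def
  proof (safe)
    fix g assume "g \<in> H2"
    then have "(\<lambda>t. \<psi> t * g t) \<in> H2" by (rule H2_multiplierD(2)[OF SchurD(1)[OF \<psi>]])
    moreover have "L2_inner u g = L2_inner p (\<lambda>t. \<psi> t * g t)"
      unfolding L2_inner_def u_def by (simp add: mult_ac)
    ultimately show "L2_inner u g = 0" using H2_minusD[OF pH] by simp
  qed (rule uL)
  \<comment> \<open>The hypothesis on \<psi> trades |\<psi>|^2 for the weight 1 - |S|^2 that defines
    b.\<close>
  have "(norm2 u)\<^sup>2 \<le> N\<^sup>2 * b"
  proof -
    have "(norm2 u)\<^sup>2 \<le> (LINT t|\<T>. N\<^sup>2 * ((1 - (cmod (S t))\<^sup>2) * (cmod (p t))\<^sup>2))"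
      unfolding norm2_sq
    proof (rule integral_mono_AE)
      show "AE t in \<T>. (cmod (u t))\<^sup>2 \<le> N\<^sup>2 * ((1 - (cmod (S t))\<^sup>2) * (cmod (p t))\<^sup>2)"
        using N(2)
      proof eventually_elim
        case (elim t)
        from mult_right_mono[OF elim, of "(cmod (p t))\<^sup>2"] show ?case
          by (simp add: u_def norm_mult power_mult_distrib mult.assoc)
      qed
    qed (use bi L2_integrable[OF uL] in auto)
    then show ?thesis unfolding b_def by simp
  qed
  also have "\<dots> \<le> N\<^sup>2 * E" unfolding E_def D by (intro mult_left_mono) auto
  finally have "norm2 u \<le> sqrt (N\<^sup>2 * E)" by (rule real_le_rsqrt)
  then have uD: "norm2 u \<le> N * sqrt E" using N(1) by (simp add: real_sqrt_mult)
  define \<omega> where "\<omega> t = S t * (cnj (\<psi> t) / \<psi> t)" for t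
  have \<omega>L: "\<omega> \<in> L2"
  proof (rule L2_bounded)
    show "\<omega> \<in> borel_measurable \<T>" unfolding \<omega>_def by measurable
    show "cmod (\<omega> t) \<le> 1" if "cmod t = 1" for t
      using S_bounded[OF that] by (cases "\<psi> t = 0") (auto simp: \<omega>_def norm_mult norm_divide)
  qed
  note P\<omega> = orth_proj_H2_minus[OF \<omega>L]
  note \<psi>L = Schur_L2[OF \<psi>]
  have "disk_value \<psi> 0 * disk_value f 0 = (LINT t|\<T>. \<psi> t * f t)"
    using H2_multiplierD(3)[OF SchurD(1)[OF \<psi>] f, of 0] by (simp add: disk_value_0_integral)
  also have "\<dots> = (LINT t|\<T>. G t * cnj (cnj (\<psi> t)) + u t * cnj (\<omega> t))"
  proof (intro Bochner_Integration.integral_cong refl)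
    fix t
    \<comment> \<open>At a zero of \<psi> the quotient in \<omega> is 0 by convention, and u
      vanishes there as well, so the identity still holds.\<close>
    show "\<psi> t * f t = G t * cnj (cnj (\<psi> t)) + u t * cnj (\<omega> t)"
      by (cases "\<psi> t = 0") (simp_all add: G_def u_def \<omega>_def algebra_simps)
  qed
  also have "\<dots> = L2_inner G (\<lambda>t. cnj (\<psi> t)) + L2_inner u \<omega>"
    unfolding L2_inner_def by (intro Bochner_Integration.integral_add L2_inner_integrable GL L2_cnj \<psi>L uL \<omega>L)
  \<comment> \<open>As u lies in \<open>H2_minus\<close>, it sees only the projection of \<omega>.
    This replaces a factor of norm at most 1 by \<tau>, which is small when S contains a high power
    of t.\<close>
  also have "L2_inner u \<omega> = L2_inner u (orth_proj H2_minus \<omega>)"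
    using P\<omega>(2)[OF uH] L2.B_herm[OF L2.V_diff[OF \<omega>L H2_minus_L2[OF P\<omega>(1)]] uL]
      L2.B_diff_right[OF \<omega>L H2_minus_L2[OF P\<omega>(1)] uL] by simp
  finally have "cmod (disk_value \<psi> 0 * disk_value f 0) \<le> cmod (L2_inner G (\<lambda>t. cnj (\<psi> t))) + cmod (L2_inner u (orth_proj H2_minus \<omega>))"
    by (simp add: norm_triangle_ineq)
  also have "cmod (L2_inner G (\<lambda>t. cnj (\<psi> t))) \<le> norm2 G * norm2 (\<lambda>t. cnj (\<psi> t))"
    by (intro L2.Cauchy_Schwarz GL L2_cnj \<psi>L)
  also have "\<dots> \<le> sqrt E * 1"
    using SchurD(2)[OF \<psi>] E_nonneg by (intro mult_mono GD norm2_bounded L2_cnj \<psi>L L2.nf_nonneg) auto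
  also have "cmod (L2_inner u (orth_proj H2_minus \<omega>)) \<le> norm2 u * norm2 (orth_proj H2_minus \<omega>)"
    by (intro L2.Cauchy_Schwarz uL H2_minus_L2 P\<omega>)
  also have "\<dots> \<le> (N * sqrt E) * \<tau>"
    unfolding \<tau>_def \<omega>_def[symmetric] by (intro mult_right_mono uD L2.nf_nonneg H2_minus_L2 P\<omega>)
  finally show ?thesis
    unfolding E_def p_def[symmetric] by (simp add: norm_mult algebra_simps)
qed

text \<open>For a single n boundedness of the evaluation is all that is asked, so \<tau> may be
  large here; f0 shows that the evaluation is not zero.\<close>

lemma kernel_value:
  assumes \<psi>: "Schur \<psi>" "disk_value \<psi> 0 \<noteq> 0" "0 \<le> N" "AE t in \<T>. (cmod (\<psi> t))\<^sup>2 \<le> N\<^sup>2 * (1 - (cmod (S t))\<^sup>2)"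
    and f0: "f0 \<in> admissible Z" "disk_value f0 0 \<noteq> 0"
  obtains d where "d > 0" "point_eval 0 (normalized_kernel S Z \<mu>) = of_real (1 / sqrt d)"
    "\<And>f. f \<in> admissible Z \<Longrightarrow> d * (cmod (disk_value f 0))\<^sup>2 \<le> (D.nf f)\<^sup>2"
    "\<And>e. e > 0 \<Longrightarrow> \<exists>f\<in>admissible Z. disk_value f 0 = 1 \<and> (D.nf f)\<^sup>2 < d + e"
proof -
  define \<tau> where "\<tau> = norm2 (orth_proj H2_minus (\<lambda>t. S t * (cnj (\<psi> t) / \<psi> t)))"
  define C where "C = (1 + \<bar>N * \<tau>\<bar>) / cmod (disk_value \<psi> 0)"
  interpret bounded_functional "admissible Z" "D_form S Z \<mu>" "\<lambda>f. disk_value f 0" C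
  proof
    fix f g :: "complex \<Rightarrow> complex" and c :: complex
    assume f: "f \<in> admissible Z"
    note fD = admissibleD[OF f]
    show "disk_value (\<lambda>t. c * f t) 0 = c * disk_value f 0" using fD by (simp add: disk_value_scale H2_L2)
    show "cmod (disk_value f 0) \<le> C * D.nf f"
    proof -
      have "cmod (disk_value \<psi> 0) * cmod (disk_value f 0) \<le> (1 + N * \<tau>) * sqrt ((norm2 f)\<^sup>2 - (norm2 (hankel S f))\<^sup>2)"
        unfolding \<tau>_def by (rule value_at_origin_bound[OF fD(1) \<psi>(1,3,4)])
      also have "\<dots> \<le> (1 + \<bar>N * \<tau>\<bar>) * sqrt ((D.nf f)\<^sup>2)"
      proof (rule mult_mono)
        show "0 \<le> sqrt ((norm2 f)\<^sup>2 - (norm2 (hankel S f))\<^sup>2)" using norm2_hankel_le[OF fD(1)] by simp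
        show "sqrt ((norm2 f)\<^sup>2 - (norm2 (hankel S f))\<^sup>2) \<le> sqrt ((D.nf f)\<^sup>2)"
          by (rule real_sqrt_le_mono[OF norm2_hankel_le_D_norm[OF f]])
      qed auto
      also have "sqrt ((D.nf f)\<^sup>2) = D.nf f" using D.nf_nonneg[OF f] by simp
      finally show ?thesis using \<psi>(2) by (simp add: C_def field_simps)
    qed
    assume g: "g \<in> admissible Z"
    show "disk_value (\<lambda>t. f t - g t) 0 = disk_value f 0 - disk_value g 0"
      using fD admissibleD[OF g] by (simp add: disk_value_diff H2_L2)
  qed (use f0 in blast)
  show ?thesis
    by (rule normalized_kernel_value)
      (rule that, auto simp: point_eval_def normalized_kernel_def repr_kernel_def H2_space_def)
qed

end

section \<open>The limit of the kernels\<close>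

lemma circle_measurable_power: "(\<lambda>t. t ^ n) \<in> borel_measurable \<T>"
  by (intro circle_continuous continuous_intros)

lemma suminf_tail_tendsto_zero:
  fixes a :: "nat \<Rightarrow> real"
  assumes "summable a"
  shows "(\<lambda>n. \<Sum>k. a (k + n)) \<longlonglongrightarrow> 0"
proof -
  have "(\<lambda>n. (\<Sum>k. a k) - (\<Sum>k<n. a k)) \<longlonglongrightarrow> (\<Sum>k. a k) - (\<Sum>k. a k)"
    by (intro tendsto_intros summable_LIMSEQ assms)
  then show ?thesis by (simp add: suminf_minus_initial_segment[OF assms])
qed

text \<open>Multiplication by t^n moves all but the frequencies below -n of w out of the negative
  range, so the squared norm of the projection is a tail of a convergent series.\<close>

lemma orth_proj_shift_tendsto:
  assumes w: "w \<in> L2"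
  shows "(\<lambda>n. norm2 (orth_proj H2_minus (\<lambda>t. t ^ n * w t))) \<longlonglongrightarrow> 0"
proof -
  define a where "a k = (cmod (fourier_coeff w (- int (Suc k))))\<^sup>2" for k
  have L: "(\<lambda>t. t ^ n * w t) \<in> L2" for n
    by (rule L2_bounded_mult[OF w, where K = 1])
      (auto simp: norm_power intro: circle_measurable_power)
  have coeff: "(\<lambda>k. a (k + n)) sums (norm2 (orth_proj H2_minus (\<lambda>t. t ^ n * w t)))\<^sup>2" for n
  proof -
    have "fourier_coeff (\<lambda>t. t ^ n * w t) (- int (Suc k)) = fourier_coeff w (- int (Suc (k + n)))" for k
      using fourier_coeff_shift[of "int n" w "- int (Suc k)"] by (simp add: algebra_simps)
    then show ?thesis using orth_proj_H2_minus(4)[OF L, of n] by (simp add: a_def)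
  qed
  have "summable a" using coeff[of 0] by (auto dest: sums_summable)
  then have "(\<lambda>n. \<Sum>k. a (k + n)) \<longlonglongrightarrow> 0" by (rule suminf_tail_tendsto_zero)
  moreover have "(\<Sum>k. a (k + n)) = (norm2 (orth_proj H2_minus (\<lambda>t. t ^ n * w t)))\<^sup>2" for n
    by (rule sums_unique[OF coeff, symmetric])
  ultimately have "(\<lambda>n. (norm2 (orth_proj H2_minus (\<lambda>t. t ^ n * w t)))\<^sup>2) \<longlonglongrightarrow> 0"
    by (simp only:)
  then have "(\<lambda>n. sqrt ((norm2 (orth_proj H2_minus (\<lambda>t. t ^ n * w t)))\<^sup>2)) \<longlonglongrightarrow> sqrt 0"
    by (rule tendsto_real_sqrt)
  then show ?thesis
    using L2.nf_nonneg[OF H2_minus_L2[OF orth_proj_H2_minus(1)[OF L]]] by simp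
qed

section \<open>Schur functions dominated by the weight 1 - |R|^2\<close>

text \<open>Where w > 0, exp of minus the integrand is min(1, (n + 1) sqrt(w)). The integrand is
  eventually 0 at each point, and |ln w| dominates it because ln (n + 1) >= 0.\<close>

lemma log_truncation_tendsto:
  assumes w: "integrable \<T> (\<lambda>t. ln (w t))"
  shows "(\<lambda>n. LINT t|\<T>. max 0 (- ln (real (Suc n)) - ln (w t) / 2)) \<longlonglongrightarrow> 0"
proof -
  have m[measurable]: "(\<lambda>t. ln (w t)) \<in> borel_measurable \<T>" using w by (rule borel_measurable_integrable)
  have "(\<lambda>n. LINT t|\<T>. max 0 (- ln (real (Suc n)) - ln (w t) / 2)) \<longlonglongrightarrow> (LINT t|\<T>. 0)"
  proof (rule integral_dominated_convergence[where w = "\<lambda>t. \<bar>ln (w t)\<bar>"])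
    show "AE t in \<T>. (\<lambda>n. max 0 (- ln (real (Suc n)) - ln (w t) / 2)) \<longlonglongrightarrow> 0"
    proof (rule AE_I2)
      fix t
      have "filterlim (\<lambda>n. ln (real (Suc n))) at_top sequentially"
        by (intro filterlim_compose[OF ln_at_top] filterlim_compose[OF filterlim_real_sequentially filterlim_Suc])
      then have "\<forall>\<^sub>F n in sequentially. - ln (w t) / 2 \<le> ln (real (Suc n))"
        by (simp add: filterlim_at_top)
      then have "\<forall>\<^sub>F n in sequentially. max 0 (- ln (real (Suc n)) - ln (w t) / 2) = 0"
        by eventually_elim simp
      then show "(\<lambda>n. max 0 (- ln (real (Suc n)) - ln (w t) / 2)) \<longlonglongrightarrow> 0" by (rule tendsto_eventually)
    qed
    show "AE t in \<T>. norm (max 0 (- ln (real (Suc n)) - ln (w t) / 2)) \<le> \<bar>ln (w t)\<bar>" for n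
    proof (rule AE_I2)
      fix t
      have "\<bar>max 0 (- a - b / 2)\<bar> \<le> \<bar>b\<bar>" if "0 \<le> a" for a b :: real
        using that by (auto simp: max_def abs_if)
      from this[of "ln (real (Suc n))" "ln (w t)"]
      show "norm (max 0 (- ln (real (Suc n)) - ln (w t) / 2)) \<le> \<bar>ln (w t)\<bar>" by simp
    qed
  qed (use w in auto)
  then show ?thesis by simp
qed

lemma bounding_Schur_function:
  assumes R: "R \<in> borel_measurable \<T>" "\<And>t. cmod t = 1 \<Longrightarrow> cmod (R t) \<le> 1"
    and log: "log_in_L1 (\<lambda>t. 1 - cmod (R t))" and c: "c < 1"
  obtains \<psi> N where "Schur \<psi>" "0 \<le> N" "AE t in \<T>. (cmod (\<psi> t))\<^sup>2 \<le> N\<^sup>2 * (1 - (cmod (R t))\<^sup>2)"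
    "c < cmod (disk_value \<psi> 0)"
proof -
  define w where "w t = 1 - cmod (R t)" for t
  have w: "AE t in \<T>. 0 < w t" "integrable \<T> (\<lambda>t. ln (w t))"
    using log by (auto simp: log_in_L1_def w_def)
  have lnm: "(\<lambda>t. ln (w t)) \<in> borel_measurable \<T>" using w(2) by (rule borel_measurable_integrable)
  \<comment> \<open>Chosen so that |\<psi>| <= exp (- L n) means |\<psi>| <= 1 together with
    |\<psi>|^2 <= (n + 1)^2 w wherever w > 0.\<close>
  define L where "L n t = max 0 (- ln (real (Suc n)) - ln (w t) / 2)" for n t
  have L_int: "integrable \<T> (L n)" for n
    unfolding L_def using w(2) by auto
  have "(\<lambda>n. exp (- ((LINT t|\<T>. L n t) + 1 / real (Suc n)))) \<longlonglongrightarrow> exp (- (0 + 0))"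
    unfolding L_def
    by (intro tendsto_intros log_truncation_tendsto w LIMSEQ_inverse_real_of_nat[unfolded inverse_eq_divide])
  then have "\<forall>\<^sub>F n in sequentially. c < exp (- ((LINT t|\<T>. L n t) + 1 / real (Suc n)))"
    using c by (intro order_tendstoD) auto
  then obtain n where n: "c < exp (- ((LINT t|\<T>. L n t) + 1 / real (Suc n)))"
    by (auto simp: eventually_sequentially)
  obtain \<psi> where \<psi>: "Schur \<psi>" "AE t in \<T>. cmod (\<psi> t) \<le> exp (- L n t)"
    "exp (- ((LINT t|\<T>. L n t) + 1 / real (Suc n))) \<le> Re (disk_value \<psi> 0)"
    by (rule analytic_minorant[OF L_int, of n "1 / real (Suc n)"]) (auto simp: L_def)
  define N where "N = real (Suc n)"
  have "AE t in \<T>. (cmod (\<psi> t))\<^sup>2 \<le> N\<^sup>2 * (1 - (cmod (R t))\<^sup>2)"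
    using \<psi>(2) w(1) AE_space
  proof eventually_elim
    case (elim t)
    have "(cmod (\<psi> t))\<^sup>2 \<le> (exp (ln N + ln (w t) / 2))\<^sup>2"
    proof (rule power_mono)
      have "- L n t \<le> ln N + ln (w t) / 2" by (simp add: L_def N_def max_def)
      then show "cmod (\<psi> t) \<le> exp (ln N + ln (w t) / 2)" using elim(1) by (meson exp_le_cancel_iff order_trans)
    qed simp
    also have "\<dots> = (exp (ln N))\<^sup>2 * exp (ln (w t))"
      by (simp add: exp_add power_mult_distrib flip: exp_double)
    also have "\<dots> = N\<^sup>2 * w t" using elim(2) by (simp add: N_def)
    \<comment> \<open>Since |R| <= 1, passing from 1 - |R| to 1 - |R|^2 only enlarges the
      weight.\<close>
    also have "\<dots> \<le> N\<^sup>2 * (1 - (cmod (R t))\<^sup>2)"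
      using R(2)[of t] elim(3) by (intro mult_left_mono) (auto simp: w_def power2_eq_square mult_left_le)
    finally show ?case .
  qed
  moreover have "c < cmod (disk_value \<psi> 0)"
    using n \<psi>(3) complex_Re_le_cmod[of "disk_value \<psi> 0"] by linarith
  ultimately show ?thesis using that[OF \<psi>(1), of N] by (simp add: N_def)
qed

lemma summable_on_small_tail:
  fixes f :: "'a \<Rightarrow> real"
  assumes "f summable_on Z" "\<And>x. x \<in> Z \<Longrightarrow> 0 \<le> f x" "0 < \<epsilon>"
  obtains F where "finite F" "F \<subseteq> Z" "\<And>I. finite I \<Longrightarrow> I \<subseteq> Z - F \<Longrightarrow> sum f I \<le> \<epsilon>"
proof -
  have "(sum f \<longlongrightarrow> infsum f Z) (finite_subsets_at_top Z)"
    using has_sum_infsum[OF assms(1)] by (simp add: has_sum_def)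
  then have "\<forall>\<^sub>F F in finite_subsets_at_top Z. dist (sum f F) (infsum f Z) < \<epsilon>"
    using assms(3) by (rule tendstoD)
  then obtain F where F: "finite F" "F \<subseteq> Z" "dist (sum f F) (infsum f Z) < \<epsilon>"
    by (auto simp: eventually_finite_subsets_at_top)
  have "sum f I \<le> \<epsilon>" if I: "finite I" "I \<subseteq> Z - F" for I
  proof -
    have "sum f F + sum f I = sum f (F \<union> I)" using I F by (subst sum.union_disjoint) auto
    also have "\<dots> \<le> infsum f Z" using I F assms by (intro finite_sum_le_infsum) auto
    finally show ?thesis using F(3) by (simp add: dist_real_def)
  qed
  with F that show ?thesis by blast
qed

theorem mainTheorem1:
  fixes R :: "complex \<Rightarrow> complex" and Z :: "complex set" and \<nu> :: "complex \<Rightarrow> real"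
  assumes "R \<in> borel_measurable circle_measure"
    and "\<forall>t\<in>sphere 0 1. cmod (R t) \<le> 1"
    and "log_in_L1 (\<lambda>t. 1 - cmod (R t))"
    and "Z \<subseteq> ball 0 1 - {0}"
    and "countable Z"
    and "(\<lambda>\<zeta>. 1 - cmod \<zeta>) summable_on Z"
    and "\<forall>\<zeta>\<in>Z. \<nu> \<zeta> > 0"
  shows "(\<lambda>n. point_eval 0
            (normalized_kernel (\<lambda>t. t ^ n * R t) Z (\<lambda>\<zeta>. cmod \<zeta> ^ (2 * n) * \<nu> \<zeta>)))
         \<longlonglongrightarrow> 1"
proof -
  define S where "S n t = t ^ n * R t" for n and t :: complex
  define \<mu> where "\<mu> n \<zeta> = cmod \<zeta> ^ (2 * n) * \<nu> \<zeta>" for n \<zeta>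
  have R1: "cmod (R t) \<le> 1" if "cmod t = 1" for t using assms(2) that by simp
  have SR: "cmod (S n t) = cmod (R t)" if "cmod t = 1" for n t
    using that by (simp add: S_def norm_mult norm_power)
  have S_meas: "S n \<in> borel_measurable \<T>" for n
    unfolding S_def by (intro borel_measurable_times circle_measurable_power assms(1))
  interpret H: hankel_data "S n" Z "\<mu> n" for n
    by standard (use S_meas SR R1 assms(4,7) in \<open>auto simp: \<mu>_def less_imp_le\<close>)

  have blaschke: "\<exists>F \<phi>. finite F \<and> F \<subseteq> Z \<and> Schur \<phi> \<and> (\<forall>\<zeta>\<in>Z - F. disk_value \<phi> \<zeta> = 0) \<and> 1 - \<epsilon> \<le> cmod (disk_value \<phi> 0)"
    if \<epsilon>: "0 < \<epsilon>" "\<epsilon> < 1" for \<epsilon>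
  proof -
    obtain F where F: "finite F" "F \<subseteq> Z" "\<And>I. finite I \<Longrightarrow> I \<subseteq> Z - F \<Longrightarrow> (\<Sum>\<zeta>\<in>I. 1 - cmod \<zeta>) \<le> \<epsilon>"
      by (rule summable_on_small_tail[OF assms(6) _ \<epsilon>(1)]) (use assms(4) in \<open>auto simp: less_imp_le\<close>)
    obtain \<phi> where "Schur \<phi>" "\<And>\<zeta>. \<zeta> \<in> Z - F \<Longrightarrow> disk_value \<phi> \<zeta> = 0" "1 - \<epsilon> \<le> Re (disk_value \<phi> 0)"
      by (rule blaschke_product_exists[of "Z - F", OF _ _ \<epsilon>(2) F(3)]) (use assms(4,5) in auto)
    then show ?thesis using F(1,2) complex_Re_le_cmod[of "disk_value \<phi> 0"] by (meson order_trans)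
  qed
  have adm: "\<phi> \<in> admissible Z" if "finite F" "Schur \<phi>" "\<forall>\<zeta>\<in>Z - F. disk_value \<phi> \<zeta> = 0" for F \<phi>
  proof -
    have "{\<zeta>\<in>Z. disk_value \<phi> \<zeta> \<noteq> 0} \<subseteq> F" using that(3) by auto
    then show ?thesis
      using that finite_subset by (auto simp: admissible_def intro: H2_multiplier_H2 SchurD)
  qed

  have "\<exists>d>0. point_eval 0 (normalized_kernel (S n) Z (\<mu> n)) = of_real (1 / sqrt d) \<and>
      (\<forall>f\<in>admissible Z. d * (cmod (disk_value f 0))\<^sup>2 \<le> (H.D.nf n f)\<^sup>2) \<and>
      (\<forall>e>0. \<exists>f\<in>admissible Z. disk_value f 0 = 1 \<and> (H.D.nf n f)\<^sup>2 < d + e)" for n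
  proof -
    \<comment> \<open>The value 1 / 2 only serves to make \<phi> nonzero at the origin, so that some
      admissible function does not vanish there.\<close>
    obtain F \<phi> where \<phi>: "finite F" "Schur \<phi>" "\<forall>\<zeta>\<in>Z - F. disk_value \<phi> \<zeta> = 0" "1 - 1 / 2 \<le> cmod (disk_value \<phi> 0)"
      using blaschke[of "1 / 2"] by auto
    obtain \<psi> N where \<psi>: "Schur \<psi>" "0 \<le> N" "AE t in \<T>. (cmod (\<psi> t))\<^sup>2 \<le> N\<^sup>2 * (1 - (cmod (R t))\<^sup>2)"
      "0 < cmod (disk_value \<psi> 0)"
      by (rule bounding_Schur_function[OF assms(1) R1 assms(3) zero_less_one])
    have ae: "AE t in \<T>. (cmod (\<psi> t))\<^sup>2 \<le> N\<^sup>2 * (1 - (cmod (S n t))\<^sup>2)"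
      using \<psi>(3) AE_space by eventually_elim (simp add: SR)
    obtain d where "d > 0" "point_eval 0 (normalized_kernel (S n) Z (\<mu> n)) = of_real (1 / sqrt d)"
      "\<And>f. f \<in> admissible Z \<Longrightarrow> d * (cmod (disk_value f 0))\<^sup>2 \<le> (H.D.nf n f)\<^sup>2"
      "\<And>e. e > 0 \<Longrightarrow> \<exists>f\<in>admissible Z. disk_value f 0 = 1 \<and> (H.D.nf n f)\<^sup>2 < d + e"
      by (rule H.kernel_value[OF \<psi>(1) _ \<psi>(2) ae adm[OF \<phi>(1,2,3)]]) (use \<psi>(4) \<phi>(4) in auto)
    then show ?thesis by blast
  qed
  \<comment> \<open>\<open>d n\<close> is the infimum of the squared D-norm over admissible
    functions with value 1 at the origin. The rest of the proof shows that it tends to 1.\<close>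
  then obtain d where d: "\<And>n. d n > 0"
    and val: "\<And>n. point_eval 0 (normalized_kernel (S n) Z (\<mu> n)) = of_real (1 / sqrt (d n))"
    and d_le: "\<And>n f. f \<in> admissible Z \<Longrightarrow> d n * (cmod (disk_value f 0))\<^sup>2 \<le> (H.D.nf n f)\<^sup>2"
    and near: "\<And>n e. e > 0 \<Longrightarrow> \<exists>f\<in>admissible Z. disk_value f 0 = 1 \<and> (H.D.nf n f)\<^sup>2 < d n + e"
    by metis

  have lower: "\<forall>\<^sub>F n in sequentially. c < 1 / sqrt (d n)" if c: "c < 1" for c
  proof -
    define \<epsilon> where "\<epsilon> = min (1 / 2) ((1 - c) / 2)"
    have \<epsilon>: "0 < \<epsilon>" "\<epsilon> < 1" "c < 1 - \<epsilon>" using c by (auto simp: \<epsilon>_def min_def field_simps)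
    obtain F \<phi> where F: "finite F" "F \<subseteq> Z" and \<phi>: "Schur \<phi>" "\<forall>\<zeta>\<in>Z - F. disk_value \<phi> \<zeta> = 0" "1 - \<epsilon> \<le> cmod (disk_value \<phi> 0)"
      using blaschke[OF \<epsilon>(1,2)] by blast
    note \<phi>A = adm[OF F(1) \<phi>(1,2)]
    define s where "s n = (\<Sum>\<zeta>\<in>F. (cmod (disk_value \<phi> \<zeta>))\<^sup>2 * \<mu> n \<zeta>)" for n
    \<comment> \<open>F and \<phi> are fixed before n. Each of the finitely many masses carries a
      factor |\<zeta>|^(2n) with |\<zeta>| < 1, however large \<nu> is.\<close>
    have "s \<longlonglongrightarrow> (\<Sum>\<zeta>\<in>F. (cmod (disk_value \<phi> \<zeta>))\<^sup>2 * (0 * \<nu> \<zeta>))"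
      unfolding s_def \<mu>_def power_mult
    proof (intro tendsto_sum tendsto_mult tendsto_const LIMSEQ_realpow_zero)
      fix \<zeta> assume "\<zeta> \<in> F"
      then have "cmod \<zeta> < 1" using F(2) assms(4) by auto
      then show "(cmod \<zeta>)\<^sup>2 < 1" by (simp add: power_less_one_iff)
    qed simp
    then have s0: "s \<longlonglongrightarrow> 0" by simp
    have s_nonneg: "0 \<le> s n" for n
      unfolding s_def by (intro sum_nonneg mult_nonneg_nonneg H.\<mu>_nonneg) (use F(2) in auto)
    have bound: "(1 - \<epsilon>) / sqrt (1 + s n) \<le> 1 / sqrt (d n)" for n
    proof -
      have n1: "norm2 \<phi> \<le> 1" by (rule norm2_bounded[OF Schur_L2[OF \<phi>(1)] SchurD(2)[OF \<phi>(1)]])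
      have "d n * (1 - \<epsilon>)\<^sup>2 \<le> d n * (cmod (disk_value \<phi> 0))\<^sup>2"
        using \<phi>(3) \<epsilon> d[of n] by (intro mult_left_mono power_mono) auto
      also have "\<dots> \<le> (H.D.nf n \<phi>)\<^sup>2" by (rule d_le[OF \<phi>A])
      also have "\<dots> = (norm2 \<phi>)\<^sup>2 - (norm2 (hankel (S n) \<phi>))\<^sup>2 + s n"
        unfolding s_def by (rule H.D_norm_sq[OF \<phi>A F]) (use \<phi>(2) in auto)
      also have "\<dots> \<le> 1 + s n"
        using power_le_one[OF L2.nf_nonneg[OF Schur_L2[OF \<phi>(1)]] n1, of 2] zero_le_power2[of "norm2 (hankel (S n) \<phi>)"] by linarith
      finally have "sqrt (d n * (1 - \<epsilon>)\<^sup>2) \<le> sqrt (1 + s n)" by (rule real_sqrt_le_mono)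
      then have "sqrt (d n) * (1 - \<epsilon>) \<le> sqrt (1 + s n)" using \<epsilon> by (simp add: real_sqrt_mult)
      moreover have "0 < sqrt (d n)" "0 < sqrt (1 + s n)" using d[of n] s_nonneg[of n] by (auto simp: add_pos_nonneg)
      ultimately show ?thesis by (simp add: field_simps)
    qed
    have "(\<lambda>n. (1 - \<epsilon>) / sqrt (1 + s n)) \<longlonglongrightarrow> (1 - \<epsilon>) / sqrt (1 + 0)"
      by (intro tendsto_intros s0) simp
    then have "\<forall>\<^sub>F n in sequentially. c < (1 - \<epsilon>) / sqrt (1 + s n)"
      using \<epsilon>(3) by (intro order_tendstoD) auto
    then show ?thesis by eventually_elim (use bound less_le_trans in blast)
  qed

  have upper: "\<forall>\<^sub>F n in sequentially. 1 / sqrt (d n) < c" if c: "1 < c" for c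
  proof -
    obtain \<psi> N where \<psi>: "Schur \<psi>" "0 \<le> N" "AE t in \<T>. (cmod (\<psi> t))\<^sup>2 \<le> N\<^sup>2 * (1 - (cmod (R t))\<^sup>2)"
      "1 / c < cmod (disk_value \<psi> 0)"
      by (rule bounding_Schur_function[OF assms(1) R1 assms(3), of "1 / c"]) (use c in auto)
    define q where "q = cmod (disk_value \<psi> 0)"
    have "0 < 1 / c" using c by simp
    then have q: "0 < q" using \<psi>(4) unfolding q_def[symmetric] by linarith
    then have qc: "1 / q < c" using \<psi>(4) c unfolding q_def[symmetric] by (simp add: field_simps)
    \<comment> \<open>Independent of n, because \<psi> is chosen from |R| alone; t^n multiplies w
      from outside.\<close>
    define w where "w t = R t * (cnj (\<psi> t) / \<psi> t)" for t
    have w: "w \<in> L2"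
    proof (rule L2_bounded)
      show "w \<in> borel_measurable \<T>"
        unfolding w_def using assms(1) H2_multiplierD(1)[OF SchurD(1)[OF \<psi>(1)]] by measurable
      show "cmod (w t) \<le> 1" if "cmod t = 1" for t
        using R1[OF that] by (cases "\<psi> t = 0") (auto simp: w_def norm_mult norm_divide)
    qed
    define \<tau> where "\<tau> n = norm2 (orth_proj H2_minus (\<lambda>t. t ^ n * w t))" for n
    have \<tau>0: "\<tau> \<longlonglongrightarrow> 0" unfolding \<tau>_def by (rule orth_proj_shift_tendsto[OF w])
    have L: "(\<lambda>t. t ^ n * w t) \<in> L2" for n
      by (rule L2_bounded_mult[OF w, where K = 1])
        (auto simp: norm_power intro: circle_measurable_power)
    have \<tau>_nonneg: "0 \<le> \<tau> n" for n
      unfolding \<tau>_def by (intro L2.nf_nonneg H2_minus_L2 orth_proj_H2_minus(1) L)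
    have bound: "1 / sqrt (d n) \<le> (1 + N * \<tau> n) / q" for n
    proof -
      have ae: "AE t in \<T>. (cmod (\<psi> t))\<^sup>2 \<le> N\<^sup>2 * (1 - (cmod (S n t))\<^sup>2)"
        using \<psi>(3) AE_space by eventually_elim (simp add: SR)
      have "q\<^sup>2 \<le> (1 + N * \<tau> n)\<^sup>2 * d n"
      proof (rule field_le_epsilon)
        fix e :: real assume e: "0 < e"
        \<comment> \<open>The infimum need not be attained by an admissible function, so a
          near-minimizer is used; e' is scaled so that the final error is exactly e.\<close>
        define e' where "e' = e / (1 + N * \<tau> n)\<^sup>2"
        have pos: "0 < 1 + N * \<tau> n" using \<psi>(2) \<tau>_nonneg[of n] by (simp add: add_pos_nonneg)
        then have "0 < e'" using e by (simp add: e'_def)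
        then obtain f where f: "f \<in> admissible Z" "disk_value f 0 = 1" "(H.D.nf n f)\<^sup>2 < d n + e'"
          using near by blast
        note fH = H.admissibleD(1)[OF f(1)]
        have "(\<lambda>t. S n t * (cnj (\<psi> t) / \<psi> t)) = (\<lambda>t. t ^ n * w t)" by (simp add: S_def w_def mult.assoc)
        then have "q \<le> (1 + N * \<tau> n) * sqrt ((norm2 f)\<^sup>2 - (norm2 (hankel (S n) f))\<^sup>2)"
          using H.value_at_origin_bound[OF fH \<psi>(1,2) ae] by (simp add: f(2) q_def \<tau>_def)
        also have "\<dots> \<le> (1 + N * \<tau> n) * sqrt (d n + e')"
          using H.norm2_hankel_le_D_norm[OF f(1), of n] f(3) pos
          by (intro mult_left_mono real_sqrt_le_mono) auto
        finally have "q\<^sup>2 \<le> ((1 + N * \<tau> n) * sqrt (d n + e'))\<^sup>2" using q by (intro power_mono) auto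
        also have "\<dots> = (1 + N * \<tau> n)\<^sup>2 * (d n + e')" using d[of n] \<open>0 < e'\<close> by (simp add: power_mult_distrib)
        also have "\<dots> = (1 + N * \<tau> n)\<^sup>2 * d n + e" using pos by (simp add: e'_def distrib_left)
        finally show "q\<^sup>2 \<le> (1 + N * \<tau> n)\<^sup>2 * d n + e" .
      qed
      then have "sqrt (q\<^sup>2) \<le> sqrt ((1 + N * \<tau> n)\<^sup>2 * d n)" by (rule real_sqrt_le_mono)
      then have "q \<le> (1 + N * \<tau> n) * sqrt (d n)"
        using q \<psi>(2) \<tau>_nonneg[of n] by (simp add: real_sqrt_mult)
      then show ?thesis using q d[of n] by (simp add: field_simps)
    qed
    have "(\<lambda>n. (1 + N * \<tau> n) / q) \<longlonglongrightarrow> (1 + N * 0) / q"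
      using q by (intro tendsto_intros \<tau>0) auto
    then have "\<forall>\<^sub>F n in sequentially. (1 + N * \<tau> n) / q < c"
      using qc by (intro order_tendstoD) auto
    then show ?thesis by eventually_elim (use bound le_less_trans in blast)
  qed

  have "(\<lambda>n. 1 / sqrt (d n)) \<longlonglongrightarrow> 1"
    using lower upper by (intro order_tendstoI)
  then have "(\<lambda>n. complex_of_real (1 / sqrt (d n))) \<longlonglongrightarrow> of_real 1"
    by (rule tendsto_of_real)
  then have "(\<lambda>n. point_eval 0 (normalized_kernel (S n) Z (\<mu> n))) \<longlonglongrightarrow> 1"
    by (simp only: val of_real_1)
  then show ?thesis unfolding S_def \<mu>_def .
qed

end
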